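(* Let $\alpha$ be an ergodic action of a compact quantum group $\mathcal{G}=(A,\Delta)$ on a compact Hausdorff space $X$ with infinitely many points. Then the unique $\alpha$-invariant measure $\mu$ of $X$ is non-atomic; that is, $\mu(\{x\})=0$ for every $x\in X$.
   Context: $\otimes$ denotes the minimal tensor product of $C^*$-algebras. A compact quantum group $\mathcal{G}$ is a pair $(A,\Delta)$ with $A$ a unital $C^*$-algebra and $\Delta:A\to A\otimes A$ a unital $*$-homomorphism such that $(id\otimes\Delta)\Delta=(\Delta\otimes id)\Delta$ and the linear spans of $\Delta(A)(1\otimes A)$ and of $\Delta(A)(A\otimes 1)$ are dense in $A\otimes A$. An action of $\mathcal{G}$ on a compact Hausdorff space $X$ is a unital $*$-homomorphism $\alpha:B\to B\otimes A$, where $B=C(X)$, with $(\alpha\otimes id)\alpha=(id\otimes\Delta)\alpha$ and such that the linear span of $\alpha(B)(1\otimes A)$ is dense in $B\otimes A$. The action is ergodic if $\{b\in B:\alpha(b)=b\otimes 1\}=\mathbb{C}1_B$. A state $\mu$ on $B$ is $\alpha$-invariant if $(\mu\otimes id)\alpha(f)=\mu(f)1_A$ for all $f\in B$; an $\alpha$-invariant measure is the regular Borel probability measure on $X$ corresponding (via the Riesz representation theorem) to an $\alpha$-invariant state. When $\alpha$ is ergodic there is exactly one $\alpha$-invariant state. *)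

theory Defs
  imports "HOL-Probability.Probability_Measure"
begin

section \<open>Unital C*-algebras\<close>

class cstar_algebra = real_normed_algebra_1 + banach +
  fixes scaleC :: "complex \<Rightarrow> 'a \<Rightarrow> 'a"  (infixr \<open>*\<^sub>C\<close> 75)
    and star :: "'a \<Rightarrow> 'a"
  assumes scaleC_add_right: "c *\<^sub>C (x + y) = c *\<^sub>C x + c *\<^sub>C y"
    and scaleC_add_left: "(c + d) *\<^sub>C x = c *\<^sub>C x + d *\<^sub>C x"
    and scaleC_scaleC: "c *\<^sub>C d *\<^sub>C x = (c * d) *\<^sub>C x"
    and scaleC_of_real: "complex_of_real r *\<^sub>C x = r *\<^sub>R x"
    and mult_scaleC_left: "(c *\<^sub>C x) * y = c *\<^sub>C (x * y)"
    and mult_scaleC_right: "x * (c *\<^sub>C y) = c *\<^sub>C (x * y)"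
    and norm_scaleC: "norm (c *\<^sub>C x) = cmod c * norm x"
    and star_star: "star (star x) = x"
    and star_add: "star (x + y) = star x + star y"
    and star_scaleC: "star (c *\<^sub>C x) = cnj c *\<^sub>C star x"
    and star_mult: "star (x * y) = star y * star x"
    and cstar_identity: "norm (star x * x) = (norm x)\<^sup>2"

lemma vector_space_scaleC: "vector_space (scaleC :: complex \<Rightarrow> 'a::cstar_algebra \<Rightarrow> 'a)"
proof
  fix x :: 'a
  show "1 *\<^sub>C x = x"
    using scaleC_of_real[of 1 x] by simp
qed (simp_all add: scaleC_add_right scaleC_add_left scaleC_scaleC)

global_interpretation complex_vector:
  vector_space "scaleC :: complex \<Rightarrow> 'a::cstar_algebra \<Rightarrow> 'a"
  defines cspan = complex_vector.span
  by (rule vector_space_scaleC)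

lemma star_one: "star (1::'a::cstar_algebra) = 1"
  by (metis mult_1_left mult_1_right star_mult star_star)

lemma norm_star: "norm (star x) = norm (x::'a::cstar_algebra)"
proof -
  have le: "norm y \<le> norm (star y)" for y :: 'a
  proof (cases "norm y = 0")
    case False
    have "norm y * norm y \<le> norm (star y) * norm y"
      using norm_mult_ineq[of "star y" y] by (simp add: cstar_identity power2_eq_square)
    with False show ?thesis by simp
  qed simp
  show ?thesis
    using le[of x] le[of "star x"] by (simp add: star_star)
qed

instantiation complex :: cstar_algebra
begin

definition scaleC_complex :: "complex \<Rightarrow> complex \<Rightarrow> complex"
  where "scaleC_complex c x = c * x"

definition star_complex :: "complex \<Rightarrow> complex"
  where "star_complex x = cnj x"

instance
  by standard
    (simp_all add: scaleC_complex_def star_complex_def algebra_simps norm_mult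
      scaleR_conv_of_real power2_eq_square)

end

text \<open>\<open>'x cfun\<close> is \<open>C(X)\<close> for the compact space \<open>X = 'x\<close>, with pointwise operations and the
  supremum norm. The boundedness condition is automatic for compact \<open>X\<close>; it makes the type a
  C*-algebra for every \<open>X\<close>. The library type \<^typ>\<open>'x \<Rightarrow>\<^sub>C complex\<close> cannot be used, because its
  completeness is declared for metric \<open>X\<close> only.\<close>

typedef (overloaded) 'x cfun =
  "{f :: 'x::topological_space \<Rightarrow> complex. continuous_on UNIV f \<and> bounded (range f)}"
  morphisms apply_cfun Abs_cfun
  by (rule exI[of _ "\<lambda>_. 0"]) (auto simp: image_constant_conv)

setup_lifting type_definition_cfun

lemma continuous_on_apply_cfun: "continuous_on UNIV (apply_cfun f)"
  and bounded_apply_cfun: "bounded (range (apply_cfun f))"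
  using apply_cfun[of f] by auto

lemma cfun_eqI: "(\<And>x. apply_cfun f x = apply_cfun g x) \<Longrightarrow> f = g"
  by transfer auto

instantiation cfun :: (topological_space) real_normed_algebra_1
begin

lift_definition zero_cfun :: "'a cfun" is "\<lambda>_. 0"
  by (auto simp: image_constant_conv)

lift_definition one_cfun :: "'a cfun" is "\<lambda>_. 1"
  by (auto simp: image_constant_conv)

lift_definition plus_cfun :: "'a cfun \<Rightarrow> 'a cfun \<Rightarrow> 'a cfun" is "\<lambda>f g x. f x + g x"
  by (auto intro: continuous_on_add bounded_plus_comp)

lift_definition minus_cfun :: "'a cfun \<Rightarrow> 'a cfun \<Rightarrow> 'a cfun" is "\<lambda>f g x. f x - g x"
  by (auto intro: continuous_on_diff bounded_minus_comp)

lift_definition uminus_cfun :: "'a cfun \<Rightarrow> 'a cfun" is "\<lambda>f x. - f x"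
  by (auto simp: bounded_iff intro: continuous_on_minus)

lift_definition times_cfun :: "'a cfun \<Rightarrow> 'a cfun \<Rightarrow> 'a cfun" is "\<lambda>f g x. f x * g x"
proof -
  fix f g :: "'a \<Rightarrow> complex"
  assume f: "continuous_on UNIV f \<and> bounded (range f)"
    and g: "continuous_on UNIV g \<and> bounded (range g)"
  from f g obtain B C where "\<And>x. norm (f x) \<le> B" "\<And>x. norm (g x) \<le> C"
    unfolding bounded_iff by auto
  then have "norm (f x * g x) \<le> B * C" for x
    by (meson mult_mono norm_ge_zero norm_mult_ineq order_trans)
  then show "continuous_on UNIV (\<lambda>x. f x * g x) \<and> bounded (range (\<lambda>x. f x * g x))"
    using f g unfolding bounded_iff by (auto intro: continuous_on_mult)
qed

lift_definition scaleR_cfun :: "real \<Rightarrow> 'a cfun \<Rightarrow> 'a cfun" is "\<lambda>r f x. complex_of_real r * f x"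
  by (auto simp: bounded_iff norm_mult intro!: continuous_on_mult_left)
    (meson mult_left_mono abs_ge_zero)

lift_definition norm_cfun :: "'a cfun \<Rightarrow> real" is "\<lambda>f. SUP x. cmod (f x)" .

definition dist_cfun :: "'a cfun \<Rightarrow> 'a cfun \<Rightarrow> real"
  where "dist_cfun f g = norm (f - g)"

definition sgn_cfun :: "'a cfun \<Rightarrow> 'a cfun"
  where "sgn_cfun f = inverse (norm f) *\<^sub>R f"

definition uniformity_cfun :: "('a cfun \<times> 'a cfun) filter"
  where "uniformity_cfun = (INF e\<in>{0<..}. principal {(f, g). dist f g < e})"

definition open_cfun :: "'a cfun set \<Rightarrow> bool"
  where "open_cfun U \<longleftrightarrow> (\<forall>f\<in>U. \<forall>\<^sub>F (f', g) in uniformity. f' = f \<longrightarrow> g \<in> U)"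

lemma cmod_apply_cfun_le: "cmod (apply_cfun f x) \<le> norm f" for f :: "'a cfun"
proof transfer
  fix f :: "'a \<Rightarrow> complex" and x
  assume "continuous_on UNIV f \<and> bounded (range f)"
  then have "bdd_above (range (\<lambda>x. cmod (f x)))"
    by (auto simp: bounded_iff bdd_above_def)
  then show "cmod (f x) \<le> (SUP x. cmod (f x))"
    by (rule cSUP_upper[rotated]) simp
qed

lemma norm_cfun_leI: "(\<And>x. cmod (apply_cfun f x) \<le> B) \<Longrightarrow> norm f \<le> B" for f :: "'a cfun"
  by transfer (auto intro: cSUP_least)

instance
proof
  fix a b c :: "'a cfun" and r q :: real
  have nonneg: "0 \<le> norm d" for d :: "'a cfun"
    using cmod_apply_cfun_le[of d] norm_ge_zero order_trans by blast
  have sR_le: "norm (u *\<^sub>R d) \<le> \<bar>u\<bar> * norm d" for u :: real and d :: "'a cfun"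
    by (rule norm_cfun_leI)
      (simp add: scaleR_cfun.rep_eq norm_mult mult_left_mono cmod_apply_cfun_le)
  have sR: "norm (u *\<^sub>R d) = \<bar>u\<bar> * norm d" for u :: real and d :: "'a cfun"
  proof (cases "u = 0")
    case True
    then show ?thesis using sR_le[of 0 d] nonneg[of "0 *\<^sub>R d"] by simp
  next
    case False
    have "inverse u *\<^sub>R u *\<^sub>R d = d"
      using False by transfer (simp add: mult.assoc[symmetric] flip: of_real_mult)
    then have "norm d \<le> inverse (\<bar>u\<bar>) * norm (u *\<^sub>R d)"
      using sR_le[of "inverse u" "u *\<^sub>R d"] by simp
    then have "\<bar>u\<bar> * norm d \<le> norm (u *\<^sub>R d)"
      using False by (simp add: field_simps)
    with sR_le[of u d] show ?thesis by simp
  qed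
  show "a + b + c = a + (b + c)" by transfer (simp add: add.assoc)
  show "a + b = b + a" by transfer (simp add: add.commute)
  show "0 + a = a" by transfer simp
  show "- a + a = 0" by transfer simp
  show "a - b = a + - b" by transfer simp
  show "a * b * c = a * (b * c)" by transfer (simp add: mult.assoc)
  show "(a + b) * c = a * c + b * c" by transfer (simp add: distrib_right)
  show "a * (b + c) = a * b + a * c" by transfer (simp add: distrib_left)
  show "1 * a = a" by transfer simp
  show "a * 1 = a" by transfer simp
  show "(0 :: 'a cfun) \<noteq> 1" by transfer (metis zero_neq_one)
  show "r *\<^sub>R (a + b) = r *\<^sub>R a + r *\<^sub>R b"
    by transfer (simp add: distrib_left)
  show "(r + q) *\<^sub>R a = r *\<^sub>R a + q *\<^sub>R a"
    by transfer (simp add: distrib_right)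
  show "r *\<^sub>R q *\<^sub>R a = (r * q) *\<^sub>R a"
    by transfer (simp add: mult.assoc)
  show "1 *\<^sub>R a = a"
    by transfer simp
  show "r *\<^sub>R a * b = r *\<^sub>R (a * b)"
    by transfer (simp add: mult.assoc)
  show "a * r *\<^sub>R b = r *\<^sub>R (a * b)"
    by transfer (simp add: mult.left_commute)
  show "dist a b = norm (a - b)" by (rule dist_cfun_def)
  show "sgn a = inverse (norm a) *\<^sub>R a" by (rule sgn_cfun_def)
  show "uniformity = (INF e\<in>{0<..}. principal {(f :: 'a cfun, g). dist f g < e})"
    by (rule uniformity_cfun_def)
  show "open U \<longleftrightarrow> (\<forall>f\<in>U. \<forall>\<^sub>F (f', g) in uniformity. f' = f \<longrightarrow> g \<in> U)" for U :: "'a cfun set"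
    by (rule open_cfun_def)
  show "norm a = 0 \<longleftrightarrow> a = 0"
  proof
    assume "norm a = 0"
    then show "a = 0"
      using cmod_apply_cfun_le[of a] by (intro cfun_eqI) (simp add: zero_cfun.rep_eq)
  next
    assume "a = 0"
    then have "norm a \<le> 0"
      by (intro norm_cfun_leI) (simp add: zero_cfun.rep_eq)
    with nonneg[of a] show "norm a = 0" by simp
  qed
  show "norm (a + b) \<le> norm a + norm b"
    by (rule norm_cfun_leI)
      (auto simp: plus_cfun.rep_eq intro: norm_triangle_le add_mono cmod_apply_cfun_le)
  show "norm (r *\<^sub>R a) = \<bar>r\<bar> * norm a"
    by (rule sR)
  show "norm (a * b) \<le> norm a * norm b"
    by (rule norm_cfun_leI)
      (simp add: times_cfun.rep_eq norm_mult mult_mono cmod_apply_cfun_le nonneg)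
  show "norm (1 :: 'a cfun) = 1"
  proof (rule antisym)
    show "norm (1 :: 'a cfun) \<le> 1"
      by (rule norm_cfun_leI) (simp add: one_cfun.rep_eq)
    show "1 \<le> norm (1 :: 'a cfun)"
      using cmod_apply_cfun_le[of "1 :: 'a cfun"] by (simp add: one_cfun.rep_eq)
  qed
qed

end

instance cfun :: (topological_space) banach
proof
  fix X :: "nat \<Rightarrow> 'a cfun"
  assume "Cauchy X"
  then have cau: "\<exists>M. \<forall>m\<ge>M. \<forall>n\<ge>M. norm (X m - X n) < e" if "e > 0" for e
    using that unfolding Cauchy_def dist_norm by blast
  have diff: "cmod (apply_cfun (X m) x - apply_cfun (X n) x) \<le> norm (X m - X n)" for m n x
    using cmod_apply_cfun_le[of "X m - X n" x] by (simp add: minus_cfun.rep_eq)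
  have "uniformly_Cauchy_on UNIV (\<lambda>n. apply_cfun (X n))"
    unfolding uniformly_Cauchy_on_def dist_norm using cau diff by (meson le_less_trans)
  then obtain l where l: "uniform_limit UNIV (\<lambda>n. apply_cfun (X n)) l sequentially"
    using Cauchy_uniformly_convergent uniformly_convergent_on_def by blast
  have "continuous_on UNIV l"
    by (rule uniform_limit_theorem[OF _ l]) (auto simp: continuous_on_apply_cfun)
  moreover have "bounded (range l)"
  proof -
    obtain N where N: "\<And>x. cmod (apply_cfun (X N) x - l x) < 1"
      using uniform_limitD[OF l zero_less_one]
      by (auto simp: eventually_sequentially dist_norm)
    have "cmod (l x) \<le> norm (X N) + 1" for x
      using norm_triangle_ineq3[of "apply_cfun (X N) x" "l x"] N[of x]
        cmod_apply_cfun_le[of "X N" x] by linarith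
    then show ?thesis by (auto simp: bounded_iff)
  qed
  ultimately obtain L where L: "apply_cfun L = l"
    using Abs_cfun_inverse[of l] by auto
  have "X \<longlonglongrightarrow> L"
    unfolding tendsto_iff eventually_sequentially dist_norm
  proof (intro allI impI)
    fix e :: real assume "0 < e"
    then obtain N where N: "\<And>n x. n \<ge> N \<Longrightarrow> cmod (apply_cfun (X n) x - l x) < e / 2"
      using uniform_limitD[OF l half_gt_zero[OF \<open>0 < e\<close>]]
      unfolding eventually_sequentially dist_norm by blast
    have "norm (X n - L) \<le> e / 2" if "n \<ge> N" for n
      using N[OF that] by (intro norm_cfun_leI) (simp add: minus_cfun.rep_eq L less_imp_le)
    with \<open>0 < e\<close> show "\<exists>N. \<forall>n\<ge>N. norm (X n - L) < e" by force
  qed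
  then show "convergent X" by (auto simp: convergent_def)
qed

instantiation cfun :: (topological_space) cstar_algebra
begin

lift_definition scaleC_cfun :: "complex \<Rightarrow> 'a cfun \<Rightarrow> 'a cfun" is "\<lambda>c f x. c * f x"
  by (auto simp: bounded_iff norm_mult intro!: continuous_on_mult_left)
    (meson mult_left_mono norm_ge_zero)

lift_definition star_cfun :: "'a cfun \<Rightarrow> 'a cfun" is "\<lambda>f x. cnj (f x)"
  by (auto simp: bounded_iff intro: continuous_on_cnj)

instance
proof
  fix a b c :: "'a cfun" and z w :: complex and r :: real
  have sC_le: "norm (u *\<^sub>C d) \<le> cmod u * norm d" for u and d :: "'a cfun"
    by (rule norm_cfun_leI)
      (simp add: scaleC_cfun.rep_eq norm_mult mult_left_mono cmod_apply_cfun_le)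
  have sC: "norm (u *\<^sub>C d) = cmod u * norm d" for u and d :: "'a cfun"
  proof (cases "u = 0")
    case True
    then show ?thesis using sC_le[of 0 d] by simp
  next
    case False
    have "inverse u *\<^sub>C u *\<^sub>C d = d"
      using False by transfer (simp add: mult.assoc[symmetric])
    then have "norm d \<le> inverse (cmod u) * norm (u *\<^sub>C d)"
      using sC_le[of "inverse u" "u *\<^sub>C d"] by (simp add: norm_inverse)
    then have "cmod u * norm d \<le> norm (u *\<^sub>C d)"
      using False by (simp add: field_simps)
    with sC_le[of u d] show ?thesis by simp
  qed
  show "z *\<^sub>C (a + b) = z *\<^sub>C a + z *\<^sub>C b" by transfer (simp add: distrib_left)
  show "(z + w) *\<^sub>C a = z *\<^sub>C a + w *\<^sub>C a" by transfer (simp add: distrib_right)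
  show "z *\<^sub>C w *\<^sub>C a = (z * w) *\<^sub>C a" by transfer (simp add: mult.assoc)
  show "complex_of_real r *\<^sub>C a = r *\<^sub>R a" by transfer simp
  show "(z *\<^sub>C a) * b = z *\<^sub>C (a * b)" by transfer (simp add: mult.assoc)
  show "a * (z *\<^sub>C b) = z *\<^sub>C (a * b)" by transfer (simp add: mult.left_commute)
  show "norm (z *\<^sub>C a) = cmod z * norm a" by (rule sC)
  show "star (star a) = a" by transfer simp
  show "star (a + b) = star a + star b" by transfer simp
  show "star (z *\<^sub>C a) = cnj z *\<^sub>C star a" by transfer simp
  show "star (a * b) = star b * star a" by transfer (simp add: mult.commute)
  show "norm (star a * a) = (norm a)\<^sup>2"
  proof (rule antisym)
    have pt: "cmod (apply_cfun (star a * a) x) = (cmod (apply_cfun a x))\<^sup>2" for x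
      by (simp add: times_cfun.rep_eq star_cfun.rep_eq norm_mult power2_eq_square)
    show "norm (star a * a) \<le> (norm a)\<^sup>2"
      by (rule norm_cfun_leI) (simp only: pt, simp add: power_mono cmod_apply_cfun_le)
    have "cmod (apply_cfun a x) \<le> sqrt (norm (star a * a))" for x
      using cmod_apply_cfun_le[of "star a * a" x] by (simp only: pt real_le_rsqrt)
    then have "norm a \<le> sqrt (norm (star a * a))"
      by (rule norm_cfun_leI)
    then have "(norm a)\<^sup>2 \<le> (sqrt (norm (star a * a)))\<^sup>2"
      by (rule power_mono) simp
    then show "(norm a)\<^sup>2 \<le> norm (star a * a)"
      by simp
  qed
qed

end

text \<open>All *-homomorphisms are unital.\<close>

definition star_hom :: "('a::cstar_algebra \<Rightarrow> 'b::cstar_algebra) \<Rightarrow> bool" where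
  "star_hom f \<longleftrightarrow>
     (\<forall>x y. f (x + y) = f x + f y) \<and> (\<forall>c x. f (c *\<^sub>C x) = c *\<^sub>C f x) \<and>
     (\<forall>x y. f (x * y) = f x * f y) \<and> (\<forall>x. f (star x) = star (f x)) \<and> f 1 = 1"

definition state :: "('a::cstar_algebra \<Rightarrow> complex) \<Rightarrow> bool" where
  "state \<phi> \<longleftrightarrow>
     (\<forall>x y. \<phi> (x + y) = \<phi> x + \<phi> y) \<and> (\<forall>c x. \<phi> (c *\<^sub>C x) = c * \<phi> x) \<and>
     (\<forall>x. \<phi> (star x * x) \<in> \<real>\<^sub>\<ge>\<^sub>0) \<and> \<phi> 1 = 1"


section \<open>Representations on \<open>\<ell>\<^sup>2(I)\<close>\<close>

text \<open>The index set \<open>I\<close> is a whole type. Operators on \<open>\<ell>\<^sup>2(I)\<close> are functions on all families;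
  only their values on square-summable families matter.\<close>

definition ell2 :: "('i \<Rightarrow> complex) set" where
  "ell2 = {x. (\<lambda>i. (cmod (x i))\<^sup>2) summable_on UNIV}"

definition ell2_inner :: "('i \<Rightarrow> complex) \<Rightarrow> ('i \<Rightarrow> complex) \<Rightarrow> complex" where
  "ell2_inner x y = (\<Sum>\<^sub>\<infinity>i. cnj (x i) * y i)"

definition ell2_norm :: "('i \<Rightarrow> complex) \<Rightarrow> real" where
  "ell2_norm x = sqrt (\<Sum>\<^sub>\<infinity>i. (cmod (x i))\<^sup>2)"

definition bounded_operator :: "(('i \<Rightarrow> complex) \<Rightarrow> 'i \<Rightarrow> complex) \<Rightarrow> bool" where
  "bounded_operator T \<longleftrightarrow>
     (\<forall>x\<in>ell2. T x \<in> ell2) \<and>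
     (\<forall>x\<in>ell2. \<forall>y\<in>ell2. T (\<lambda>i. x i + y i) = (\<lambda>i. T x i + T y i)) \<and>
     (\<forall>c. \<forall>x\<in>ell2. T (\<lambda>i. c * x i) = (\<lambda>i. c * T x i)) \<and>
     (\<exists>C. \<forall>x\<in>ell2. ell2_norm (T x) \<le> C * ell2_norm x)"

definition operator_norm :: "(('i \<Rightarrow> complex) \<Rightarrow> 'i \<Rightarrow> complex) \<Rightarrow> real" where
  "operator_norm T = (SUP x\<in>{x\<in>ell2. ell2_norm x \<le> 1}. ell2_norm (T x))"

definition representation ::
  "('a::cstar_algebra \<Rightarrow> ('i \<Rightarrow> complex) \<Rightarrow> 'i \<Rightarrow> complex) \<Rightarrow> bool" where
  "representation \<pi> \<longleftrightarrow>
     (\<forall>a. bounded_operator (\<pi> a)) \<and>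
     (\<forall>a b. \<forall>x\<in>ell2. \<pi> (a + b) x = (\<lambda>i. \<pi> a x i + \<pi> b x i)) \<and>
     (\<forall>c a. \<forall>x\<in>ell2. \<pi> (c *\<^sub>C a) x = (\<lambda>i. c * \<pi> a x i)) \<and>
     (\<forall>a b. \<forall>x\<in>ell2. \<pi> (a * b) x = \<pi> a (\<pi> b x)) \<and>
     (\<forall>x\<in>ell2. \<pi> 1 x = x) \<and>
     (\<forall>a. \<forall>x\<in>ell2. \<forall>y\<in>ell2. ell2_inner (\<pi> (star a) x) y = ell2_inner x (\<pi> a y))"

definition faithful ::
  "('a::cstar_algebra \<Rightarrow> ('i \<Rightarrow> complex) \<Rightarrow> 'i \<Rightarrow> complex) \<Rightarrow> bool" where
  "faithful \<pi> \<longleftrightarrow> (\<forall>a b. (\<forall>x\<in>ell2. \<pi> a x = \<pi> b x) \<longrightarrow> a = b)"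


section \<open>The minimal tensor product\<close>

text \<open>\<open>min_tensor t\<close> says that the C*-algebra \<open>'t\<close>, with the elementary tensors \<open>t a b\<close>, is the
  minimal (spatial) tensor product of \<open>'a\<close> and \<open>'b\<close>: for faithful representations \<open>\<pi>\<close> on \<open>H\<close>
  and \<open>\<sigma>\<close> on \<open>K\<close>, it is carried isometrically by \<open>\<rho>\<close> onto the norm closure of the span of
  the operators \<open>\<pi>(a) \<otimes> \<sigma>(b)\<close> on \<open>H \<otimes> K\<close>. Here \<open>H = \<ell>\<^sup>2('a)\<close> and \<open>K = \<ell>\<^sup>2('b)\<close>, so that
  \<open>H \<otimes> K = \<ell>\<^sup>2('a \<times> 'b)\<close>. This choice loses nothing: the norm does not depend on the faithful
  representations, and a unital C*-algebra \<open>A\<close> always has a faithful unital one on \<open>\<ell>\<^sup>2(A)\<close>,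
  because a sum of GNS representations over one norming state for each element of \<open>A\<close> has
  Hilbert dimension at most \<open>|A|\<close> (and has dimension \<open>|A|\<close> exactly if all of these summands
  are kept).\<close>

definition ell2_tensor :: "('i \<Rightarrow> complex) \<Rightarrow> ('j \<Rightarrow> complex) \<Rightarrow> 'i \<times> 'j \<Rightarrow> complex" where
  "ell2_tensor x y = (\<lambda>(i, j). x i * y j)"

definition min_tensor ::
  "('a::cstar_algebra \<Rightarrow> 'b::cstar_algebra \<Rightarrow> 't::cstar_algebra) \<Rightarrow> bool" where
  "min_tensor t \<longleftrightarrow>
     (\<exists>(\<pi> :: 'a \<Rightarrow> ('a \<Rightarrow> complex) \<Rightarrow> 'a \<Rightarrow> complex)
       (\<sigma> :: 'b \<Rightarrow> ('b \<Rightarrow> complex) \<Rightarrow> 'b \<Rightarrow> complex)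
       (\<rho> :: 't \<Rightarrow> ('a \<times> 'b \<Rightarrow> complex) \<Rightarrow> 'a \<times> 'b \<Rightarrow> complex).
       representation \<pi> \<and> faithful \<pi> \<and> representation \<sigma> \<and> faithful \<sigma> \<and>
       representation \<rho> \<and> (\<forall>u. operator_norm (\<rho> u) = norm u) \<and>
       (\<forall>a b. \<forall>x\<in>ell2. \<forall>y\<in>ell2.
          \<rho> (t a b) (ell2_tensor x y) = ell2_tensor (\<pi> a x) (\<sigma> b y))) \<and>
     closure (cspan {t a b |a b. True}) = UNIV"

text \<open>The C*-algebra \<open>'abc\<close> as \<open>A \<otimes> B \<otimes> C\<close>, identified with both \<open>(A \<otimes> B) \<otimes> C\<close> and
  \<open>A \<otimes> (B \<otimes> C)\<close>.\<close>

definition triple_tensor ::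
  "('a::cstar_algebra \<Rightarrow> 'b::cstar_algebra \<Rightarrow> 'ab::cstar_algebra) \<Rightarrow>
   ('b \<Rightarrow> 'c::cstar_algebra \<Rightarrow> 'bc::cstar_algebra) \<Rightarrow>
   ('ab \<Rightarrow> 'c \<Rightarrow> 'abc::cstar_algebra) \<Rightarrow> ('a \<Rightarrow> 'bc \<Rightarrow> 'abc) \<Rightarrow> bool" where
  "triple_tensor tab tbc tab_c ta_bc \<longleftrightarrow>
     min_tensor tab \<and> min_tensor tbc \<and> min_tensor tab_c \<and> min_tensor ta_bc \<and>
     (\<forall>a b c. tab_c (tab a b) c = ta_bc a (tbc b c))"

text \<open>\<open>F\<close> is the *-homomorphism \<open>f \<otimes> g\<close>; for *-homomorphisms \<open>f\<close> and \<open>g\<close> between minimal tensor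
  products it exists and is unique.\<close>

definition is_tensor_hom ::
  "('a::cstar_algebra \<Rightarrow> 'b::cstar_algebra \<Rightarrow> 's::cstar_algebra) \<Rightarrow>
   ('c::cstar_algebra \<Rightarrow> 'd::cstar_algebra \<Rightarrow> 't::cstar_algebra) \<Rightarrow>
   ('a \<Rightarrow> 'c) \<Rightarrow> ('b \<Rightarrow> 'd) \<Rightarrow> ('s \<Rightarrow> 't) \<Rightarrow> bool" where
  "is_tensor_hom s t f g F \<longleftrightarrow> star_hom F \<and> (\<forall>a b. F (s a b) = t (f a) (g b))"

text \<open>\<open>S\<close> is the slice map \<open>\<phi> \<otimes> id\<close>; for a state \<open>\<phi>\<close> it exists and is unique.\<close>

definition is_slice_map ::
  "('a::cstar_algebra \<Rightarrow> 'b::cstar_algebra \<Rightarrow> 't::cstar_algebra) \<Rightarrow>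
   ('a \<Rightarrow> complex) \<Rightarrow> ('t \<Rightarrow> 'b) \<Rightarrow> bool" where
  "is_slice_map t \<phi> S \<longleftrightarrow>
     bounded_linear S \<and> (\<forall>c u. S (c *\<^sub>C u) = c *\<^sub>C S u) \<and> (\<forall>a b. S (t a b) = \<phi> a *\<^sub>C b)"


section \<open>Compact quantum groups and their actions\<close>

text \<open>\<open>A\<close> is the type \<open>'a\<close>; \<open>t\<close> makes \<open>'aa\<close> into \<open>A \<otimes> A\<close>, and \<open>tl\<close>, \<open>tr\<close> make \<open>'aaa\<close> into
  \<open>(A \<otimes> A) \<otimes> A\<close> and \<open>A \<otimes> (A \<otimes> A)\<close>.\<close>

locale compact_quantum_group =
  fixes t :: "'a::cstar_algebra \<Rightarrow> 'a \<Rightarrow> 'aa::cstar_algebra"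
    and tl :: "'aa \<Rightarrow> 'a \<Rightarrow> 'aaa::cstar_algebra"
    and tr :: "'a \<Rightarrow> 'aa \<Rightarrow> 'aaa"
    and \<Delta> :: "'a \<Rightarrow> 'aa"
  assumes tensor_AAA: "triple_tensor t t tl tr"
    and star_hom_\<Delta>: "star_hom \<Delta>"
    and coassociative:
      "\<exists>F G. is_tensor_hom t tr id \<Delta> F \<and> is_tensor_hom t tl \<Delta> id G \<and> F \<circ> \<Delta> = G \<circ> \<Delta>"
    and dense_right: "closure (cspan {\<Delta> a * t 1 b |a b. True}) = UNIV"
    and dense_left: "closure (cspan {\<Delta> a * t b 1 |a b. True}) = UNIV"

text \<open>With \<open>B = C(X)\<close>, \<open>s\<close> makes \<open>'ba\<close> into \<open>B \<otimes> A\<close>, and \<open>sl\<close>, \<open>sr\<close> make \<open>'baa\<close> into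
  \<open>(B \<otimes> A) \<otimes> A\<close> and \<open>B \<otimes> (A \<otimes> A)\<close>.\<close>

locale quantum_action = compact_quantum_group t tl tr \<Delta>
  for t :: "'a::cstar_algebra \<Rightarrow> 'a \<Rightarrow> 'aa::cstar_algebra"
    and tl :: "'aa \<Rightarrow> 'a \<Rightarrow> 'aaa::cstar_algebra"
    and tr :: "'a \<Rightarrow> 'aa \<Rightarrow> 'aaa"
    and \<Delta> :: "'a \<Rightarrow> 'aa" +
  fixes s :: "'x::t2_space cfun \<Rightarrow> 'a \<Rightarrow> 'ba::cstar_algebra"
    and sl :: "'ba \<Rightarrow> 'a \<Rightarrow> 'baa::cstar_algebra"
    and sr :: "'x cfun \<Rightarrow> 'aa \<Rightarrow> 'baa"
    and \<alpha> :: "'x cfun \<Rightarrow> 'ba"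
  assumes compact_X: "compact (UNIV :: 'x set)"
    and tensor_BAA: "triple_tensor s t sl sr"
    and star_hom_\<alpha>: "star_hom \<alpha>"
    and coaction:
      "\<exists>F G. is_tensor_hom s sl \<alpha> id F \<and> is_tensor_hom s sr id \<Delta> G \<and> F \<circ> \<alpha> = G \<circ> \<alpha>"
    and dense_\<alpha>: "closure (cspan {\<alpha> f * s 1 a |f a. True}) = UNIV"

definition ergodic ::
  "('b::cstar_algebra \<Rightarrow> 'a::cstar_algebra \<Rightarrow> 'ba::cstar_algebra) \<Rightarrow> ('b \<Rightarrow> 'ba) \<Rightarrow> bool" where
  "ergodic s \<alpha> \<longleftrightarrow> {b. \<alpha> b = s b 1} = range (\<lambda>c. c *\<^sub>C 1)"

definition invariant_state ::
  "('b::cstar_algebra \<Rightarrow> 'a::cstar_algebra \<Rightarrow> 'ba::cstar_algebra) \<Rightarrow> ('b \<Rightarrow> 'ba) \<Rightarrow>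
   ('b \<Rightarrow> complex) \<Rightarrow> bool" where
  "invariant_state s \<alpha> \<phi> \<longleftrightarrow>
     state \<phi> \<and> (\<exists>S. is_slice_map s \<phi> S \<and> (\<forall>b. S (\<alpha> b) = \<phi> b *\<^sub>C 1))"

definition regular_borel_probability :: "'x::topological_space measure \<Rightarrow> bool" where
  "regular_borel_probability \<mu> \<longleftrightarrow>
     prob_space \<mu> \<and> sets \<mu> = sets borel \<and>
     (\<forall>E\<in>sets borel. emeasure \<mu> E = (SUP K\<in>{K. compact K \<and> K \<in> sets borel \<and> K \<subseteq> E}. emeasure \<mu> K)) \<and>
     (\<forall>E\<in>sets borel. emeasure \<mu> E = (INF U\<in>{U. open U \<and> E \<subseteq> U}. emeasure \<mu> U))"

definition invariant_measure ::
  "('x::topological_space cfun \<Rightarrow> 'a::cstar_algebra \<Rightarrow> 'ba::cstar_algebra) \<Rightarrow>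
   ('x cfun \<Rightarrow> 'ba) \<Rightarrow> 'x measure \<Rightarrow> bool" where
  "invariant_measure s \<alpha> \<mu> \<longleftrightarrow>
     regular_borel_probability \<mu> \<and>
     invariant_state s \<alpha> (\<lambda>f. integral\<^sup>L \<mu> (apply_cfun f))"

end

theory Submission
  imports Defs
begin

text \<open>Write \<open>\<alpha>\<^sub>x f\<close> for the value of \<open>\<alpha> f \<in> C(X) \<otimes> A = C(X, A)\<close> at \<open>x\<close>. Averaging over states of \<open>A\<close>
  (the argument of Woronowicz, Maes and Van Daele for the Haar state, with compactness of
  \<open>{(id \<otimes> \<phi>) (\<alpha> f)}\<close> in norm in place of separability of \<open>A\<close>) produces a function \<open>g\<close> with
  \<open>\<alpha> g = g \<otimes> 1\<close> in the closure of \<open>{(id \<otimes> \<phi>) (\<alpha> f)}\<close>. By ergodicity \<open>g\<close> is the constant \<open>\<mu>(f)\<close>, and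
  therefore \<open>\<bar>\<mu>(f)\<bar> \<le> \<parallel>\<alpha>\<^sub>x f\<parallel>\<close> for every \<open>x\<close>.

  Let \<open>\<mu>{x\<^sub>0} = M > 0\<close>, let \<open>e\<close> be the indicator function of \<open>x\<^sub>0\<close>, and let \<open>p\<^sub>x = \<alpha>\<^sub>x e\<close>. If \<open>\<zeta> = \<alpha>(k) (1 \<otimes> a)\<close>, then
  \<open>M \<alpha>(e) \<zeta> = \<alpha>(e) (1 \<otimes> (\<mu> \<otimes> id) (\<alpha>(e) \<zeta>))\<close>, because \<open>e k = k(x\<^sub>0) e\<close> and \<open>\<mu>\<close> is invariant. Such
  \<open>\<zeta>\<close> span a dense subspace, so \<open>\<zeta> = g \<otimes> 1\<close> is allowed. As \<open>X\<close> is infinite, there is \<open>x\<^sub>1\<close> with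
  \<open>\<mu>{x\<^sub>1} < M\<close>; choose \<open>g \<ge> 0\<close> with \<open>g(x\<^sub>1) = 1\<close> and \<open>\<mu>(g) < M\<close>. At \<open>x\<^sub>1\<close> the identity
  reads \<open>M p = p a\<close> for \<open>p = p\<^sub>x\<^sub>1\<close>, with \<open>\<parallel>a\<parallel> \<le> \<mu>(g) < M\<close>, so \<open>p = 0\<close>, while the first part gives
  \<open>\<parallel>p\<parallel> \<ge> M\<close>. As \<open>e\<close> need not be continuous, it is approximated by continuous functions supported
  near \<open>x\<^sub>0\<close>.\<close>

section \<open>C*-algebras\<close>

text \<open>The only Hilbert space data at hand are the representations inside
  \<open>min_tensor\<close>. Norm bounds, positivity and slice maps are all drawn from them with one
  tool of functional calculus, the square root of \<open>1 - x\<close>. States enter as unital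
  contractive functionals (\<open>markov\<close>), a form that survives composition with slice maps,
  \<Delta> and \<alpha>; their positivity is proved where squares have to be compared. An averaging
  state treats only finitely many states of A at a time. The resulting conditions on a function are
  closed and have the finite intersection property in the norm-compact set of slices, which gives
  one function fixed for all states. The approximation of the indicator of the atom comes last in
  the order of choices: \<open>g \<otimes> 1\<close> is first replaced by a finite sum of terms
  \<open>\<alpha> k * s 1 a\<close>, and only then is a function picked that is localized finely
  enough for those finitely many \<open>k\<close>. Hence the split into
  \<open>no_localized_functions\<close>, whose list and tolerance are independent of
  \<open>f\<close>, and \<open>ex_localized_function\<close>, which meets every list and
  tolerance.\<close>

lemma scaleR_eq_scaleC: "r *\<^sub>R x = complex_of_real r *\<^sub>C (x::'a::cstar_algebra)"
  by (simp add: scaleC_of_real)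

lemma star_zero [simp]: "star (0::'a::cstar_algebra) = 0"
  using star_add[of 0 "0::'a"] by simp

lemma star_minus [simp]: "star (- x) = - star (x::'a::cstar_algebra)"
  using star_add[of x "- x"] by (simp add: eq_neg_iff_add_eq_0 add.commute)

lemma star_diff: "star (x - y) = star x - star (y::'a::cstar_algebra)"
  using star_add[of x "- y"] by simp

lemma star_scaleR: "star (r *\<^sub>R x) = r *\<^sub>R star (x::'a::cstar_algebra)"
  by (simp add: scaleR_eq_scaleC star_scaleC)

lemma bounded_linear_star: "bounded_linear (star :: 'a::cstar_algebra \<Rightarrow> 'a)"
  by (rule bounded_linear_intro[where K = 1]) (simp_all add: star_add star_scaleR norm_star)

lemma star_power: "star (x ^ n) = star (x::'a::cstar_algebra) ^ n"
  by (induction n) (simp_all add: star_one star_mult power_commutes)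

lemma norm_selfadj_square:
  fixes x :: "'a::cstar_algebra"
  assumes "star x = x"
  shows "norm (x * x) = (norm x)\<^sup>2"
  using cstar_identity[of x] assms by simp

lemma bounded_linear_scaleC: "bounded_linear (scaleC c :: 'a::cstar_algebra \<Rightarrow> 'a)"
  by (rule bounded_linear_intro[where K = "cmod c"])
    (simp_all add: scaleC_add_right scaleR_eq_scaleC scaleC_scaleC norm_scaleC mult.commute)

section \<open>Square roots and absolute values from a binomial series\<close>

text \<open>The Taylor coefficients of \<open>sqrt (1 - z)\<close> at 0.\<close>

definition sqrt_coeff :: "nat \<Rightarrow> real" where
  "sqrt_coeff n = (1 / 2 gchoose n) * (- 1) ^ n"

lemma sqrt_coeff_0 [simp]: "sqrt_coeff 0 = 1"
  by (simp add: sqrt_coeff_def)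

text \<open>From index 1 on, consecutive coefficients have the positive ratio
  \<open>(m - 1/2) / (m + 1)\<close>, so the sign of the coefficient \<open>- 1/2\<close> at index 1
  persists.\<close>

lemma sqrt_coeff_Suc_nonpos: "sqrt_coeff (Suc n) \<le> 0"
proof (induction n)
  case (Suc n)
  have "(1 / 2 - of_nat (Suc n)) * (1 / 2 gchoose Suc n)
      = of_nat (Suc (Suc n)) * (1 / 2 gchoose Suc (Suc n) :: real)"
    using gbinomial_mult_1[of "1 / 2 :: real" "Suc n"] by (simp add: algebra_simps)
  then have "real (Suc (Suc n)) * sqrt_coeff (Suc (Suc n))
      = (1 / 2 - real (Suc n)) * (1 / 2 gchoose Suc n) * (- 1) ^ Suc (Suc n)"
    unfolding sqrt_coeff_def by simp
  also have "\<dots> = (real (Suc n) - 1 / 2) * sqrt_coeff (Suc n)"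
    unfolding sqrt_coeff_def by (simp add: algebra_simps)
  finally have "real (Suc (Suc n)) * sqrt_coeff (Suc (Suc n))
      = (real (Suc n) - 1 / 2) * sqrt_coeff (Suc n)" .
  moreover have "(real (Suc n) - 1 / 2) * sqrt_coeff (Suc n) \<le> 0"
    using Suc by (intro mult_nonneg_nonpos) auto
  ultimately show ?case
    by (metis mult_le_0_iff of_nat_0_less_iff zero_less_Suc not_le)
qed (simp add: sqrt_coeff_def)

text \<open>Summing coefficients means dividing \<open>sqrt (1 - z)\<close> by \<open>1 - z\<close>,
  so the partial sums are the coefficients of \<open>1 / sqrt (1 - z)\<close>, which are
  nonnegative.\<close>

lemma sum_sqrt_coeff_nonneg: "(\<Sum>k\<le>n. sqrt_coeff k) \<ge> 0"
proof -
  have "(\<Sum>k\<le>n. sqrt_coeff k) = (- 1) ^ n * ((1 / 2 - 1) gchoose n)"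
    unfolding sqrt_coeff_def by (rule gbinomial_sum_lower_neg)
  also have "\<dots> = pochhammer (1 / 2) n / fact n"
    by (simp add: gbinomial_pochhammer flip: power_mult_distrib)
  also have "\<dots> \<ge> 0"
    by (intro divide_nonneg_nonneg pochhammer_nonneg) auto
  finally show ?thesis .
qed

text \<open>The head is 1 and the partial sums stay nonnegative, so the nonpositive tail has mass at
  most 1. This gives absolute convergence on the whole closed unit ball and, later,
  \<open>norm (1 - e) \<le> 1\<close>.\<close>

lemma sum_abs_sqrt_coeff_Suc: "(\<Sum>k<n. \<bar>sqrt_coeff (Suc k)\<bar>) \<le> 1"
proof -
  have "(\<Sum>k\<le>n. sqrt_coeff k) = sqrt_coeff 0 + (\<Sum>k<n. sqrt_coeff (Suc k))"
    by (rule sum.atMost_shift)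
  moreover have "(\<Sum>k<n. \<bar>sqrt_coeff (Suc k)\<bar>) = - (\<Sum>k<n. sqrt_coeff (Suc k))"
    by (simp add: abs_of_nonpos sqrt_coeff_Suc_nonpos sum_negf)
  ultimately show ?thesis using sum_sqrt_coeff_nonneg[of n] by simp
qed

lemma summable_abs_sqrt_coeff: "summable (\<lambda>n. \<bar>sqrt_coeff n\<bar>)"
proof -
  have "summable (\<lambda>n. \<bar>sqrt_coeff (Suc n)\<bar>)"
    by (rule summableI_nonneg_bounded[where x = 1]) (auto intro: sum_abs_sqrt_coeff_Suc)
  then show ?thesis by (subst (asm) summable_Suc_iff)
qed

text \<open>The square of the series is \<open>1 - z\<close>: the Vandermonde convolution turns two
  binomials with upper index 1/2 into one with upper index 1.\<close>

lemma sqrt_coeff_convolution: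
  "(\<Sum>k\<le>n. sqrt_coeff k * sqrt_coeff (n - k)) = (if n = 0 then 1 else if n = 1 then - 1 else 0)"
proof -
  have "(\<Sum>k\<le>n. sqrt_coeff k * sqrt_coeff (n - k))
      = (\<Sum>k\<le>n. (1 / 2 gchoose k) * (1 / 2 gchoose (n - k))) * (- 1) ^ n"
    unfolding sum_distrib_right
    by (rule sum.cong) (auto simp: sqrt_coeff_def simp flip: power_add)
  also have "(\<Sum>k\<le>n. (1 / 2 gchoose k) * (1 / 2 gchoose (n - k))) = ((1::real) gchoose n)"
    using gbinomial_Vandermonde[of "1 / 2 :: real" "1 / 2" n] by (simp add: atLeast0AtMost)
  also have "((1::real) gchoose n) = real (1 choose n)"
    using binomial_gbinomial[of 1 n] by (metis of_nat_1)
  also have "real (1 choose n) * (- 1) ^ n = (if n = 0 then 1 else if n = 1 then - 1 else 0)"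
    by (cases n; cases "n - 1") auto
  finally show ?thesis .
qed

text \<open>\<open>e\<close> is a limit of real polynomials in \<open>x\<close>, hence self-adjoint
  and commuting with whatever commutes with \<open>x\<close>. The bound on \<open>1 - e\<close> lets
  the lemma be applied again, to \<open>1 - e\<close>, which yields a square root of
  \<open>e\<close> itself.\<close>

lemma ex_sqrt_one_minus:
  fixes x :: "'a::cstar_algebra"
  assumes sa: "star x = x" and le: "norm x \<le> 1"
  obtains e where "star e = e" "e * e = 1 - x" "norm (1 - e) \<le> 1"
    "\<And>y. x * y = y * x \<Longrightarrow> e * y = y * e"
proof -
  define c where "c = (\<lambda>n. sqrt_coeff n *\<^sub>R x ^ n)"
  define e where "e = (\<Sum>n. c n)"
  have pow: "norm (x ^ n) \<le> 1" for n
    using norm_power_ineq[of x n] power_le_one[OF norm_ge_zero le, of n] by linarith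
  have norm_c: "norm (c n) \<le> \<bar>sqrt_coeff n\<bar>" for n
    using mult_left_mono[OF pow, of "\<bar>sqrt_coeff n\<bar>"] by (simp add: c_def)
  have sumn: "summable (\<lambda>n. norm (c n))"
    by (rule summable_comparison_test'[OF summable_abs_sqrt_coeff, of 0]) (simp add: norm_c)
  then have sum: "summable c" by (rule summable_norm_cancel)
  have sumn_Suc: "summable (\<lambda>n. norm (c (Suc n)))"
    using summable_Suc_iff[of "\<lambda>n. norm (c n)"] sumn by simp
  have "star e = (\<Sum>n. star (c n))"
    unfolding e_def by (rule bounded_linear.suminf[OF bounded_linear_star sum])
  then have "star e = e"
    by (simp add: c_def e_def star_scaleR star_power sa)
  moreover have "e * e = 1 - x"
  proof -
    have "e * e = (\<Sum>n. \<Sum>i\<le>n. c i * c (n - i))"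
      unfolding e_def by (rule Cauchy_product[OF sumn sumn])
    also have "(\<lambda>n. \<Sum>i\<le>n. c i * c (n - i)) = (\<lambda>n. if n = 0 then 1 else if n = 1 then - x else 0)"
    proof
      fix n
      have "(\<Sum>i\<le>n. c i * c (n - i)) = (\<Sum>i\<le>n. (sqrt_coeff i * sqrt_coeff (n - i)) *\<^sub>R x ^ n)"
        by (rule sum.cong) (auto simp: c_def simp flip: power_add)
      also have "\<dots> = (if n = 0 then 1 else if n = 1 then - x else 0)"
        by (simp flip: scaleR_left.sum add: sqrt_coeff_convolution)
      finally show "(\<Sum>i\<le>n. c i * c (n - i)) = (if n = 0 then 1 else if n = 1 then - x else 0)" .
    qed
    also have "(\<Sum>n. if n = 0 then 1 else if n = 1 then - x else 0) = 1 - x"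
      by (subst suminf_finite[of "{0, 1}"]) auto
    finally show ?thesis .
  qed
  moreover have "norm (1 - e) \<le> 1"
  proof -
    have "1 - e = - (\<Sum>n. c (Suc n))"
      unfolding e_def using suminf_split_head[OF sum] by (simp add: c_def)
    also have "norm \<dots> \<le> (\<Sum>n. norm (c (Suc n)))"
      unfolding norm_minus_cancel
      by (rule summable_norm) (rule sumn_Suc)
    also have "\<dots> \<le> 1"
    proof (rule suminf_le_const)
      show "summable (\<lambda>n. norm (c (Suc n)))" by (rule sumn_Suc)
      show "(\<Sum>k<n. norm (c (Suc k))) \<le> 1" for n
        using sum_mono[of "{..<n}" "\<lambda>k. norm (c (Suc k))" "\<lambda>k. \<bar>sqrt_coeff (Suc k)\<bar>"]
          norm_c sum_abs_sqrt_coeff_Suc[of n] by force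
    qed
    finally show ?thesis .
  qed
  moreover have "e * y = y * e" if xy: "x * y = y * x" for y
  proof -
    have "x ^ n * y = y * x ^ n" for n
      using power_commuting_commutes[OF xy] .
    then have "c n * y = y * c n" for n by (simp add: c_def)
    then show ?thesis
      unfolding e_def by (simp add: suminf_mult[OF sum, symmetric] suminf_mult2[OF sum])
  qed
  ultimately show ?thesis by (rule that)
qed

text \<open>Here \<open>d + \<i> e\<close> is \<open>sqrt s\<close> times a unitary, and \<open>d\<close> is its real part.\<close>

lemma norm_square_le_of_sum_squares:
  fixes d e :: "'a::cstar_algebra"
  assumes d: "star d = d" and e: "star e = e" and comm: "d * e = e * d"
    and sum: "d * d + e * e = s *\<^sub>R 1"
  shows "norm (d * d) \<le> \<bar>s\<bar>"
proof -
  define u where "u = d + \<i> *\<^sub>C e"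
  have su: "star u = d - \<i> *\<^sub>C e"
    by (simp add: u_def star_add star_scaleC d e)
  have "star u * u = s *\<^sub>R 1"
    unfolding su sum[symmetric]
    by (simp add: u_def algebra_simps mult_scaleC_left mult_scaleC_right scaleC_scaleC comm)
  then have nu: "(norm u)\<^sup>2 = \<bar>s\<bar>"
    using cstar_identity[of u] by simp
  have "2 *\<^sub>R d = u + star u"
    by (simp add: su) (simp add: u_def scaleR_2)
  then have "2 * norm d \<le> norm u + norm (star u)"
    by (metis norm_triangle_ineq norm_scaleR abs_numeral)
  then have "norm d \<le> norm u" by (simp add: norm_star)
  then have "(norm d)\<^sup>2 \<le> (norm u)\<^sup>2" by (simp add: power_mono)
  then show ?thesis by (simp add: nu norm_selfadj_square[OF d])
qed

text \<open>\<open>p\<close> is the absolute value of \<open>y\<close>; its square root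
  \<open>w\<close> is carried along to witness that \<open>p\<close> is positive. Scaling reduces to
  \<open>norm y \<le> 1\<close>.\<close>

lemma ex_abs:
  fixes y :: "'a::cstar_algebra"
  assumes sa: "star y = y"
  obtains p w where "star w = w" "p = w * w" "p * p = y * y"
    "\<And>z. y * z = z * y \<Longrightarrow> w * z = z * w"
proof (cases "y = 0")
  case True
  then show ?thesis using that[of 0 0] by simp
next
  case False
  have ex: "\<exists>p w. star w = w \<and> p = w * w \<and> p * p = y * y \<and> (\<forall>z. y * z = z * y \<longrightarrow> w * z = z * w)"
    if sa: "star y = y" and le: "norm y \<le> 1" for y :: 'a
  proof -
    have sy: "star (y * y) = y * y" by (simp add: star_mult sa)
    have "norm (y * y) \<le> 1"
      using norm_mult_ineq[of y y] mult_mono[OF le le] by simp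
    \<comment> \<open>\<open>e\<close> serves to show \<open>norm (1 - y * y) \<le> 1\<close>,
      because its square and that of \<open>y\<close> add up to 1. That bound gives access to the
      square root \<open>p\<close> of \<open>y * y\<close>.\<close>
    with sy obtain e where e: "star e = e" "e * e = 1 - y * y"
      "\<And>z. (y * y) * z = z * (y * y) \<Longrightarrow> e * z = z * e"
      by (rule ex_sqrt_one_minus) blast
    have "norm (e * e) \<le> \<bar>1\<bar>"
    proof (rule norm_square_le_of_sum_squares[OF e(1) sa])
      show "e * y = y * e" by (rule e(3)) (simp add: mult.assoc)
      show "e * e + y * y = 1 *\<^sub>R 1" by (simp add: e(2))
    qed
    then have le2: "norm (1 - y * y) \<le> 1" by (simp add: e(2))
    have "star (1 - y * y) = 1 - y * y" by (simp add: star_diff star_one sy)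
    from this le2 obtain p where p: "star p = p" "p * p = 1 - (1 - y * y)" "norm (1 - p) \<le> 1"
      "\<And>z. (1 - y * y) * z = z * (1 - y * y) \<Longrightarrow> p * z = z * p"
      by (rule ex_sqrt_one_minus) blast
    have "star (1 - p) = 1 - p" by (simp add: star_diff star_one p)
    from this p(3) obtain w where w: "star w = w" "w * w = 1 - (1 - p)"
      "\<And>z. (1 - p) * z = z * (1 - p) \<Longrightarrow> w * z = z * w"
      by (rule ex_sqrt_one_minus) blast
    have "w * z = z * w" if yz: "y * z = z * y" for z
    proof -
      have "y * y * z = z * (y * y)" by (metis mult.assoc yz)
      then have "p * z = z * p" by (intro p(4)) (simp add: algebra_simps)
      then show ?thesis by (intro w(3)) (simp add: algebra_simps)
    qed
    moreover have "p = w * w" "p * p = y * y" using w(2) p(2) by simp_all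
    ultimately show ?thesis using w(1) by blast
  qed
  define r where "r = norm y"
  have r: "r > 0" using False by (simp add: r_def)
  obtain p w where pw: "star w = w" "p = w * w" "p * p = (y /\<^sub>R r) * (y /\<^sub>R r)"
    "\<And>z. (y /\<^sub>R r) * z = z * (y /\<^sub>R r) \<Longrightarrow> w * z = z * w"
  proof -
    have "star (y /\<^sub>R r) = y /\<^sub>R r" "norm (y /\<^sub>R r) \<le> 1"
      using False by (simp_all add: star_scaleR sa r_def)
    from ex[OF this] show ?thesis using that by blast
  qed
  show ?thesis
  proof (rule that[of "sqrt r *\<^sub>R w" "r *\<^sub>R p"])
    show "star (sqrt r *\<^sub>R w) = sqrt r *\<^sub>R w" by (simp add: star_scaleR pw(1))
    show "r *\<^sub>R p = sqrt r *\<^sub>R w * sqrt r *\<^sub>R w" using r by (simp add: pw(2))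
    show "r *\<^sub>R p * r *\<^sub>R p = y * y" 
    proof -
      have "r * (r * (inverse r * inverse r)) = 1" using r by (simp add: field_simps)
      then show ?thesis using pw(3) by simp
    qed
    show "sqrt r *\<^sub>R w * z = z * sqrt r *\<^sub>R w" if "y * z = z * y" for z
      using pw(4)[of z] that by simp
  qed
qed

subsection \<open>*-homomorphisms\<close>

text \<open>For self-adjoint \<open>x\<close> of norm at most 1 the relation
  \<open>x * x + e * e = 1\<close> is purely algebraic, so it survives \<open>f\<close> and bounds
  the image through \<open>norm_square_le_of_sum_squares\<close>. The C*-identity gives the general
  case.\<close>

lemma star_hom_norm_le:
  fixes f :: "'a::cstar_algebra \<Rightarrow> 'b::cstar_algebra"
  assumes f: "star_hom f"
  shows "norm (f a) \<le> norm a"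
proof -
  have add: "f (x + y) = f x + f y" and scC: "f (c *\<^sub>C x) = c *\<^sub>C f x"
    and mult: "f (x * y) = f x * f y" and st: "f (star x) = star (f x)" and one: "f 1 = 1" for x y c
    using f by (auto simp: star_hom_def)
  have sc: "f (r *\<^sub>R x) = r *\<^sub>R f x" for r x by (simp add: scaleR_eq_scaleC scC)
  have sa_le: "norm (f x) \<le> 1" if sa: "star x = x" and le: "norm x \<le> 1" for x
  proof -
    have "star (x * x) = x * x" by (simp add: star_mult sa)
    moreover have "norm (x * x) \<le> 1" using norm_mult_ineq[of x x] mult_mono[OF le le] by simp
    ultimately obtain e where e: "star e = e" "e * e = 1 - x * x"
      "\<And>y. x * x * y = y * (x * x) \<Longrightarrow> e * y = y * e"
      by (rule ex_sqrt_one_minus) blast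
    have "x * x + e * e = 1" by (simp add: e)
    then have "f x * f x + f e * f e = 1 *\<^sub>R 1" by (simp flip: mult add add: one)
    moreover have "f x * f e = f e * f x"
      using e(3)[of x] by (simp flip: mult add: mult.assoc)
    ultimately have "norm (f x * f x) \<le> \<bar>1\<bar>"
      by (intro norm_square_le_of_sum_squares[of _ "f e"]) (simp_all flip: st add: sa e)
    then have "(norm (f x))\<^sup>2 \<le> 1\<^sup>2"
      using norm_selfadj_square[of "f x"] by (simp flip: st add: sa)
    then show ?thesis by (rule power2_le_imp_le) simp
  qed
  have sa_le': "norm (f x) \<le> norm x" if sa: "star x = x" for x
  proof (cases "x = 0")
    case True
    then show ?thesis using sc[of 0 0] by simp
  next
    case False
    have "norm (f (x /\<^sub>R norm x)) \<le> 1"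
      by (rule sa_le) (use False in \<open>auto simp: star_scaleR sa\<close>)
    then show ?thesis using False by (simp add: sc field_simps)
  qed
  have "(norm (f a))\<^sup>2 = norm (f (star a * a))"
    by (simp add: mult st cstar_identity)
  also have "\<dots> \<le> norm (star a * a)"
    by (rule sa_le') (simp add: star_mult star_star)
  also have "\<dots> = (norm a)\<^sup>2" by (rule cstar_identity)
  finally show ?thesis by (rule power2_le_imp_le) simp
qed

section \<open>Representations on \<open>\<ell>\<^sup>2\<close>\<close>

lemma ell2_inner_summable:
  assumes "x \<in> ell2" "y \<in> ell2"
  shows "(\<lambda>i. cnj (x i) * y i) summable_on UNIV"
  unfolding summable_on_iff_abs_summable_on_complex
  by (rule Infinite_Sum.abs_summable_product)
    (use assms in \<open>simp_all add: ell2_def norm_mult power2_eq_square\<close>)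

lemma ell2_add:
  assumes "x \<in> ell2" "y \<in> ell2"
  shows "(\<lambda>i. x i + y i) \<in> ell2"
proof -
  have "(\<lambda>i. 2 * (cmod (x i))\<^sup>2 + 2 * (cmod (y i))\<^sup>2) summable_on UNIV"
    using assms by (intro summable_on_add summable_on_cmult_right) (auto simp: ell2_def)
  moreover have "(cmod (a + b))\<^sup>2 \<le> 2 * (cmod a)\<^sup>2 + 2 * (cmod b)\<^sup>2" for a b
  proof -
    have "(cmod (a + b))\<^sup>2 \<le> (cmod a + cmod b)\<^sup>2"
      by (simp add: norm_triangle_ineq power_mono)
    also have "\<dots> \<le> 2 * (cmod a)\<^sup>2 + 2 * (cmod b)\<^sup>2"
      using sum_squares_bound[of "cmod a" "cmod b"] by (simp add: power2_sum)
    finally show ?thesis .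
  qed
  ultimately show ?thesis
    unfolding ell2_def by (auto intro: summable_on_comparison_test)
qed

lemma ell2_cmult:
  assumes "x \<in> ell2"
  shows "(\<lambda>i. c * x i) \<in> ell2"
  using assms by (auto simp: ell2_def norm_mult power_mult_distrib intro: summable_on_cmult_right)

lemma ell2_uminus: "x \<in> ell2 \<Longrightarrow> (\<lambda>i. - x i) \<in> ell2"
  using ell2_cmult[of x "- 1"] by simp

lemma ell2_inner_add_left:
  assumes "x \<in> ell2" "y \<in> ell2" "z \<in> ell2"
  shows "ell2_inner (\<lambda>i. x i + y i) z = ell2_inner x z + ell2_inner y z"
  unfolding ell2_inner_def
  by (subst infsum_add[symmetric]) (use assms in \<open>auto intro: ell2_inner_summable simp: distrib_right\<close>)

lemma ell2_inner_add_right: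
  assumes "x \<in> ell2" "y \<in> ell2" "z \<in> ell2"
  shows "ell2_inner z (\<lambda>i. x i + y i) = ell2_inner z x + ell2_inner z y"
  unfolding ell2_inner_def
  by (subst infsum_add[symmetric]) (use assms in \<open>auto intro: ell2_inner_summable simp: distrib_left\<close>)

lemma ell2_inner_cmult_right: "ell2_inner x (\<lambda>i. c * y i) = c * ell2_inner x y"
  unfolding ell2_inner_def by (simp add: mult.left_commute infsum_cmult_right')

lemma ell2_inner_cmult_left: "ell2_inner (\<lambda>i. c * x i) y = cnj c * ell2_inner x y"
  unfolding ell2_inner_def by (simp add: mult.assoc infsum_cmult_right')

lemma ell2_inner_commute: "ell2_inner y x = cnj (ell2_inner x y)"
  unfolding ell2_inner_def by (simp flip: infsum_cnj add: mult.commute)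

lemma ell2_norm_nonneg [simp]: "ell2_norm x \<ge> 0"
  by (simp add: ell2_norm_def infsum_nonneg)

lemma ell2_norm_square: "(ell2_norm x)\<^sup>2 = (\<Sum>\<^sub>\<infinity>i. (cmod (x i))\<^sup>2)"
  by (simp add: ell2_norm_def infsum_nonneg)

lemma ell2_inner_self:
  assumes "x \<in> ell2"
  shows "ell2_inner x x = of_real ((ell2_norm x)\<^sup>2)"
proof -
  have "ell2_inner x x = (\<Sum>\<^sub>\<infinity>i. of_real ((cmod (x i))\<^sup>2))"
    unfolding ell2_inner_def
    by (rule infsum_cong) (metis complex_norm_square mult.commute)
  also have "\<dots> = of_real (\<Sum>\<^sub>\<infinity>i. (cmod (x i))\<^sup>2)"
    using assms unfolding ell2_def mem_Collect_eq
    by (intro infsumI has_sum_of_real has_sum_infsum)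
  finally show ?thesis by (simp add: ell2_norm_square)
qed

lemma ell2_norm_eq_0:
  assumes "x \<in> ell2" "ell2_norm x = 0"
  shows "x = (\<lambda>i. 0)"
proof
  fix i
  have "(\<Sum>\<^sub>\<infinity>i. (cmod (x i))\<^sup>2) \<le> 0" using assms by (simp flip: ell2_norm_square)
  then have "(cmod (x i))\<^sup>2 = 0"
    using assms(1) by (intro nonneg_infsum_le_0D[of "\<lambda>i. (cmod (x i))\<^sup>2" UNIV]) (auto simp: ell2_def)
  then show "x i = 0" by simp
qed

lemma ell2_norm_cmult: "ell2_norm (\<lambda>i. c * x i) = cmod c * ell2_norm x"
proof -
  have "ell2_norm (\<lambda>i. c * x i) = sqrt ((cmod c)\<^sup>2 * (\<Sum>\<^sub>\<infinity>i. (cmod (x i))\<^sup>2))"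
    unfolding ell2_norm_def by (simp add: norm_mult power_mult_distrib infsum_cmult_right')
  then show ?thesis by (simp add: ell2_norm_def real_sqrt_mult)
qed

lemma ell2_norm_add_square:
  assumes "x \<in> ell2" "y \<in> ell2"
  shows "(ell2_norm (\<lambda>i. x i + y i))\<^sup>2
    = (ell2_norm x)\<^sup>2 + 2 * Re (ell2_inner x y) + (ell2_norm y)\<^sup>2"
proof -
  have "of_real ((ell2_norm (\<lambda>i. x i + y i))\<^sup>2)
      = ell2_inner x x + ell2_inner x y + (ell2_inner y x + ell2_inner y y)"
    unfolding ell2_inner_self[OF ell2_add[OF assms], symmetric]
    by (simp add: ell2_inner_add_left ell2_inner_add_right assms ell2_add)
  then have "Re (of_real ((ell2_norm (\<lambda>i. x i + y i))\<^sup>2))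
      = Re (ell2_inner x x + ell2_inner x y + (ell2_inner y x + ell2_inner y y))"
    by (rule arg_cong)
  then show ?thesis
    using assms by (simp add: ell2_inner_self ell2_inner_commute[of y x])
qed

lemma ell2_Cauchy_Schwarz:
  assumes x: "x \<in> ell2" and y: "y \<in> ell2"
  shows "cmod (ell2_inner x y) \<le> ell2_norm x * ell2_norm y"
proof (cases "ell2_norm y = 0")
  case True
  then show ?thesis
    using ell2_norm_eq_0[OF y] by (simp add: ell2_inner_def)
next
  case False
  define n where "n = ell2_norm y"
  define \<beta> where "\<beta> = ell2_inner x y"
  \<comment> \<open>This \<open>c\<close> minimizes the norm of \<open>x + c y\<close>.\<close>
  define c where "c = - cnj \<beta> / of_real (n\<^sup>2)"
  have n: "n > 0" using False ell2_norm_nonneg[of y] unfolding n_def by linarith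
  have "0 \<le> (ell2_norm (\<lambda>i. x i + c * y i))\<^sup>2" by simp
  also have "\<dots> = (ell2_norm x)\<^sup>2 + 2 * Re (c * \<beta>) + (cmod c * n)\<^sup>2"
    using ell2_norm_add_square[OF x ell2_cmult[OF y]]
    by (simp add: ell2_inner_cmult_right ell2_norm_cmult n_def \<beta>_def)
  also have "c * \<beta> = of_real (- ((cmod \<beta>)\<^sup>2 / n\<^sup>2))"
    using complex_norm_square[of \<beta>] by (simp add: c_def mult.commute)
  also have "cmod c = cmod \<beta> / n\<^sup>2"
    using n by (simp add: c_def norm_divide norm_power)
  also have "(cmod \<beta> / n\<^sup>2 * n)\<^sup>2 = (cmod \<beta>)\<^sup>2 / n\<^sup>2"
    using n by (simp add: field_simps power2_eq_square)
  finally have "(cmod \<beta>)\<^sup>2 \<le> (ell2_norm x * n)\<^sup>2"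
    using n by (simp add: field_simps)
  then show ?thesis
    using n by (auto simp: \<beta>_def n_def intro: power2_le_imp_le)
qed

definition ell2_unit :: "'i \<Rightarrow> 'i \<Rightarrow> complex" where
  "ell2_unit k = (\<lambda>i. if i = k then 1 else 0)"

lemma ell2_unit_in_ell2: "ell2_unit k \<in> ell2"
  unfolding ell2_def mem_Collect_eq
  by (rule summable_on_cong_neutral[where T = "{k}", THEN iffD2]) (auto simp: ell2_unit_def)

lemma ell2_inner_unit: "ell2_inner (ell2_unit k) x = x k"
proof -
  have "ell2_inner (ell2_unit k) x = (\<Sum>\<^sub>\<infinity>i\<in>{k}. cnj (ell2_unit k i) * x i)"
    unfolding ell2_inner_def by (rule infsum_cong_neutral) (auto simp: ell2_unit_def)
  then show ?thesis by (simp add: ell2_unit_def)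
qed

lemma ell2_unit_tensor: "ell2_tensor (ell2_unit i) (ell2_unit j) = ell2_unit (i, j)"
  by (auto simp: ell2_tensor_def ell2_unit_def)

lemma infsum_tensor:
  fixes f :: "'i \<Rightarrow> complex" and g :: "'j \<Rightarrow> complex"
  assumes f: "f summable_on UNIV" and g: "g summable_on UNIV"
  shows "(\<lambda>(i, j). f i * g j) summable_on UNIV"
    and "(\<Sum>\<^sub>\<infinity>(i, j). f i * g j) = (\<Sum>\<^sub>\<infinity>i. f i) * (\<Sum>\<^sub>\<infinity>j. g j)"
proof -
  have f': "(\<lambda>i. norm (f i)) summable_on UNIV" and g': "(\<lambda>j. norm (g j)) summable_on UNIV"
    using f g by (simp_all add: summable_on_iff_abs_summable_on_complex)
  have "(\<lambda>p. norm (case p of (i, j) \<Rightarrow> f i * g j)) summable_on (SIGMA _:UNIV. UNIV)"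
    unfolding Infinite_Sum.abs_summable_on_Sigma_iff
  proof (intro conjI ballI)
    show "(\<lambda>j. norm (case (i, j) of (i, j) \<Rightarrow> f i * g j)) summable_on UNIV" for i
      using summable_on_cmult_right[OF g', of "cmod (f i)"] by (simp add: norm_mult)
    show "(\<lambda>i. norm (\<Sum>\<^sub>\<infinity>j. norm (case (i, j) of (i, j) \<Rightarrow> f i * g j))) summable_on UNIV"
      using summable_on_cmult_left[OF f', of "\<bar>\<Sum>\<^sub>\<infinity>j. cmod (g j)\<bar>"]
      by (simp add: norm_mult infsum_cmult_right' abs_mult)
  qed
  then have s: "(\<lambda>(i, j). f i * g j) summable_on (SIGMA _:UNIV. UNIV)"
    by (rule Infinite_Sum.abs_summable_summable)
  then show "(\<lambda>(i, j). f i * g j) summable_on UNIV" by simp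
  have "(\<Sum>\<^sub>\<infinity>(i, j). f i * g j) = (\<Sum>\<^sub>\<infinity>i. \<Sum>\<^sub>\<infinity>j. f i * g j)"
    using infsum_Sigma_banach[OF s] by simp
  then show "(\<Sum>\<^sub>\<infinity>(i, j). f i * g j) = (\<Sum>\<^sub>\<infinity>i. f i) * (\<Sum>\<^sub>\<infinity>j. g j)"
    by (simp add: infsum_cmult_right' infsum_cmult_left')
qed

lemma ell2_tensor_in_ell2:
  assumes "x \<in> ell2" "y \<in> ell2"
  shows "ell2_tensor x y \<in> ell2"
proof -
  have "(\<lambda>i. complex_of_real ((cmod (x i))\<^sup>2)) summable_on UNIV"
    "(\<lambda>i. complex_of_real ((cmod (y i))\<^sup>2)) summable_on UNIV"
    using assms by (simp_all add: ell2_def summable_on_of_real del: of_real_power)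
  from infsum_tensor(1)[OF this]
  have "(\<lambda>p. Re (case p of (i, j) \<Rightarrow> of_real ((cmod (x i))\<^sup>2) * of_real ((cmod (y j))\<^sup>2))) summable_on UNIV"
    by (rule summable_on_Re)
  then show ?thesis
    unfolding ell2_def mem_Collect_eq
    by (rule summable_on_cong[THEN iffD1, rotated])
      (auto simp: ell2_tensor_def norm_mult power_mult_distrib simp flip: of_real_mult)
qed

lemma ell2_inner_tensor:
  assumes "x \<in> ell2" "y \<in> ell2" "x' \<in> ell2" "y' \<in> ell2"
  shows "ell2_inner (ell2_tensor x y) (ell2_tensor x' y') = ell2_inner x x' * ell2_inner y y'"
proof -
  have "ell2_inner (ell2_tensor x y) (ell2_tensor x' y')
      = (\<Sum>\<^sub>\<infinity>(i, j). (cnj (x i) * x' i) * (cnj (y j) * y' j))"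
    unfolding ell2_inner_def by (rule infsum_cong) (auto simp: ell2_tensor_def)
  also have "\<dots> = ell2_inner x x' * ell2_inner y y'"
    unfolding ell2_inner_def
    by (rule infsum_tensor(2)) (use assms in \<open>auto intro: ell2_inner_summable\<close>)
  finally show ?thesis .
qed

lemma ell2_norm_tensor:
  assumes "x \<in> ell2" "y \<in> ell2"
  shows "ell2_norm (ell2_tensor x y) = ell2_norm x * ell2_norm y"
proof -
  have "of_real ((ell2_norm (ell2_tensor x y))\<^sup>2) = (of_real ((ell2_norm x * ell2_norm y)\<^sup>2) :: complex)"
    using assms unfolding power_mult_distrib of_real_mult
    by (simp only: ell2_inner_self[symmetric] ell2_tensor_in_ell2 ell2_inner_tensor)
  then have "(ell2_norm (ell2_tensor x y))\<^sup>2 = (ell2_norm x * ell2_norm y)\<^sup>2"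
    by (simp only: of_real_eq_iff)
  then show ?thesis by (simp add: power2_eq_iff_nonneg)
qed

lemma ell2_norm_zero: "ell2_norm (\<lambda>i. 0) = 0"
  by (simp add: ell2_norm_def)

section \<open>Representations are contractive, and faithful ones are isometric\<close>

locale cstar_rep =
  fixes \<pi> :: "'a::cstar_algebra \<Rightarrow> ('i \<Rightarrow> complex) \<Rightarrow> 'i \<Rightarrow> complex"
  assumes rep: "representation \<pi>"
begin

lemma in_ell2: "x \<in> ell2 \<Longrightarrow> \<pi> a x \<in> ell2"
  using rep by (auto simp: representation_def bounded_operator_def)

lemma vec_add: "x \<in> ell2 \<Longrightarrow> y \<in> ell2 \<Longrightarrow> \<pi> a (\<lambda>i. x i + y i) = (\<lambda>i. \<pi> a x i + \<pi> a y i)"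
  using rep by (auto simp: representation_def bounded_operator_def)

lemma vec_cmult: "x \<in> ell2 \<Longrightarrow> \<pi> a (\<lambda>i. c * x i) = (\<lambda>i. c * \<pi> a x i)"
  using rep by (auto simp: representation_def bounded_operator_def)

lemma add: "x \<in> ell2 \<Longrightarrow> \<pi> (a + b) x = (\<lambda>i. \<pi> a x i + \<pi> b x i)"
  using rep by (auto simp: representation_def)

lemma cmult: "x \<in> ell2 \<Longrightarrow> \<pi> (c *\<^sub>C a) x = (\<lambda>i. c * \<pi> a x i)"
  using rep by (auto simp: representation_def)

lemma mult: "x \<in> ell2 \<Longrightarrow> \<pi> (a * b) x = \<pi> a (\<pi> b x)"
  using rep by (auto simp: representation_def)

lemma one: "x \<in> ell2 \<Longrightarrow> \<pi> 1 x = x"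
  using rep by (auto simp: representation_def)

lemma adjoint: "x \<in> ell2 \<Longrightarrow> y \<in> ell2 \<Longrightarrow> ell2_inner (\<pi> (star a) x) y = ell2_inner x (\<pi> a y)"
  using rep by (auto simp: representation_def)

lemma zero: "x \<in> ell2 \<Longrightarrow> \<pi> 0 x = (\<lambda>i. 0)"
  using cmult[of x 0 0] by simp

lemma scaleR: "x \<in> ell2 \<Longrightarrow> \<pi> (r *\<^sub>R a) x = (\<lambda>i. of_real r * \<pi> a x i)"
  by (simp add: scaleR_eq_scaleC cmult)

lemma minus: "x \<in> ell2 \<Longrightarrow> \<pi> (- a) x = (\<lambda>i. - \<pi> a x i)"
  using scaleR[of x "- 1" a] by simp

lemma diff: "x \<in> ell2 \<Longrightarrow> \<pi> (a - b) x = (\<lambda>i. \<pi> a x i - \<pi> b x i)"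
  using add[of x a "- b"] by (simp add: minus)

lemma inner_add:
  "x \<in> ell2 \<Longrightarrow> y \<in> ell2 \<Longrightarrow> ell2_inner x (\<pi> (a + b) y) = ell2_inner x (\<pi> a y) + ell2_inner x (\<pi> b y)"
  by (simp add: add ell2_inner_add_right in_ell2)

lemma inner_cmult: "y \<in> ell2 \<Longrightarrow> ell2_inner x (\<pi> (c *\<^sub>C a) y) = c * ell2_inner x (\<pi> a y)"
  by (simp add: cmult ell2_inner_cmult_right)

lemma inner_diff:
  "x \<in> ell2 \<Longrightarrow> y \<in> ell2 \<Longrightarrow> ell2_inner x (\<pi> (a - b) y) = ell2_inner x (\<pi> a y) - ell2_inner x (\<pi> b y)"
  using inner_add[of x y "a - b" b] by simp

lemma inner_scaleR: "y \<in> ell2 \<Longrightarrow> ell2_inner x (\<pi> (r *\<^sub>R a) y) = of_real r * ell2_inner x (\<pi> a y)"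
  by (simp add: scaleR_eq_scaleC inner_cmult)

lemma inner_square:
  "x \<in> ell2 \<Longrightarrow> ell2_inner x (\<pi> (star a * a) x) = of_real ((ell2_norm (\<pi> a x))\<^sup>2)"
  using adjoint[of x "\<pi> (star a * a) x" 1] adjoint[of "\<pi> a x" x "star a"]
    adjoint[of x "\<pi> a x" "star a"]
  by (simp add: star_star mult in_ell2 ell2_inner_self)

text \<open>With \<open>b\<close> the normalization of \<open>star a * a\<close> and
  \<open>e\<close> a square root of \<open>1 - b\<close>, the squared norm of
  \<open>\<pi> a x\<close> falls short of the squared bound by exactly
  \<open>(norm a)\<^sup>2\<close> times that of \<open>\<pi> e x\<close>.\<close>

lemma norm_le:
  assumes x: "x \<in> ell2"
  shows "ell2_norm (\<pi> a x) \<le> norm a * ell2_norm x"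
proof (cases "a = 0")
  case True
  then show ?thesis by (simp add: zero x ell2_norm_zero)
next
  case False
  define b where "b = (star a * a) /\<^sub>R (norm a)\<^sup>2"
  have "star b = b" by (simp add: b_def star_scaleR star_mult star_star)
  moreover have "norm b \<le> 1" using False by (simp add: b_def cstar_identity)
  ultimately obtain e where e: "star e = e" "e * e = 1 - b"
    by (rule ex_sqrt_one_minus) blast
  have "star a * a = (norm a)\<^sup>2 *\<^sub>R (1 - star e * e)"
    using False by (simp add: e) (simp add: b_def)
  then have "ell2_inner x (\<pi> (star a * a) x)
      = of_real ((norm a)\<^sup>2) * (ell2_inner x (\<pi> 1 x) - ell2_inner x (\<pi> (star e * e) x))"
    by (simp only: inner_scaleR[OF x] inner_diff[OF x x])
  then have "complex_of_real ((ell2_norm (\<pi> a x))\<^sup>2)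
      = of_real ((norm a)\<^sup>2 * ((ell2_norm x)\<^sup>2 - (ell2_norm (\<pi> e x))\<^sup>2))"
    unfolding inner_square[OF x] one[OF x] ell2_inner_self[OF x]
    by (simp only: of_real_mult of_real_diff)
  then have "(ell2_norm (\<pi> a x))\<^sup>2 = (norm a)\<^sup>2 * ((ell2_norm x)\<^sup>2 - (ell2_norm (\<pi> e x))\<^sup>2)"
    by (simp only: of_real_eq_iff)
  also have "\<dots> \<le> (norm a)\<^sup>2 * (ell2_norm x)\<^sup>2"
    by (intro mult_left_mono) auto
  finally have "(ell2_norm (\<pi> a x))\<^sup>2 \<le> (norm a * ell2_norm x)\<^sup>2"
    by (simp add: power_mult_distrib)
  then show ?thesis by (rule power2_le_imp_le) simp
qed

end

text \<open>The positive part \<open>z\<close> of \<open>x\<^sup>2 - s\<close> is represented by \<open>0\<close>, hence vanishes,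
  so \<open>x\<^sup>2 \<le> s\<close> already holds in the algebra. The spectrum is not needed.\<close>

lemma faithful_selfadj_norm_le:
  fixes \<pi> :: "'a::cstar_algebra \<Rightarrow> ('i \<Rightarrow> complex) \<Rightarrow> 'i \<Rightarrow> complex"
  assumes "representation \<pi>" and faith: "faithful \<pi>" and sa: "star x = x" and C: "C \<ge> 0"
    and bound: "\<And>\<xi>. \<xi> \<in> ell2 \<Longrightarrow> ell2_norm (\<pi> x \<xi>) \<le> C * ell2_norm \<xi>"
  shows "norm x \<le> C"
proof (rule ccontr)
  interpret cstar_rep \<pi> by standard fact
  assume "\<not> norm x \<le> C"
  then have "C\<^sup>2 < (norm x)\<^sup>2" using C by (intro power_strict_mono) auto
  then obtain s where s: "C\<^sup>2 < s" "s < (norm x)\<^sup>2" using dense by blast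
  define y where "y = x * x - s *\<^sub>R 1"
  have "star y = y" by (simp add: y_def star_diff star_mult sa star_scaleR star_one)
  then obtain p w where w: "star w = w" and p: "p = w * w" and pp: "p * p = y * y"
    and comm: "\<And>z. y * z = z * y \<Longrightarrow> w * z = z * w"
    by (rule ex_abs) blast
  define z where "z = p + y"
  have "w * y = y * w" by (rule comm) simp
  then have "p * y = y * p" by (metis p mult.assoc)
  then have yz: "y * z = p * z" by (simp add: z_def algebra_simps pp)
  \<comment> \<open>On \<open>\<eta> = \<pi> z \<xi>\<close> the element \<open>y\<close> acts like
    \<open>p = w * w\<close>, so the quadratic form of \<open>x * x - s\<close> is nonnegative at
    \<eta>; but \<open>\<pi> x\<close> is bounded by \<open>C\<close> and
    \<open>C\<^sup>2 < s\<close>, which leaves only \<open>\<eta> = 0\<close>.\<close>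
  have "\<pi> z \<xi> = \<pi> 0 \<xi>" if \<xi>: "\<xi> \<in> ell2" for \<xi>
  proof -
    define \<eta> where "\<eta> = \<pi> z \<xi>"
    have \<eta>: "\<eta> \<in> ell2" by (simp add: \<eta>_def in_ell2 \<xi>)
    have "\<pi> y \<eta> = \<pi> p \<eta>" by (simp add: \<eta>_def \<xi> yz flip: mult)
    then have "ell2_inner \<eta> (\<pi> (star x * x - s *\<^sub>R 1) \<eta>) = ell2_inner \<eta> (\<pi> (star w * w) \<eta>)"
      by (simp add: y_def p sa w)
    then have "complex_of_real ((ell2_norm (\<pi> x \<eta>))\<^sup>2 - s * (ell2_norm \<eta>)\<^sup>2)
        = of_real ((ell2_norm (\<pi> w \<eta>))\<^sup>2)"
      unfolding inner_diff[OF \<eta> \<eta>] inner_square[OF \<eta>] inner_scaleR[OF \<eta>] one[OF \<eta>] ell2_inner_self[OF \<eta>]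
      by (simp only: of_real_mult of_real_diff)
    then have "(ell2_norm (\<pi> x \<eta>))\<^sup>2 - s * (ell2_norm \<eta>)\<^sup>2 = (ell2_norm (\<pi> w \<eta>))\<^sup>2"
      by (simp only: of_real_eq_iff)
    moreover have "(ell2_norm (\<pi> x \<eta>))\<^sup>2 \<le> C\<^sup>2 * (ell2_norm \<eta>)\<^sup>2"
      using power_mono[OF bound[OF \<eta>], of 2] by (simp add: power_mult_distrib)
    ultimately have "(s - C\<^sup>2) * (ell2_norm \<eta>)\<^sup>2 \<le> 0"
      using zero_le_power2[of "ell2_norm (\<pi> w \<eta>)"] unfolding left_diff_distrib by linarith
    then have "ell2_norm \<eta> = 0" using s(1) by (simp add: mult_le_0_iff)
    then show ?thesis using ell2_norm_eq_0[OF \<eta>] by (simp add: \<eta>_def zero \<xi>)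
  qed
  then have "z = 0" using faith by (auto simp: faithful_def)
  then have "p = - y" by (simp add: z_def eq_neg_iff_add_eq_0)
  then have "x * x + w * w = s *\<^sub>R 1" by (simp add: p y_def algebra_simps)
  moreover have "x * w = w * x"
    by (rule comm[symmetric]) (simp add: y_def algebra_simps)
  ultimately have "norm (x * x) \<le> \<bar>s\<bar>"
    by (intro norm_square_le_of_sum_squares[OF sa w])
  moreover have "s > 0" using s(1) zero_le_power2[of C] by linarith
  ultimately show False using s(2) norm_selfadj_square[OF sa] by simp
qed

text \<open>The bound passes to \<open>star a\<close> by duality, so \<open>star a * a\<close> obeys
  the bound \<open>C\<^sup>2\<close>, and the C*-identity reduces everything to the self-adjoint
  case.\<close>

lemma faithful_norm_le:
  fixes \<pi> :: "'a::cstar_algebra \<Rightarrow> ('i \<Rightarrow> complex) \<Rightarrow> 'i \<Rightarrow> complex"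
  assumes "representation \<pi>" and faith: "faithful \<pi>" and C: "C \<ge> 0"
    and bound: "\<And>\<xi>. \<xi> \<in> ell2 \<Longrightarrow> ell2_norm (\<pi> a \<xi>) \<le> C * ell2_norm \<xi>"
  shows "norm a \<le> C"
proof -
  interpret cstar_rep \<pi> by standard fact
  have bound': "ell2_norm (\<pi> (star a) \<eta>) \<le> C * ell2_norm \<eta>" if \<eta>: "\<eta> \<in> ell2" for \<eta>
  proof -
    define \<zeta> where "\<zeta> = \<pi> (star a) \<eta>"
    have \<zeta>: "\<zeta> \<in> ell2" by (simp add: \<zeta>_def in_ell2 \<eta>)
    have "of_real ((ell2_norm \<zeta>)\<^sup>2) = ell2_inner \<eta> (\<pi> a \<zeta>)"
      using adjoint[OF \<eta> \<zeta>, of a] by (simp add: ell2_inner_self[OF \<zeta>] flip: \<zeta>_def)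
    then have "(ell2_norm \<zeta>)\<^sup>2 = cmod (ell2_inner \<eta> (\<pi> a \<zeta>))"
      by (metis norm_of_real abs_of_nonneg zero_le_power2)
    also have "\<dots> \<le> ell2_norm \<eta> * ell2_norm (\<pi> a \<zeta>)"
      by (rule ell2_Cauchy_Schwarz[OF \<eta> in_ell2[OF \<zeta>]])
    also have "\<dots> \<le> ell2_norm \<eta> * (C * ell2_norm \<zeta>)"
      by (intro mult_left_mono bound \<zeta>) simp
    finally have "ell2_norm \<zeta> * ell2_norm \<zeta> \<le> (C * ell2_norm \<eta>) * ell2_norm \<zeta>"
      by (simp add: power2_eq_square mult_ac)
    then have "ell2_norm \<zeta> \<le> C * ell2_norm \<eta>"
      using C ell2_norm_nonneg[of \<zeta>]
      by (cases "ell2_norm \<zeta> = 0") (auto simp: mult_le_cancel_right)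
    then show ?thesis by (simp add: \<zeta>_def)
  qed
  have "norm (star a * a) \<le> C\<^sup>2"
  proof (rule faithful_selfadj_norm_le[OF assms(1,2)])
    show "star (star a * a) = star a * a" by (simp add: star_mult star_star)
    fix \<xi> :: "'i \<Rightarrow> complex" assume \<xi>: "\<xi> \<in> ell2"
    have "ell2_norm (\<pi> (star a * a) \<xi>) \<le> C * ell2_norm (\<pi> a \<xi>)"
      using bound'[OF in_ell2[OF \<xi>]] by (simp add: mult \<xi>)
    also have "\<dots> \<le> C * (C * ell2_norm \<xi>)"
      by (intro mult_left_mono bound \<xi> C)
    finally show "ell2_norm (\<pi> (star a * a) \<xi>) \<le> C\<^sup>2 * ell2_norm \<xi>"
      by (simp add: power2_eq_square mult.assoc)
  qed simp
  then have "(norm a)\<^sup>2 \<le> C\<^sup>2" by (simp add: cstar_identity)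
  then show ?thesis using C by (rule power2_le_imp_le)
qed

lemma faithful_norm_le_inner:
  fixes \<pi> :: "'a::cstar_algebra \<Rightarrow> ('i \<Rightarrow> complex) \<Rightarrow> 'i \<Rightarrow> complex"
  assumes "representation \<pi>" "faithful \<pi>" and C: "C \<ge> 0"
    and bound: "\<And>\<xi> \<eta>. \<xi> \<in> ell2 \<Longrightarrow> \<eta> \<in> ell2 \<Longrightarrow>
      cmod (ell2_inner \<eta> (\<pi> a \<xi>)) \<le> C * ell2_norm \<eta> * ell2_norm \<xi>"
  shows "norm a \<le> C"
proof (rule faithful_norm_le[OF assms(1-3)])
  interpret cstar_rep \<pi> by standard fact
  fix \<xi> :: "'i \<Rightarrow> complex" assume \<xi>: "\<xi> \<in> ell2"
  define \<zeta> where "\<zeta> = \<pi> a \<xi>"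
  have \<zeta>: "\<zeta> \<in> ell2" by (simp add: \<zeta>_def in_ell2 \<xi>)
  have "(ell2_norm \<zeta>)\<^sup>2 = cmod (ell2_inner \<zeta> \<zeta>)" by (simp add: ell2_inner_self[OF \<zeta>] norm_power)
  also have "\<dots> \<le> C * ell2_norm \<zeta> * ell2_norm \<xi>"
    using bound[OF \<xi> \<zeta>] by (simp add: \<zeta>_def)
  finally have "ell2_norm \<zeta> * ell2_norm \<zeta> \<le> (C * ell2_norm \<xi>) * ell2_norm \<zeta>"
    by (simp add: power2_eq_square mult_ac)
  then have "ell2_norm \<zeta> \<le> C * ell2_norm \<xi>"
    using C ell2_norm_nonneg[of \<zeta>]
    by (cases "ell2_norm \<zeta> = 0") (auto simp: mult_le_cancel_right)
  then show "ell2_norm (\<pi> a \<xi>) \<le> C * ell2_norm \<xi>" by (simp add: \<zeta>_def)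
qed

section \<open>Complex-linear maps, contractions and Markov maps\<close>

text \<open>\<open>bounded_linear\<close> is real linearity; the second clause adds the complex
  scalars.\<close>

definition cblin :: "('a::cstar_algebra \<Rightarrow> 'b::cstar_algebra) \<Rightarrow> bool" where
  "cblin f \<longleftrightarrow> bounded_linear f \<and> (\<forall>c x. f (c *\<^sub>C x) = c *\<^sub>C f x)"

definition ccontr :: "('a::cstar_algebra \<Rightarrow> 'b::cstar_algebra) \<Rightarrow> bool" where
  "ccontr f \<longleftrightarrow> cblin f \<and> (\<forall>x. norm (f x) \<le> norm x)"

text \<open>For scalar-valued \<open>f\<close> these are the states. The two conditions pass through
  compositions, averages and pointwise limits; positivity is derived from them in
  \<open>markov_functional_pos\<close>.\<close>

definition markov :: "('a::cstar_algebra \<Rightarrow> 'b::cstar_algebra) \<Rightarrow> bool" where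
  "markov f \<longleftrightarrow> ccontr f \<and> f 1 = 1"

lemma scaleC_complex [simp]: "c *\<^sub>C (z :: complex) = c * z"
  by (simp add: scaleC_complex_def)

lemma cblin_bounded_linear: "cblin f \<Longrightarrow> bounded_linear f"
  by (simp add: cblin_def)

lemma cblin_add: "cblin f \<Longrightarrow> f (x + y) = f x + f y"
  by (simp add: cblin_def linear_simps)

lemma cblin_diff: "cblin f \<Longrightarrow> f (x - y) = f x - f y"
  by (simp add: cblin_def linear_simps)

lemma cblin_zero: "cblin f \<Longrightarrow> f 0 = 0"
  by (simp add: cblin_def linear_simps)

lemma cblin_scaleC: "cblin f \<Longrightarrow> f (c *\<^sub>C x) = c *\<^sub>C f x"
  by (simp add: cblin_def)

lemma cblin_scaleR: "cblin f \<Longrightarrow> f (r *\<^sub>R x) = r *\<^sub>R f x"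
  by (simp add: cblin_def linear_simps)

lemma cblin_sum: "cblin f \<Longrightarrow> f (\<Sum>i\<in>I. g i) = (\<Sum>i\<in>I. f (g i))"
  by (simp add: cblin_def bounded_linear.linear linear_sum)

lemma cblin_list_sum: "cblin f \<Longrightarrow> f (\<Sum>(a, b)\<leftarrow>ps. g a b) = (\<Sum>(a, b)\<leftarrow>ps. f (g a b))"
  by (induction ps) (auto simp: cblin_zero cblin_add)

lemma cblin_compose: "cblin f \<Longrightarrow> cblin g \<Longrightarrow> cblin (\<lambda>x. f (g x))"
  by (simp add: cblin_def bounded_linear_compose)

lemma cblin_id: "cblin (\<lambda>x. x)"
  by (simp add: cblin_def bounded_linear_ident)

lemma cblin_mult_left: "cblin f \<Longrightarrow> cblin (\<lambda>x. a * f x)"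
  by (simp add: cblin_def bounded_linear_const_mult mult_scaleC_right)

lemma cblin_mult_right: "cblin f \<Longrightarrow> cblin (\<lambda>x. f x * a)"
  by (simp add: cblin_def bounded_linear_mult_const mult_scaleC_left)

lemma cblin_minus: "cblin f \<Longrightarrow> cblin g \<Longrightarrow> cblin (\<lambda>x. f x - g x)"
  by (simp add: cblin_def bounded_linear_sub complex_vector.scale_right_diff_distrib)

lemma cblin_scale: "cblin f \<Longrightarrow> cblin (\<lambda>x. c *\<^sub>C f x)"
  by (simp add: cblin_def bounded_linear_compose[OF bounded_linear_scaleC] scaleC_scaleC mult.commute)

lemma cblin_sum_fun: "(\<And>i. i \<in> I \<Longrightarrow> cblin (f i)) \<Longrightarrow> cblin (\<lambda>x. \<Sum>i\<in>I. f i x)"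
  by (simp add: cblin_def bounded_linear_sum complex_vector.scale_sum_right)

lemma cblinI:
  assumes "\<And>x y. f (x + y) = f x + f y" "\<And>c x. f (c *\<^sub>C x) = c *\<^sub>C f x"
    and "\<And>x. norm (f x) \<le> K * norm x"
  shows "cblin f"
  unfolding cblin_def using assms
  by (auto intro!: bounded_linear_intro[where K = K] simp: scaleR_eq_scaleC mult.commute)

lemma ccontrI:
  assumes "\<And>x y. f (x + y) = f x + f y" "\<And>c x. f (c *\<^sub>C x) = c *\<^sub>C f x"
    and "\<And>x. norm (f x) \<le> norm x"
  shows "ccontr f"
  unfolding ccontr_def using assms by (auto intro!: cblinI[where K = 1])

lemma ccontr_cblin: "ccontr f \<Longrightarrow> cblin f"
  by (simp add: ccontr_def)

lemma ccontr_norm: "ccontr f \<Longrightarrow> norm (f x) \<le> norm x"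
  by (simp add: ccontr_def)

lemma ccontr_compose: "ccontr f \<Longrightarrow> ccontr g \<Longrightarrow> ccontr (\<lambda>x. f (g x))"
  by (auto simp: ccontr_def cblin_compose intro: order_trans)

lemma markov_ccontr: "markov f \<Longrightarrow> ccontr f"
  by (simp add: markov_def)

lemma markov_one: "markov f \<Longrightarrow> f 1 = 1"
  by (simp add: markov_def)

lemma markov_cblin: "markov f \<Longrightarrow> cblin f"
  by (simp add: markov_def ccontr_cblin)

lemma markov_compose: "markov f \<Longrightarrow> markov g \<Longrightarrow> markov (\<lambda>x. f (g x))"
  by (simp add: markov_def ccontr_compose)

lemma markov_id: "markov (\<lambda>x. x)"
  by (simp add: markov_def ccontr_def cblin_id)

lemma markov_average:
  assumes I: "finite I" "I \<noteq> {}" and f: "\<And>i. i \<in> I \<Longrightarrow> markov (f i)"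
  shows "markov (\<lambda>x. (1 / real (card I)) *\<^sub>R (\<Sum>i\<in>I. f i x))"
  unfolding markov_def ccontr_def
proof (intro conjI allI)
  have c: "card I > 0" using I by (simp add: card_gt_0_iff)
  show "cblin (\<lambda>x. (1 / real (card I)) *\<^sub>R (\<Sum>i\<in>I. f i x))"
    unfolding scaleR_eq_scaleC by (intro cblin_scale cblin_sum_fun markov_cblin f)
  show "norm ((1 / real (card I)) *\<^sub>R (\<Sum>i\<in>I. f i x)) \<le> norm x" for x
  proof -
    have "norm (\<Sum>i\<in>I. f i x) \<le> (\<Sum>i\<in>I. norm x)"
      by (intro order_trans[OF norm_sum] sum_mono ccontr_norm markov_ccontr f)
    then show ?thesis using c by (simp add: field_simps)
  qed
  have "(\<Sum>i\<in>I. f i 1) = (\<Sum>i\<in>I. 1)" by (intro sum.cong refl markov_one f)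
  also have "\<dots> = real (card I) *\<^sub>R 1" by (simp add: scaleR_conv_of_real)
  finally show "(1 / real (card I)) *\<^sub>R (\<Sum>i\<in>I. f i 1) = 1"
    using c by simp
qed

lemma star_hom_ccontr: "star_hom f \<Longrightarrow> ccontr f"
  by (rule ccontrI) (auto simp: star_hom_def star_hom_norm_le)

lemma star_hom_markov: "star_hom f \<Longrightarrow> markov f"
  by (simp add: markov_def star_hom_ccontr) (simp add: star_hom_def)

lemma cblin_eq_on_dense:
  assumes dense: "closure (cspan S) = UNIV" and f: "cblin f" and g: "cblin g"
    and eq: "\<And>x. x \<in> S \<Longrightarrow> f x = g x"
  shows "f u = g u"
proof -
  have cont: "continuous_on UNIV f" "continuous_on UNIV g"
    using f g by (simp_all add: cblin_def linear_continuous_on)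
  have "complex_vector.subspace {u. f u = g u}"
    unfolding complex_vector.subspace_def
    using f g by (simp add: cblin_zero cblin_add cblin_scaleC)
  then have "cspan S \<subseteq> {u. f u = g u}"
    using eq by (intro complex_vector.span_minimal) auto
  moreover have "closed {u. f u = g u}"
    using cont by (rule closed_Collect_eq)
  ultimately have "closure (cspan S) \<subseteq> {u. f u = g u}"
    by (rule closure_minimal)
  then show ?thesis using dense by auto
qed

text \<open>If \<open>\<Phi> b\<close> had a nonzero imaginary part, then \<open>b + i r\<close> with \<open>r\<close> large would violate
  the norm bound.\<close>

lemma markov_functional_selfadj_real:
  fixes \<Phi> :: "'a::cstar_algebra \<Rightarrow> complex"
  assumes \<Phi>: "markov \<Phi>" and b: "star b = b"
  shows "Im (\<Phi> b) = 0"
proof (rule ccontr)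
  assume nz: "Im (\<Phi> b) \<noteq> 0"
  have ineq: "2 * r * Im (\<Phi> b) \<le> (norm b)\<^sup>2" for r
  proof -
    define u where "u = b + (\<i> * of_real r) *\<^sub>C 1"
    have "star u * u = b * b + r\<^sup>2 *\<^sub>R 1"
      by (simp add: u_def star_add star_scaleC b star_one algebra_simps mult_scaleC_left
          mult_scaleC_right scaleC_scaleC complex_vector.scale_minus_left power2_eq_square scaleR_eq_scaleC)
    then have "(norm u)\<^sup>2 = norm (b * b + r\<^sup>2 *\<^sub>R 1)" by (metis cstar_identity)
    also have "\<dots> \<le> (norm b)\<^sup>2 + r\<^sup>2"
      using norm_triangle_ineq[of "b * b" "r\<^sup>2 *\<^sub>R 1"] by (simp add: norm_selfadj_square[OF b])
    finally have "(norm u)\<^sup>2 \<le> (norm b)\<^sup>2 + r\<^sup>2" .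
    moreover have "\<Phi> u = \<Phi> b + \<i> * of_real r"
      using markov_cblin[OF \<Phi>] by (simp add: u_def cblin_add cblin_scaleC markov_one[OF \<Phi>])
    moreover have "cmod (\<Phi> u) \<le> norm u" by (rule ccontr_norm[OF markov_ccontr[OF \<Phi>]])
    then have "(cmod (\<Phi> u))\<^sup>2 \<le> (norm u)\<^sup>2" by (simp add: power_mono)
    ultimately have "(Re (\<Phi> b))\<^sup>2 + (Im (\<Phi> b) + r)\<^sup>2 \<le> (norm b)\<^sup>2 + r\<^sup>2"
      by (simp add: cmod_power2)
    moreover have "(Im (\<Phi> b) + r)\<^sup>2 = (Im (\<Phi> b))\<^sup>2 + r\<^sup>2 + 2 * r * Im (\<Phi> b)"
      by (simp add: power2_sum)
    ultimately show ?thesis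
      using zero_le_power2[of "Re (\<Phi> b)"] zero_le_power2[of "Im (\<Phi> b)"] by linarith
  qed
  have "2 * (((norm b)\<^sup>2 + 1) / (2 * Im (\<Phi> b))) * Im (\<Phi> b) = (norm b)\<^sup>2 + 1"
    using nz by (simp add: field_simps)
  then show False using ineq[of "((norm b)\<^sup>2 + 1) / (2 * Im (\<Phi> b))"] by simp
qed

text \<open>\<open>x + star x\<close> and \<open>\<i> *\<^sub>C (x - star x)\<close> are
  self-adjoint, hence \<Phi> takes real values on both.\<close>

lemma markov_functional_star:
  fixes \<Phi> :: "'a::cstar_algebra \<Rightarrow> complex"
  assumes \<Phi>: "markov \<Phi>"
  shows "\<Phi> (star x) = cnj (\<Phi> x)"
proof -
  note lin = cblin_add[OF markov_cblin[OF \<Phi>]] cblin_scaleC[OF markov_cblin[OF \<Phi>]]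
    cblin_diff[OF markov_cblin[OF \<Phi>]]
  have "Im (\<Phi> (x + star x)) = 0"
    by (rule markov_functional_selfadj_real[OF \<Phi>]) (simp add: star_add star_star add.commute)
  moreover have "Im (\<Phi> (\<i> *\<^sub>C (x - star x))) = 0"
    by (rule markov_functional_selfadj_real[OF \<Phi>])
      (simp add: star_scaleC star_diff star_star complex_vector.scale_right_diff_distrib complex_vector.scale_minus_left)
  ultimately show ?thesis by (simp add: lin complex_eq_iff)
qed

text \<open>That \<open>a\<^sup>* a\<close> is the square of a self-adjoint element is avoided: a faithful representation
  gives \<open>\<parallel>1 - a\<^sup>* a\<parallel> \<le> 1\<close> for \<open>\<parallel>a\<parallel> \<le> 1\<close> directly.\<close>

lemma markov_functional_pos:
  fixes \<Phi> :: "'a::cstar_algebra \<Rightarrow> complex"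
    and \<pi> :: "'a \<Rightarrow> ('i \<Rightarrow> complex) \<Rightarrow> 'i \<Rightarrow> complex"
  assumes \<pi>: "representation \<pi>" "faithful \<pi>" and \<Phi>: "markov \<Phi>"
  shows "Re (\<Phi> (star a * a)) \<ge> 0"
proof -
  interpret cstar_rep \<pi> by standard fact
  note lin = cblin_scaleR[OF markov_cblin[OF \<Phi>]] cblin_diff[OF markov_cblin[OF \<Phi>]]
  have pos1: "Re (\<Phi> (star a * a)) \<ge> 0" if a: "norm a \<le> 1" for a
  proof -
    have "norm (1 - star a * a) \<le> 1"
    proof (rule faithful_norm_le[OF \<pi>])
      fix \<xi> :: "'i \<Rightarrow> complex" assume \<xi>: "\<xi> \<in> ell2"
      define \<eta> where "\<eta> = \<pi> (star a * a) \<xi>"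
      have \<eta>: "\<eta> \<in> ell2" by (simp add: \<eta>_def in_ell2 \<xi>)
      have eq: "\<pi> (1 - star a * a) \<xi> = (\<lambda>i. \<xi> i + - \<eta> i)"
        by (simp add: diff \<xi> one \<eta>_def)
      have "(ell2_norm (\<pi> (1 - star a * a) \<xi>))\<^sup>2
          = (ell2_norm \<xi>)\<^sup>2 + 2 * Re (ell2_inner \<xi> (\<lambda>i. - \<eta> i)) + (ell2_norm (\<lambda>i. - \<eta> i))\<^sup>2"
        unfolding eq by (rule ell2_norm_add_square[OF \<xi> ell2_uminus[OF \<eta>]])
      also have "ell2_inner \<xi> (\<lambda>i. - \<eta> i) = - of_real ((ell2_norm (\<pi> a \<xi>))\<^sup>2)"
        using ell2_inner_cmult_right[of \<xi> "- 1" \<eta>] inner_square[OF \<xi>, of a] by (simp add: \<eta>_def)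
      also have "ell2_norm (\<lambda>i. - \<eta> i) = ell2_norm \<eta>"
        using ell2_norm_cmult[of "- 1" \<eta>] by simp
      finally have "(ell2_norm (\<pi> (1 - star a * a) \<xi>))\<^sup>2
          = (ell2_norm \<xi>)\<^sup>2 - 2 * (ell2_norm (\<pi> a \<xi>))\<^sup>2 + (ell2_norm \<eta>)\<^sup>2" by simp
      moreover have "ell2_norm \<eta> \<le> norm (star a) * ell2_norm (\<pi> a \<xi>)"
        unfolding \<eta>_def mult[OF \<xi>] by (rule norm_le[OF in_ell2[OF \<xi>]])
      then have "ell2_norm \<eta> \<le> ell2_norm (\<pi> a \<xi>)"
        using a mult_right_mono[of "norm a" 1 "ell2_norm (\<pi> a \<xi>)"] by (simp add: norm_star)
      then have "(ell2_norm \<eta>)\<^sup>2 \<le> (ell2_norm (\<pi> a \<xi>))\<^sup>2" by (simp add: power_mono)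
      ultimately have "(ell2_norm (\<pi> (1 - star a * a) \<xi>))\<^sup>2 \<le> (ell2_norm \<xi>)\<^sup>2"
        using zero_le_power2[of "ell2_norm (\<pi> a \<xi>)"] by linarith
      then show "ell2_norm (\<pi> (1 - star a * a) \<xi>) \<le> 1 * ell2_norm \<xi>"
        using power2_le_imp_le by simp
    qed simp
    then have "cmod (\<Phi> (1 - star a * a)) \<le> 1"
      using ccontr_norm[OF markov_ccontr[OF \<Phi>]] order_trans by blast
    then have "Re (\<Phi> (1 - star a * a)) \<le> 1" using complex_Re_le_cmod order_trans by blast
    then show ?thesis by (simp add: lin markov_one[OF \<Phi>])
  qed
  show ?thesis
  proof (cases "a = 0")
    case True
    then show ?thesis using lin(1)[of 0 0] by simp
  next
    case False
    have "Re (\<Phi> (star (a /\<^sub>R norm a) * (a /\<^sub>R norm a))) \<ge> 0"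
      using False by (intro pos1) simp
    moreover have "inverse (norm a) * inverse (norm a) > 0" using False by simp
    ultimately show ?thesis
      by (simp add: star_scaleR lin zero_le_mult_iff del: mult_pos_pos)
  qed
qed

text \<open>Cauchy-Schwarz for the form \<open>\<Phi> (star x * y)\<close>: a null vector is
  orthogonal to everything, since otherwise the form on \<open>star w + k *\<^sub>C v\<close> would
  be real-affine in \<open>k\<close> and could be made negative.\<close>

lemma markov_functional_null:
  fixes \<Phi> :: "'a::cstar_algebra \<Rightarrow> complex"
  assumes pos: "\<And>x. Re (\<Phi> (star x * x)) \<ge> 0" and \<Phi>: "markov \<Phi>" and null: "\<Phi> (star v * v) = 0"
  shows "\<Phi> (w * v) = 0"
proof (rule ccontr)
  assume nz: "\<Phi> (w * v) \<noteq> 0"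
  define \<beta> where "\<beta> = \<Phi> (w * v)"
  note lin = cblin_add[OF markov_cblin[OF \<Phi>]] cblin_scaleC[OF markov_cblin[OF \<Phi>]]
  have ineq: "0 \<le> Re (\<Phi> (w * star w)) + 2 * Re (k * \<beta>)" for k
  proof -
    define x where "x = star w + k *\<^sub>C v"
    have "star x * x = w * star w + k *\<^sub>C (w * v) + cnj k *\<^sub>C star (w * v) + (cnj k * k) *\<^sub>C (star v * v)"
      by (simp add: x_def star_add star_scaleC star_star star_mult algebra_simps mult_scaleC_left
          mult_scaleC_right scaleC_scaleC)
    then have "\<Phi> (star x * x) = \<Phi> (w * star w) + k * \<beta> + cnj (k * \<beta>)"
      by (simp add: lin markov_functional_star[OF \<Phi>] null \<beta>_def)
    then show ?thesis using pos[of x] by (simp add: algebra_simps)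
  qed
  define r where "r = Re (\<Phi> (w * star w))"
  \<comment> \<open>Chosen to give \<open>k * \<beta> = - (r + 1)\<close>, so that the bound becomes
    \<open>0 \<le> r - 2 * (r + 1)\<close>.\<close>
  define k where "k = - (cnj \<beta> * of_real ((r + 1) / (cmod \<beta>)\<^sup>2))"
  have r0: "r \<ge> 0" using ineq[of 0] by (simp add: r_def)
  have "k * \<beta> = - of_real (r + 1)"
  proof -
    have "k * \<beta> = - ((\<beta> * cnj \<beta>) * of_real ((r + 1) / (cmod \<beta>)\<^sup>2))" by (simp add: k_def mult_ac)
    also have "\<beta> * cnj \<beta> = of_real ((cmod \<beta>)\<^sup>2)" by (rule complex_norm_square[symmetric])
    finally show ?thesis using nz by (simp add: \<beta>_def)
  qed
  then show False using ineq[of k] r0 by (simp add: r_def)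
qed

section \<open>Minimal tensor products and slice maps\<close>

text \<open>Finite sums of tensors are handled as lists of pairs. Scalars are absorbed into the left
  factor and addition is concatenation, so the sums form a subspace and hence contain the
  span.\<close>

lemma dense_span_list:
  fixes t :: "'a::cstar_algebra \<Rightarrow> 'b \<Rightarrow> 't::cstar_algebra"
  assumes scale: "\<And>c a b. t (c *\<^sub>C a) b = c *\<^sub>C t a b"
    and dense: "closure (cspan {t a b |a b. True}) = UNIV" and e: "e > 0"
  shows "\<exists>ps. norm ((\<Sum>(a, b)\<leftarrow>ps. t a b) - u) < e"
proof -
  define T where "T ps = (\<Sum>(a, b)\<leftarrow>ps. t a b)" for ps
  have T_app: "T (ps @ qs) = T ps + T qs" for ps qs
    by (simp add: T_def)
  have T_sc: "T (map (\<lambda>(a, b). (c *\<^sub>C a, b)) ps) = c *\<^sub>C T ps" for c ps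
    by (induction ps) (auto simp: T_def scale scaleC_add_right)
  have sub: "complex_vector.subspace (range T)"
    unfolding complex_vector.subspace_def
  proof (intro conjI ballI allI)
    have "T [] = 0" by (simp add: T_def)
    then show "0 \<in> range T" by (metis rangeI)
    show "x + y \<in> range T" if "x \<in> range T" "y \<in> range T" for x y
      using that T_app by (metis (no_types, lifting) imageE rangeI)
    show "c *\<^sub>C x \<in> range T" if "x \<in> range T" for c x
      using that T_sc by (metis (no_types, lifting) imageE rangeI)
  qed
  have "t a b = T [(a, b)]" for a b by (simp add: T_def)
  then have "{t a b |a b. True} \<subseteq> range T" by auto
  then have "cspan {t a b |a b. True} \<subseteq> range T"
    using sub by (rule complex_vector.span_minimal)
  then have "closure (range T) = UNIV" using dense closure_mono by blast
  then show ?thesis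
    using e closure_approachable[of u "range T"] by (auto simp: dist_norm T_def)
qed

text \<open>Fixes one choice of the representations that \<open>min_tensor\<close> only asserts to
  exist; what is proved here about \<open>t\<close> alone is exported afterwards.\<close>

locale tensor_rep = P: cstar_rep \<pi> + Q: cstar_rep \<sigma> + R: cstar_rep \<rho>
  for \<pi> :: "'a::cstar_algebra \<Rightarrow> ('a \<Rightarrow> complex) \<Rightarrow> 'a \<Rightarrow> complex"
    and \<sigma> :: "'b::cstar_algebra \<Rightarrow> ('b \<Rightarrow> complex) \<Rightarrow> 'b \<Rightarrow> complex"
    and \<rho> :: "'t::cstar_algebra \<Rightarrow> ('a \<times> 'b \<Rightarrow> complex) \<Rightarrow> 'a \<times> 'b \<Rightarrow> complex" +
  fixes t :: "'a \<Rightarrow> 'b \<Rightarrow> 't"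
  assumes faithful_\<pi>: "faithful \<pi>" and faithful_\<sigma>: "faithful \<sigma>"
    and \<rho>_isometric: "operator_norm (\<rho> u) = norm u"
    and \<rho>_tensor: "x \<in> ell2 \<Longrightarrow> y \<in> ell2 \<Longrightarrow> \<rho> (t a b) (ell2_tensor x y) = ell2_tensor (\<pi> a x) (\<sigma> b y)"
    and dense: "closure (cspan {t a b |a b. True}) = UNIV"
begin

lemma faithful_\<rho>: "faithful \<rho>"
  unfolding faithful_def
proof (intro allI impI)
  fix u v assume eq: "\<forall>x\<in>ell2. \<rho> u x = \<rho> v x"
  have z: "\<rho> (u - v) x = (\<lambda>i. 0)" if "x \<in> ell2" for x
    using that eq by (simp add: R.diff)
  have "(\<lambda>i. 0 :: complex) \<in> ell2" by (simp add: ell2_def)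
  then have ne: "{x :: 'a \<times> 'b \<Rightarrow> complex. x \<in> ell2 \<and> ell2_norm x \<le> 1} \<noteq> {}"
    using ell2_norm_zero by (metis (mono_tags, lifting) empty_Collect_eq zero_le_one)
  have "operator_norm (\<rho> (u - v)) = (SUP x\<in>{x :: 'a \<times> 'b \<Rightarrow> complex. x \<in> ell2 \<and> ell2_norm x \<le> 1}. 0)"
    unfolding operator_norm_def by (rule SUP_cong) (auto simp: z ell2_norm_zero)
  also have "\<dots> = 0" using ne by (rule cSUP_const)
  finally show "u = v" by (simp add: \<rho>_isometric)
qed

text \<open>Unit vectors of the product index set are product vectors, so the hypothesis makes all
  matrix entries of the difference vanish. Passing to the adjoint gives each coordinate of
  \<open>\<rho> w \<xi>\<close> as a pairing of \<xi> with zero. The algebraic rules for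
  \<open>t\<close> below all rest on this.\<close>

lemma eq_of_tensor_inner:
  assumes eq: "\<And>x y x' y'. x \<in> ell2 \<Longrightarrow> y \<in> ell2 \<Longrightarrow> x' \<in> ell2 \<Longrightarrow> y' \<in> ell2 \<Longrightarrow>
    ell2_inner (ell2_tensor x y) (\<rho> u (ell2_tensor x' y'))
      = ell2_inner (ell2_tensor x y) (\<rho> v (ell2_tensor x' y'))"
  shows "u = v"
proof -
  define w where "w = u - v"
  have "ell2_inner (ell2_unit k) (\<rho> w (ell2_unit l)) = 0" for k l
    using eq[of "ell2_unit (fst k)" "ell2_unit (snd k)" "ell2_unit (fst l)" "ell2_unit (snd l)"]
    by (simp add: ell2_unit_in_ell2 ell2_unit_tensor w_def R.inner_diff)
  then have "ell2_inner (ell2_unit l) (\<rho> (star w) (ell2_unit k)) = 0" for k l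
    using R.adjoint[of "ell2_unit k" "ell2_unit l" w]
    by (subst ell2_inner_commute) (simp add: ell2_unit_in_ell2)
  then have z: "\<rho> (star w) (ell2_unit k) = (\<lambda>i. 0)" for k
    by (simp add: ell2_inner_unit fun_eq_iff del: split_paired_All)
  have "\<rho> w \<xi> = (\<lambda>i. 0)" if "\<xi> \<in> ell2" for \<xi>
  proof
    fix k
    have "\<rho> w \<xi> k = ell2_inner (\<rho> (star w) (ell2_unit k)) \<xi>"
      using that by (simp add: R.adjoint ell2_unit_in_ell2 ell2_inner_unit)
    then show "\<rho> w \<xi> k = 0" by (simp add: z ell2_inner_def)
  qed
  then have "w = 0" using faithful_\<rho> by (auto simp: faithful_def R.zero)
  then show ?thesis by (simp add: w_def)
qed

lemma inner_\<rho>: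
  assumes "x \<in> ell2" "y \<in> ell2" "x' \<in> ell2" "y' \<in> ell2"
  shows "ell2_inner (ell2_tensor x y) (\<rho> (t a b) (ell2_tensor x' y'))
    = ell2_inner x (\<pi> a x') * ell2_inner y (\<sigma> b y')"
  using assms by (simp add: \<rho>_tensor ell2_inner_tensor P.in_ell2 Q.in_ell2)

lemma t_add_right: "t a (b + b') = t a b + t a b'"
  by (rule eq_of_tensor_inner) (simp add: inner_\<rho> R.inner_add Q.inner_add ell2_tensor_in_ell2 distrib_left)

lemma t_scale_left: "t (c *\<^sub>C a) b = c *\<^sub>C t a b"
  by (rule eq_of_tensor_inner) (simp add: inner_\<rho> R.inner_cmult P.inner_cmult ell2_tensor_in_ell2)

lemma t_scale_right: "t a (c *\<^sub>C b) = c *\<^sub>C t a b"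
  by (rule eq_of_tensor_inner) (simp add: inner_\<rho> R.inner_cmult Q.inner_cmult ell2_tensor_in_ell2)

lemma t_mult: "t a b * t a' b' = t (a * a') (b * b')"
  by (rule eq_of_tensor_inner)
    (simp add: R.mult ell2_tensor_in_ell2 \<rho>_tensor P.mult Q.mult P.in_ell2 Q.in_ell2)

lemma t_one: "t 1 1 = 1"
  by (rule eq_of_tensor_inner) (simp add: R.one ell2_tensor_in_ell2 \<rho>_tensor P.one Q.one)

lemma t_star: "star (t a b) = t (star a) (star b)"
proof (rule eq_of_tensor_inner)
  fix x x' :: "'a \<Rightarrow> complex" and y y' :: "'b \<Rightarrow> complex"
  assume [simp]: "x \<in> ell2" "y \<in> ell2" "x' \<in> ell2" "y' \<in> ell2"
  have "ell2_inner (ell2_tensor x y) (\<rho> (star (t a b)) (ell2_tensor x' y'))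
      = ell2_inner (\<rho> (star (star (t a b))) (ell2_tensor x y)) (ell2_tensor x' y')"
    by (rule R.adjoint[symmetric]) (simp_all add: ell2_tensor_in_ell2)
  also have "\<dots> = ell2_inner (\<pi> (star (star a)) x) x' * ell2_inner (\<sigma> (star (star b)) y) y'"
    by (simp add: star_star \<rho>_tensor ell2_inner_tensor P.in_ell2 Q.in_ell2)
  also have "\<dots> = ell2_inner x (\<pi> (star a) x') * ell2_inner y (\<sigma> (star b) y')"
    by (simp only: P.adjoint Q.adjoint \<open>x \<in> ell2\<close> \<open>y \<in> ell2\<close> \<open>x' \<in> ell2\<close> \<open>y' \<in> ell2\<close>)
  finally show "ell2_inner (ell2_tensor x y) (\<rho> (star (t a b)) (ell2_tensor x' y'))
      = ell2_inner (ell2_tensor x y) (\<rho> (t (star a) (star b)) (ell2_tensor x' y'))"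
    by (simp add: inner_\<rho>)
qed

lemma cblin_inner_\<pi>:
  assumes "x \<in> ell2" "x' \<in> ell2"
  shows "cblin (\<lambda>a. ell2_inner x (\<pi> a x'))"
    and "cmod (ell2_inner x (\<pi> a x')) \<le> ell2_norm x * ell2_norm x' * norm a"
proof -
  show *: "cmod (ell2_inner x (\<pi> a x')) \<le> ell2_norm x * ell2_norm x' * norm a" for a
    using ell2_Cauchy_Schwarz[OF assms(1) P.in_ell2[OF assms(2)], of a]
      mult_left_mono[OF P.norm_le[OF assms(2)] ell2_norm_nonneg, of x a]
    by (simp add: mult_ac)
  show "cblin (\<lambda>a. ell2_inner x (\<pi> a x'))"
    by (rule cblinI[where K = "ell2_norm x * ell2_norm x'"])
      (use assms * in \<open>simp_all add: P.inner_add P.inner_cmult\<close>)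
qed

lemma cblin_inner_\<sigma>:
  assumes "y \<in> ell2" "y' \<in> ell2"
  shows "cblin (\<lambda>b. ell2_inner y (\<sigma> b y'))"
    and "cmod (ell2_inner y (\<sigma> b y')) \<le> ell2_norm y * ell2_norm y' * norm b"
proof -
  show *: "cmod (ell2_inner y (\<sigma> b y')) \<le> ell2_norm y * ell2_norm y' * norm b" for b
    using ell2_Cauchy_Schwarz[OF assms(1) Q.in_ell2[OF assms(2)], of b]
      mult_left_mono[OF Q.norm_le[OF assms(2)] ell2_norm_nonneg, of y b]
    by (simp add: mult_ac)
  show "cblin (\<lambda>b. ell2_inner y (\<sigma> b y'))"
    by (rule cblinI[where K = "ell2_norm y * ell2_norm y'"])
      (use assms * in \<open>simp_all add: Q.inner_add Q.inner_cmult\<close>)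
qed

lemma cblin_inner_\<rho>:
  assumes "\<xi> \<in> ell2" "\<eta> \<in> ell2"
  shows "cblin (\<lambda>u. ell2_inner \<xi> (\<rho> u \<eta>))"
    and "cmod (ell2_inner \<xi> (\<rho> u \<eta>)) \<le> ell2_norm \<xi> * ell2_norm \<eta> * norm u"
proof -
  show *: "cmod (ell2_inner \<xi> (\<rho> u \<eta>)) \<le> ell2_norm \<xi> * ell2_norm \<eta> * norm u" for u
    using ell2_Cauchy_Schwarz[OF assms(1) R.in_ell2[OF assms(2)], of u]
      mult_left_mono[OF R.norm_le[OF assms(2)] ell2_norm_nonneg, of \<xi> u]
    by (simp add: mult_ac)
  show "cblin (\<lambda>u. ell2_inner \<xi> (\<rho> u \<eta>))"
    by (rule cblinI[where K = "ell2_norm \<xi> * ell2_norm \<eta>"])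
      (use assms * in \<open>simp_all add: R.inner_add R.inner_cmult\<close>)
qed

text \<open>Pairing with vectors \<open>x, x'\<close> on the left leg turns \<open>\<Sum> a\<^sub>i \<otimes> b\<^sub>i\<close> into
  \<open>w = \<Sum> \<langle>x, \<pi> a\<^sub>i x'\<rangle> b\<^sub>i\<close>, whose norm is bounded because \<open>\<sigma>\<close> is isometric; \<open>\<phi> w\<close> is the
  corresponding matrix coefficient of \<open>\<Sum> \<phi> b\<^sub>i a\<^sub>i\<close>.\<close>

lemma right_slice_norm_le:
  assumes \<phi>: "ccontr (\<phi> :: 'b \<Rightarrow> complex)"
  shows "norm (\<Sum>(a, b)\<leftarrow>ps. \<phi> b *\<^sub>C a) \<le> norm (\<Sum>(a, b)\<leftarrow>ps. t a b)"
proof (rule faithful_norm_le_inner[OF P.rep faithful_\<pi>])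
  fix x' x :: "'a \<Rightarrow> complex" assume x: "x \<in> ell2" and x': "x' \<in> ell2"
  define w where "w ps = (\<Sum>(a, b)\<leftarrow>ps. ell2_inner x (\<pi> a x') *\<^sub>C b)" for ps :: "('a \<times> 'b) list"
  note \<phi>l = cblin_add[OF ccontr_cblin[OF \<phi>]] cblin_zero[OF ccontr_cblin[OF \<phi>]]
    cblin_scaleC[OF ccontr_cblin[OF \<phi>]]
  have 1: "ell2_inner x (\<pi> (\<Sum>(a, b)\<leftarrow>ps. \<phi> b *\<^sub>C a) x') = \<phi> (w ps)" for ps
    using x x' by (induction ps)
      (auto simp: w_def \<phi>l P.zero P.inner_add P.inner_cmult ell2_inner_def[of _ "\<lambda>i. 0"])
  have 2: "ell2_inner y (\<sigma> (w ps) y')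
      = ell2_inner (ell2_tensor x y) (\<rho> (\<Sum>(a, b)\<leftarrow>ps. t a b) (ell2_tensor x' y'))"
    if "y \<in> ell2" "y' \<in> ell2" for y y' ps
    using that x x' by (induction ps)
      (auto simp: w_def Q.zero R.zero Q.inner_add Q.inner_cmult R.inner_add ell2_tensor_in_ell2
        inner_\<rho> ell2_inner_def[of _ "\<lambda>i. 0"])
  have "norm (w ps) \<le> ell2_norm x * ell2_norm x' * norm (\<Sum>(a, b)\<leftarrow>ps. t a b)"
  proof (rule faithful_norm_le_inner[OF Q.rep faithful_\<sigma>])
    fix y' y :: "'b \<Rightarrow> complex" assume y: "y \<in> ell2" and y': "y' \<in> ell2"
    show "cmod (ell2_inner y (\<sigma> (w ps) y'))
        \<le> ell2_norm x * ell2_norm x' * norm (\<Sum>(a, b)\<leftarrow>ps. t a b) * ell2_norm y * ell2_norm y'"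
      using cblin_inner_\<rho>(2)[of "ell2_tensor x y" "ell2_tensor x' y'" "\<Sum>(a, b)\<leftarrow>ps. t a b"] x x' y y'
      by (simp add: 2 ell2_tensor_in_ell2 ell2_norm_tensor mult_ac)
  qed simp
  then show "cmod (ell2_inner x (\<pi> (\<Sum>(a, b)\<leftarrow>ps. \<phi> b *\<^sub>C a) x'))
      \<le> norm (\<Sum>(a, b)\<leftarrow>ps. t a b) * ell2_norm x * ell2_norm x'"
    using ccontr_norm[OF \<phi>, of "w ps"] by (simp add: 1 mult_ac)
qed simp

lemma left_slice_norm_le:
  assumes \<phi>: "ccontr (\<phi> :: 'a \<Rightarrow> complex)"
  shows "norm (\<Sum>(a, b)\<leftarrow>ps. \<phi> a *\<^sub>C b) \<le> norm (\<Sum>(a, b)\<leftarrow>ps. t a b)"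
proof (rule faithful_norm_le_inner[OF Q.rep faithful_\<sigma>])
  fix y' y :: "'b \<Rightarrow> complex" assume y: "y \<in> ell2" and y': "y' \<in> ell2"
  define w where "w ps = (\<Sum>(a, b)\<leftarrow>ps. ell2_inner y (\<sigma> b y') *\<^sub>C a)" for ps :: "('a \<times> 'b) list"
  note \<phi>l = cblin_add[OF ccontr_cblin[OF \<phi>]] cblin_zero[OF ccontr_cblin[OF \<phi>]]
    cblin_scaleC[OF ccontr_cblin[OF \<phi>]]
  have 1: "ell2_inner y (\<sigma> (\<Sum>(a, b)\<leftarrow>ps. \<phi> a *\<^sub>C b) y') = \<phi> (w ps)" for ps
    using y y' by (induction ps)
      (auto simp: w_def \<phi>l Q.zero Q.inner_add Q.inner_cmult ell2_inner_def[of _ "\<lambda>i. 0"])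
  have 2: "ell2_inner x (\<pi> (w ps) x')
      = ell2_inner (ell2_tensor x y) (\<rho> (\<Sum>(a, b)\<leftarrow>ps. t a b) (ell2_tensor x' y'))"
    if "x \<in> ell2" "x' \<in> ell2" for x x' ps
    using that y y' by (induction ps)
      (auto simp: w_def P.zero R.zero P.inner_add P.inner_cmult R.inner_add ell2_tensor_in_ell2
        inner_\<rho> ell2_inner_def[of _ "\<lambda>i. 0"])
  have "norm (w ps) \<le> ell2_norm y * ell2_norm y' * norm (\<Sum>(a, b)\<leftarrow>ps. t a b)"
  proof (rule faithful_norm_le_inner[OF P.rep faithful_\<pi>])
    fix x' x :: "'a \<Rightarrow> complex" assume x: "x \<in> ell2" and x': "x' \<in> ell2"
    show "cmod (ell2_inner x (\<pi> (w ps) x'))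
        \<le> ell2_norm y * ell2_norm y' * norm (\<Sum>(a, b)\<leftarrow>ps. t a b) * ell2_norm x * ell2_norm x'"
      using cblin_inner_\<rho>(2)[of "ell2_tensor x y" "ell2_tensor x' y'" "\<Sum>(a, b)\<leftarrow>ps. t a b"] x x' y y'
      by (simp add: 2 ell2_tensor_in_ell2 ell2_norm_tensor mult_ac)
  qed simp
  then show "cmod (ell2_inner y (\<sigma> (\<Sum>(a, b)\<leftarrow>ps. \<phi> a *\<^sub>C b) y'))
      \<le> norm (\<Sum>(a, b)\<leftarrow>ps. t a b) * ell2_norm y * ell2_norm y'"
    using ccontr_norm[OF \<phi>, of "w ps"] by (simp add: 1 mult_ac)
qed simp

text \<open>Extension by continuity from sums of tensors. The bound, applied to differences, makes
  \<open>S\<close> Lipschitz with respect to \<open>T\<close>; in particular \<open>S ps\<close>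
  depends only on \<open>T ps\<close>.\<close>

lemma ex_extension:
  fixes k :: "'a \<Rightarrow> 'b \<Rightarrow> 'c::cstar_algebra"
  assumes scale: "\<And>c a b. k (c *\<^sub>C a) b = c *\<^sub>C k a b"
    and bound: "\<And>ps. norm (\<Sum>(a, b)\<leftarrow>ps. k a b) \<le> norm (\<Sum>(a, b)\<leftarrow>ps. t a b)"
  shows "\<exists>K. ccontr K \<and> (\<forall>a b. K (t a b) = k a b)"
proof -
  define T where "T ps = (\<Sum>(a, b)\<leftarrow>ps. t a b)" for ps
  define S where "S ps = (\<Sum>(a, b)\<leftarrow>ps. k a b)" for ps
  define sc :: "complex \<Rightarrow> ('a \<times> 'b) list \<Rightarrow> ('a \<times> 'b) list" where "sc c = map (\<lambda>(a, b). (c *\<^sub>C a, b))" for c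
  have T_app: "T (ps @ qs) = T ps + T qs" and S_app: "S (ps @ qs) = S ps + S qs" for ps qs
    by (simp_all add: T_def S_def)
  have T_sc: "T (sc c ps) = c *\<^sub>C T ps" for c ps
    by (induction ps) (auto simp: T_def sc_def t_scale_left scaleC_add_right)
  have S_sc: "S (sc c ps) = c *\<^sub>C S ps" for c ps
    by (induction ps) (auto simp: S_def sc_def scale scaleC_add_right)
  \<comment> \<open>A difference of sums is again a sum over a list: append \<open>qs\<close> with
    its left entries multiplied by -1.\<close>
  have ST: "norm (S ps - S qs) \<le> norm (T ps - T qs)" for ps qs
    using bound[of "ps @ sc (- 1) qs"]
    by (simp flip: T_def S_def add: T_app S_app T_sc S_sc complex_vector.scale_minus_left)
  have approx: "\<exists>ps. norm (T ps - u) < e" if "e > 0" for u e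
    unfolding T_def using t_scale_left dense that by (rule dense_span_list)
  \<comment> \<open>This inequality for all \<open>ps\<close> pins down the value at
    \<open>u\<close>; additivity, homogeneity and the norm bound of \<open>K\<close> are read off
    from it.\<close>
  have "\<exists>k. \<forall>ps. norm (S ps - k) \<le> norm (T ps - u)" for u
  proof -
    have "\<forall>n. \<exists>ps. norm (T ps - u) < 1 / real (Suc n)" using approx by simp
    then obtain ps where ps: "\<And>n. norm (T (ps n) - u) < 1 / real (Suc n)" by metis
    have lim: "(\<lambda>n. T (ps n)) \<longlonglongrightarrow> u"
    proof (rule LIMSEQ_I)
      fix e :: real assume "e > 0"
      then obtain N where N: "1 / real (Suc N) < e" using nat_approx_posE by blast
      have "norm (T (ps n) - u) < e" if "n \<ge> N" for n
      proof -
        have "1 / real (Suc n) \<le> 1 / real (Suc N)" using that by (simp add: field_simps)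
        then show ?thesis using ps[of n] N by linarith
      qed
      then show "\<exists>N. \<forall>n\<ge>N. norm (T (ps n) - u) < e" by blast
    qed
    have "Cauchy (\<lambda>n. S (ps n))"
    proof (rule CauchyI)
      fix e :: real assume "e > 0"
      then obtain M where "\<forall>m\<ge>M. \<forall>n\<ge>M. norm (T (ps m) - T (ps n)) < e"
        using LIMSEQ_imp_Cauchy[OF lim] CauchyD by blast
      then show "\<exists>M. \<forall>m\<ge>M. \<forall>n\<ge>M. norm (S (ps m) - S (ps n)) < e"
        using ST by (meson le_less_trans)
    qed
    then obtain k where k: "(\<lambda>n. S (ps n)) \<longlonglongrightarrow> k" using Cauchy_convergent convergent_def by blast
    have "norm (S qs - k) \<le> norm (T qs - u)" for qs
      by (rule LIMSEQ_le[of "\<lambda>n. norm (S qs - S (ps n))" _ "\<lambda>n. norm (T qs - T (ps n))"])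
        (auto intro!: tendsto_intros k lim ST)
    then show ?thesis by blast
  qed
  then obtain K where K: "\<And>ps u. norm (S ps - K u) \<le> norm (T ps - u)" by metis
  have "K (u + v) = K u + K v" for u v
  proof -
    have "norm (K (u + v) - (K u + K v)) \<le> e" if "e > 0" for e
    proof -
      obtain ps where ps: "norm (T ps - u) < e / 4" using approx[of "e / 4" u] \<open>e > 0\<close> by auto
      obtain qs where qs: "norm (T qs - v) < e / 4" using approx[of "e / 4" v] \<open>e > 0\<close> by auto
      have "norm (K (u + v) - (K u + K v))
          = norm ((S ps - K u) + (S qs - K v) - (S (ps @ qs) - K (u + v)))"
        by (simp add: S_app algebra_simps)
      also have "\<dots> \<le> norm (S ps - K u) + norm (S qs - K v) + norm (S (ps @ qs) - K (u + v))"
        using norm_triangle_ineq4[of "(S ps - K u) + (S qs - K v)" "S (ps @ qs) - K (u + v)"]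
          norm_triangle_ineq[of "S ps - K u" "S qs - K v"] by linarith
      also have "norm (S (ps @ qs) - K (u + v)) \<le> norm ((T ps - u) + (T qs - v))"
        using K[of "ps @ qs" "u + v"] by (simp add: T_app algebra_simps)
      also have "\<dots> \<le> norm (T ps - u) + norm (T qs - v)" by (rule norm_triangle_ineq)
      finally show ?thesis using K[of ps u] K[of qs v] ps qs by linarith
    qed
    then have "norm (K (u + v) - (K u + K v)) \<le> 0" by (rule field_le_epsilon[of _ 0, simplified])
    then show ?thesis by simp
  qed
  moreover have "K (c *\<^sub>C u) = c *\<^sub>C K u" for c u
  proof -
    have "norm (K (c *\<^sub>C u) - c *\<^sub>C K u) \<le> e" if "e > 0" for e
    proof -
      define d where "d = e / (2 * (cmod c + 1))"
      have "cmod c + 1 > 0" by (simp add: add_nonneg_pos)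
      then have d: "d > 0" "2 * (cmod c + 1) * d = e" using \<open>e > 0\<close> by (simp_all add: d_def)
      obtain ps where ps: "norm (T ps - u) < d" using approx[of d u] d by auto
      have "norm (K (c *\<^sub>C u) - c *\<^sub>C K u)
          = norm (c *\<^sub>C (S ps - K u) - (S (sc c ps) - K (c *\<^sub>C u)))"
        by (simp add: S_sc complex_vector.scale_right_diff_distrib)
      also have "\<dots> \<le> cmod c * norm (S ps - K u) + norm (S (sc c ps) - K (c *\<^sub>C u))"
        using norm_triangle_ineq4 norm_scaleC by metis
      also have "norm (S (sc c ps) - K (c *\<^sub>C u)) \<le> norm (c *\<^sub>C (T ps - u))"
        using K[of "sc c ps" "c *\<^sub>C u"] by (simp add: T_sc complex_vector.scale_right_diff_distrib)
      also have "\<dots> = cmod c * norm (T ps - u)" by (rule norm_scaleC)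
      also have "cmod c * norm (S ps - K u) + cmod c * norm (T ps - u) \<le> cmod c * d + cmod c * d"
        using K[of ps u] ps by (intro add_mono mult_left_mono) auto
      also have "\<dots> \<le> e" using d by (simp add: algebra_simps)
      finally show ?thesis by simp
    qed
    then have "norm (K (c *\<^sub>C u) - c *\<^sub>C K u) \<le> 0" by (rule field_le_epsilon[of _ 0, simplified])
    then show ?thesis by simp
  qed
  moreover have "norm (K u) \<le> norm u" for u
    using K[of "[]" u] by (simp add: S_def T_def)
  moreover have "K (t a b) = k a b" for a b
    using K[of "[(a, b)]" "t a b"] by (simp add: S_def T_def)
  ultimately show ?thesis by (intro exI[of _ K] conjI ccontrI) auto
qed

lemma ex_right_slice:
  assumes "ccontr (\<phi> :: 'b \<Rightarrow> complex)"
  shows "\<exists>K. ccontr K \<and> (\<forall>a b. K (t a b) = \<phi> b *\<^sub>C a)"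
  using right_slice_norm_le[OF assms]
  by (intro ex_extension) (simp_all add: scaleC_scaleC mult.commute)

lemma ex_left_slice:
  assumes "ccontr (\<phi> :: 'a \<Rightarrow> complex)"
  shows "\<exists>K. ccontr K \<and> (\<forall>a b. K (t a b) = \<phi> a *\<^sub>C b)"
  using left_slice_norm_le[OF assms]
  by (intro ex_extension) (simp_all add: scaleC_scaleC cblin_scaleC[OF ccontr_cblin[OF assms]])

text \<open>Vector states suffice: after normalization they show that all diagonal coefficients of
  \<open>\<sigma> b\<close> vanish, and polarization with the scalars 1 and \<open>\<i>\<close>
  takes care of the rest.\<close>

lemma right_factor_states_separate:
  assumes "\<And>\<phi> :: 'b \<Rightarrow> complex. markov \<phi> \<Longrightarrow> \<phi> b = 0"
  shows "b = 0"
proof -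
  have self0: "ell2_inner y (\<sigma> b y) = 0" if y: "y \<in> ell2" for y
  proof (cases "ell2_norm y = 0")
    case True
    then show ?thesis using ell2_norm_eq_0[OF y] by (simp add: ell2_inner_def)
  next
    case False
    define r where "r = (1 / ell2_norm y)\<^sup>2"
    have r: "r * (ell2_norm y)\<^sup>2 = 1" "r \<ge> 0" using False by (simp_all add: r_def power_divide)
    have cb: "cblin (\<lambda>b. of_real r *\<^sub>C ell2_inner y (\<sigma> b y))"
      by (rule cblin_scale[OF cblin_inner_\<sigma>(1)[OF y y]])
    have "cmod (of_real r * ell2_inner y (\<sigma> b y)) \<le> norm b" for b
    proof -
      have "cmod (of_real r * ell2_inner y (\<sigma> b y)) = r * cmod (ell2_inner y (\<sigma> b y))"
        using r by (simp add: norm_mult)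
      also have "\<dots> \<le> r * (ell2_norm y * ell2_norm y * norm b)"
        using r by (intro mult_left_mono cblin_inner_\<sigma>(2) y)
      also have "\<dots> = (r * (ell2_norm y)\<^sup>2) * norm b" by (simp add: power2_eq_square)
      finally show ?thesis by (simp add: r)
    qed
    moreover have "of_real r * ell2_inner y (\<sigma> 1 y) = 1"
      using r(1) unfolding Q.one[OF y] ell2_inner_self[OF y] by (metis of_real_mult of_real_1)
    ultimately have "markov (\<lambda>b. of_real r *\<^sub>C ell2_inner y (\<sigma> b y))"
      using cb by (simp add: markov_def ccontr_def)
    then have "of_real r *\<^sub>C ell2_inner y (\<sigma> b y) = 0" by (rule assms)
    then show ?thesis using r by auto
  qed
  have "\<sigma> b y = \<sigma> 0 y" if y: "y \<in> ell2" for y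
  proof -
    define z where "z = \<sigma> b y"
    have z: "z \<in> ell2" by (simp add: z_def Q.in_ell2 y)
    have sum0: "cnj c * ell2_inner z (\<sigma> b y) + c * ell2_inner y (\<sigma> b z) = 0" for c
    proof -
      have cz: "(\<lambda>i. c * z i) \<in> ell2" by (rule ell2_cmult[OF z])
      have "ell2_inner (\<lambda>i. y i + c * z i) (\<sigma> b (\<lambda>i. y i + c * z i)) = 0"
        by (rule self0[OF ell2_add[OF y cz]])
      then show ?thesis
        by (simp add: Q.vec_add y z cz Q.vec_cmult Q.in_ell2 ell2_cmult ell2_inner_add_left
            ell2_inner_add_right ell2_add ell2_inner_cmult_left ell2_inner_cmult_right self0 add.commute)
    qed
    have "ell2_inner z (\<sigma> b y) = 0"
      using sum0[of 1] sum0[of \<i>] by (simp add: complex_eq_iff)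
    then have "ell2_norm z = 0" using ell2_inner_self[OF z] by (simp add: z_def)
    then show ?thesis using ell2_norm_eq_0[OF z] by (simp add: z_def Q.zero y)
  qed
  then show ?thesis using faithful_\<sigma> by (auto simp: faithful_def)
qed

text \<open>Slicing with the functional \<open>ell2_inner y (\<sigma> b y')\<close> of
  \<open>b\<close> recovers the matrix coefficients of \<open>\<rho> u\<close> at product vectors.
  For different \<open>y\<close> and \<open>y'\<close> it is in general no state, hence the
  hypotheses over all contractions; \<open>r\<close> scales it to one.\<close>

lemma right_slices_separate:
  assumes K: "\<And>\<phi>. ccontr \<phi> \<Longrightarrow> ccontr (K \<phi>)" "\<And>\<phi> a b. ccontr \<phi> \<Longrightarrow> K \<phi> (t a b) = \<phi> b *\<^sub>C a"
    and zero: "\<And>\<phi> :: 'b \<Rightarrow> complex. ccontr \<phi> \<Longrightarrow> K \<phi> u = 0"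
  shows "u = 0"
proof (rule eq_of_tensor_inner)
  fix x x' :: "'a \<Rightarrow> complex" and y y' :: "'b \<Rightarrow> complex"
  assume [simp]: "x \<in> ell2" "y \<in> ell2" "x' \<in> ell2" "y' \<in> ell2"
  define r where "r = 1 / (ell2_norm y * ell2_norm y' + 1)"
  have pos: "ell2_norm y * ell2_norm y' + 1 > 0" by (simp add: add_nonneg_pos)
  then have r: "r > 0" "r * (ell2_norm y * ell2_norm y') \<le> 1" by (simp_all add: r_def field_simps)
  define \<phi> where "\<phi> b = of_real r *\<^sub>C ell2_inner y (\<sigma> b y')" for b
  have "cmod (\<phi> b) \<le> norm b" for b
  proof -
    have "cmod (\<phi> b) = r * cmod (ell2_inner y (\<sigma> b y'))"
      using r by (simp add: \<phi>_def norm_mult)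
    also have "\<dots> \<le> r * (ell2_norm y * ell2_norm y' * norm b)"
      using r by (intro mult_left_mono cblin_inner_\<sigma>(2)) auto
    also have "\<dots> = (r * (ell2_norm y * ell2_norm y')) * norm b" by simp
    also have "\<dots> \<le> 1 * norm b" by (intro mult_right_mono r) simp
    finally show ?thesis by simp
  qed
  then have \<phi>: "ccontr \<phi>"
    using cblin_scale[OF cblin_inner_\<sigma>(1)[of y y'], of "of_real r"]
    unfolding ccontr_def \<phi>_def[abs_def] by simp
  have "ell2_inner x (\<pi> (K \<phi> u) x') = of_real r *\<^sub>C ell2_inner (ell2_tensor x y) (\<rho> u (ell2_tensor x' y'))"
  proof (rule cblin_eq_on_dense[OF dense, of "\<lambda>u. ell2_inner x (\<pi> (K \<phi> u) x')"])
    show "cblin (\<lambda>u. ell2_inner x (\<pi> (K \<phi> u) x'))"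
      by (rule cblin_compose[OF cblin_inner_\<pi>(1) ccontr_cblin[OF K(1)[OF \<phi>]]]) simp_all
    show "cblin (\<lambda>u. of_real r *\<^sub>C ell2_inner (ell2_tensor x y) (\<rho> u (ell2_tensor x' y')))"
      by (intro cblin_scale cblin_inner_\<rho> ell2_tensor_in_ell2) simp_all
  qed (auto simp: K(2)[OF \<phi>] P.inner_cmult inner_\<rho> \<phi>_def)
  then have "ell2_inner (ell2_tensor x y) (\<rho> u (ell2_tensor x' y')) = 0"
    using r by (simp add: zero[OF \<phi>] P.zero ell2_inner_def[of _ "\<lambda>i. 0"])
  then show "ell2_inner (ell2_tensor x y) (\<rho> u (ell2_tensor x' y'))
      = ell2_inner (ell2_tensor x y) (\<rho> 0 (ell2_tensor x' y'))"
    by (simp add: R.zero ell2_tensor_in_ell2 ell2_inner_def[of _ "\<lambda>i. 0"])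
qed

end

text \<open>This is \<open>id \<otimes> \<phi>\<close>. Over a minimal tensor product and for
  contractive \<phi>, density of the elementary tensors leaves exactly one candidate, so
  \<open>SOME\<close> involves no real choice.\<close>

definition rslice :: "('a::cstar_algebra \<Rightarrow> 'b::cstar_algebra \<Rightarrow> 't::cstar_algebra) \<Rightarrow>
    ('b \<Rightarrow> complex) \<Rightarrow> 't \<Rightarrow> 'a" where
  "rslice t \<phi> = (SOME K. ccontr K \<and> (\<forall>a b. K (t a b) = \<phi> b *\<^sub>C a))"

definition lslice :: "('a::cstar_algebra \<Rightarrow> 'b::cstar_algebra \<Rightarrow> 't::cstar_algebra) \<Rightarrow>
    ('a \<Rightarrow> complex) \<Rightarrow> 't \<Rightarrow> 'b" where
  "lslice t \<phi> = (SOME K. ccontr K \<and> (\<forall>a b. K (t a b) = \<phi> a *\<^sub>C b))"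

locale tensor_product =
  fixes t :: "'a::cstar_algebra \<Rightarrow> 'b::cstar_algebra \<Rightarrow> 't::cstar_algebra"
  assumes min_tensor: "min_tensor t"
begin

lemma ex_rep: "\<exists>\<pi> \<sigma> \<rho>. tensor_rep \<pi> \<sigma> \<rho> t"
proof -
  obtain \<pi> :: "'a \<Rightarrow> ('a \<Rightarrow> complex) \<Rightarrow> 'a \<Rightarrow> complex" and \<sigma> :: "'b \<Rightarrow> ('b \<Rightarrow> complex) \<Rightarrow> 'b \<Rightarrow> complex"
    and \<rho> :: "'t \<Rightarrow> ('a \<times> 'b \<Rightarrow> complex) \<Rightarrow> 'a \<times> 'b \<Rightarrow> complex"
    where "Defs.representation \<pi>" "faithful \<pi>" "Defs.representation \<sigma>" "faithful \<sigma>" "Defs.representation \<rho>"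
      "\<forall>u. operator_norm (\<rho> u) = norm u"
      "\<forall>a b. \<forall>x\<in>ell2. \<forall>y\<in>ell2. \<rho> (t a b) (ell2_tensor x y) = ell2_tensor (\<pi> a x) (\<sigma> b y)"
      "closure (cspan {t a b |a b. True}) = UNIV"
    using min_tensor unfolding min_tensor_def by blast
  then have "tensor_rep \<pi> \<sigma> \<rho> t"
    by (simp add: tensor_rep_def tensor_rep_axioms_def cstar_rep_def)
  then show ?thesis by blast
qed

lemma dense: "closure (cspan {t a b |a b. True}) = UNIV"
  using min_tensor by (simp add: min_tensor_def)

lemma
  shows add_right: "t a (b + b') = t a b + t a b'"
    and scale_left: "t (c *\<^sub>C a) b = c *\<^sub>C t a b"
    and scale_right: "t a (c *\<^sub>C b) = c *\<^sub>C t a b"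
    and mult: "t a b * t a' b' = t (a * a') (b * b')"
    and one: "t 1 1 = 1"
    and star: "star (t a b) = t (star a) (star b)"
  using ex_rep tensor_rep.t_add_right tensor_rep.t_scale_left
    tensor_rep.t_scale_right tensor_rep.t_mult tensor_rep.t_one tensor_rep.t_star
  by metis+

lemma star_hom_right: "star_hom (\<lambda>b. t 1 b)"
  by (auto simp: star_hom_def add_right scale_right mult one star star_one)

text \<open>Boundedness comes from \<open>t a b = t a 1 * t 1 b\<close> and the contractivity of the
  homomorphism \<open>b \<mapsto> t 1 b\<close>.\<close>

lemma cblin_right: "cblin (\<lambda>b. t a b)"
proof -
  have "cblin (\<lambda>b. t a 1 * t 1 b)"
    by (intro cblin_mult_left ccontr_cblin star_hom_ccontr star_hom_right)
  then show ?thesis by (simp add: mult)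
qed

lemma eq_on_tensors:
  assumes "cblin f" "cblin g" "\<And>a b. f (t a b) = g (t a b)"
  shows "f u = g u"
  by (rule cblin_eq_on_dense[OF dense assms(1,2)]) (use assms(3) in auto)

lemma
  assumes "ccontr (\<phi> :: 'b \<Rightarrow> complex)"
  shows rslice_ccontr: "ccontr (rslice t \<phi>)"
    and rslice_tensor: "rslice t \<phi> (t a b) = \<phi> b *\<^sub>C a"
proof -
  have "\<exists>K. ccontr K \<and> (\<forall>a b. K (t a b) = \<phi> b *\<^sub>C a)"
    using ex_rep tensor_rep.ex_right_slice assms by blast
  then have "ccontr (rslice t \<phi>) \<and> (\<forall>a b. rslice t \<phi> (t a b) = \<phi> b *\<^sub>C a)"
    unfolding rslice_def by (rule someI_ex)
  then show "ccontr (rslice t \<phi>)" "rslice t \<phi> (t a b) = \<phi> b *\<^sub>C a" by auto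
qed

lemma
  assumes "ccontr (\<phi> :: 'a \<Rightarrow> complex)"
  shows lslice_ccontr: "ccontr (lslice t \<phi>)"
    and lslice_tensor: "lslice t \<phi> (t a b) = \<phi> a *\<^sub>C b"
proof -
  have "\<exists>K. ccontr K \<and> (\<forall>a b. K (t a b) = \<phi> a *\<^sub>C b)"
    using ex_rep tensor_rep.ex_left_slice assms by blast
  then have "ccontr (lslice t \<phi>) \<and> (\<forall>a b. lslice t \<phi> (t a b) = \<phi> a *\<^sub>C b)"
    unfolding lslice_def by (rule someI_ex)
  then show "ccontr (lslice t \<phi>)" "lslice t \<phi> (t a b) = \<phi> a *\<^sub>C b" by auto
qed

lemma rslice_markov: "markov \<phi> \<Longrightarrow> markov (rslice t \<phi>)"
  using rslice_tensor[of \<phi> 1 1] by (simp add: markov_def rslice_ccontr one)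

lemma lslice_markov: "markov \<phi> \<Longrightarrow> markov (lslice t \<phi>)"
  using lslice_tensor[of \<phi> 1 1] by (simp add: markov_def lslice_ccontr one)

lemma rslice_mult_left:
  assumes "ccontr \<phi>"
  shows "rslice t \<phi> (t c 1 * u) = c * rslice t \<phi> u"
proof -
  have c: "cblin (rslice t \<phi>)" by (rule ccontr_cblin[OF rslice_ccontr[OF assms]])
  show ?thesis
    by (rule eq_on_tensors[OF cblin_compose[OF c cblin_mult_left[OF cblin_id]] cblin_mult_left[OF c]])
      (simp add: mult rslice_tensor[OF assms] mult_scaleC_right)
qed

lemma lslice_mult_right:
  assumes "ccontr \<phi>"
  shows "lslice t \<phi> (u * t 1 c) = lslice t \<phi> u * c"
proof -
  have c: "cblin (lslice t \<phi>)" by (rule ccontr_cblin[OF lslice_ccontr[OF assms]])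
  show ?thesis
    by (rule eq_on_tensors[OF cblin_compose[OF c cblin_mult_right[OF cblin_id]] cblin_mult_right[OF c]])
      (simp add: mult lslice_tensor[OF assms] mult_scaleC_left)
qed

lemma positive:
  assumes "markov (\<Phi> :: 't \<Rightarrow> complex)"
  shows "Re (\<Phi> (star u * u)) \<ge> 0"
proof -
  obtain \<pi> \<sigma> \<rho> where "tensor_rep \<pi> \<sigma> \<rho> t" using ex_rep by blast
  then interpret tensor_rep \<pi> \<sigma> \<rho> t .
  show ?thesis using R.rep faithful_\<rho> assms by (rule markov_functional_pos)
qed

lemma states_separate_right:
  assumes "\<And>\<phi> :: 'b \<Rightarrow> complex. markov \<phi> \<Longrightarrow> \<phi> b = 0"
  shows "b = 0"
  using ex_rep tensor_rep.right_factor_states_separate assms by blast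

lemma rslices_separate:
  assumes "\<And>\<phi> :: 'b \<Rightarrow> complex. ccontr \<phi> \<Longrightarrow> rslice t \<phi> u = 0"
  shows "u = 0"
proof -
  obtain \<pi> \<sigma> \<rho> where "tensor_rep \<pi> \<sigma> \<rho> t" using ex_rep by blast
  then interpret tensor_rep \<pi> \<sigma> \<rho> t .
  show ?thesis
    by (rule right_slices_separate[of "rslice t"]) (simp_all add: rslice_ccontr rslice_tensor assms)
qed

end

section \<open>Averages, limits and compactness of slices\<close>

context tensor_product
begin

lemma dense_list: "e > 0 \<Longrightarrow> \<exists>ps. norm ((\<Sum>(a, b)\<leftarrow>ps. t a b) - u) < e"
  using scale_left dense by (rule dense_span_list)

lemma rslice_average:
  assumes I: "finite I" "I \<noteq> {}" and f: "\<And>i. i \<in> I \<Longrightarrow> markov (f i :: 'b \<Rightarrow> complex)"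
  shows "rslice t (\<lambda>x. (1 / real (card I)) *\<^sub>R (\<Sum>i\<in>I. f i x)) u
    = (1 / real (card I)) *\<^sub>R (\<Sum>i\<in>I. rslice t (f i) u)"
proof (rule eq_on_tensors)
  have av: "ccontr (\<lambda>x. (1 / real (card I)) *\<^sub>R (\<Sum>i\<in>I. f i x))"
    using markov_average[of I f] I f by (simp add: markov_ccontr)
  then show "cblin (rslice t (\<lambda>x. (1 / real (card I)) *\<^sub>R (\<Sum>i\<in>I. f i x)))"
    by (intro ccontr_cblin rslice_ccontr)
  show "cblin (\<lambda>u. (1 / real (card I)) *\<^sub>R (\<Sum>i\<in>I. rslice t (f i) u))"
    unfolding scaleR_eq_scaleC using f
    by (intro cblin_scale cblin_sum_fun ccontr_cblin rslice_ccontr markov_ccontr)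
  show "rslice t (\<lambda>x. (1 / real (card I)) *\<^sub>R (\<Sum>i\<in>I. f i x)) (t a b)
      = (1 / real (card I)) *\<^sub>R (\<Sum>i\<in>I. rslice t (f i) (t a b))" for a b
    unfolding rslice_tensor[OF av] using f
    by (simp add: rslice_tensor markov_ccontr scaleR_eq_scaleC scaleC_scaleC scaleR_conv_of_real
        flip: complex_vector.scale_sum_left)
qed

text \<open>On finite sums of tensors a slice is a finite combination of values of the state, so
  pointwise convergence suffices there; contractivity makes the approximation of \<open>u\<close> by
  such a sum uniform in \<open>n\<close>.\<close>

lemma rslice_tendsto:
  assumes f: "\<And>n. markov (f n :: 'b \<Rightarrow> complex)" and g: "markov g"
    and lim: "\<And>b. (\<lambda>n. f n b) \<longlonglongrightarrow> g b"
  shows "(\<lambda>n. rslice t (f n) u) \<longlonglongrightarrow> rslice t g u"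
proof (rule LIMSEQ_I)
  fix e :: real assume e: "e > 0"
  obtain ps where ps: "norm ((\<Sum>(a, b)\<leftarrow>ps. t a b) - u) < e / 4"
    using dense_list[of "e / 4" u] e by auto
  define v where "v = (\<Sum>(a, b)\<leftarrow>ps. t a b)"
  have sl: "rslice t \<phi> v = (\<Sum>(a, b)\<leftarrow>ps. \<phi> b *\<^sub>C a)" if "markov \<phi>" for \<phi>
    using that unfolding v_def
    by (simp add: cblin_list_sum ccontr_cblin rslice_ccontr markov_ccontr rslice_tensor)
  have "(\<lambda>n. \<Sum>(a, b)\<leftarrow>ps. f n b *\<^sub>C a) \<longlonglongrightarrow> (\<Sum>(a, b)\<leftarrow>ps. g b *\<^sub>C a)"
  proof (induction ps)
    case (Cons p ps)
    obtain a b where p: "p = (a, b)" by fastforce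
    have "(\<lambda>n. cmod (f n b - g b) * norm a) \<longlonglongrightarrow> cmod (g b - g b) * norm a"
      by (intro tendsto_intros lim)
    then have "(\<lambda>n. norm ((f n b - g b) *\<^sub>C a)) \<longlonglongrightarrow> 0"
      by (simp add: norm_scaleC)
    then have "(\<lambda>n. (f n b - g b) *\<^sub>C a) \<longlonglongrightarrow> 0"
      by (rule tendsto_norm_zero_cancel)
    then have "(\<lambda>n. f n b *\<^sub>C a) \<longlonglongrightarrow> g b *\<^sub>C a"
      by (simp add: complex_vector.scale_left_diff_distrib LIM_zero_iff)
    then show ?case using Cons by (simp add: p tendsto_add)
  qed simp
  then have "(\<lambda>n. rslice t (f n) v) \<longlonglongrightarrow> rslice t g v" by (simp add: sl f g)
  then obtain N where N: "\<And>n. n \<ge> N \<Longrightarrow> norm (rslice t (f n) v - rslice t g v) < e / 4"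
    using LIMSEQ_D[of "\<lambda>n. rslice t (f n) v" "rslice t g v" "e / 4"] e by auto
  have close: "norm (rslice t \<phi> v - rslice t \<phi> u) < e / 4" if "markov \<phi>" for \<phi>
    using ccontr_norm[OF rslice_ccontr[OF markov_ccontr[OF that]], of "v - u"] ps
    by (simp add: v_def cblin_diff ccontr_cblin rslice_ccontr markov_ccontr that)
  have "norm (rslice t (f n) u - rslice t g u) < e" if "n \<ge> N" for n
  proof -
    have "norm (rslice t (f n) u - rslice t g u)
        = norm ((rslice t (f n) v - rslice t g v) + (rslice t g v - rslice t g u)
          - (rslice t (f n) v - rslice t (f n) u))" by simp
    also have "\<dots> \<le> norm (rslice t (f n) v - rslice t g v) + norm (rslice t g v - rslice t g u)
          + norm (rslice t (f n) v - rslice t (f n) u)"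
      using norm_triangle_ineq4[of "(rslice t (f n) v - rslice t g v) + (rslice t g v - rslice t g u)"
          "rslice t (f n) v - rslice t (f n) u"]
        norm_triangle_ineq[of "rslice t (f n) v - rslice t g v" "rslice t g v - rslice t g u"] by linarith
    finally show ?thesis using N[OF that] close[OF g] close[OF f, of n] e by linarith
  qed
  then show "\<exists>N. \<forall>n\<ge>N. norm (rslice t (f n) u - rslice t g u) < e" by blast
qed

text \<open>On a finite sum of tensors the slices lie in a sum of discs \<open>z *\<^sub>C a\<close>
  with \<open>cmod z \<le> norm b\<close>, a compact set independent of the state. Contractivity
  then makes the slices of any \<open>u\<close> totally bounded.\<close>

lemma compact_rslices: "compact (closure {rslice t \<phi> u |\<phi>. markov (\<phi> :: 'b \<Rightarrow> complex)})"
  unfolding compact_eq_totally_bounded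
proof (intro conjI allI impI)
  show "complete (closure {rslice t \<phi> u |\<phi>. markov \<phi>})"
    by (simp add: complete_eq_closed)
  fix e :: real assume e: "e > 0"
  obtain ps where ps: "norm ((\<Sum>(a, b)\<leftarrow>ps. t a b) - u) < e / 4"
    using dense_list[of "e / 4" u] e by auto
  have cpt: "\<exists>C. compact C \<and> (\<forall>\<phi>. markov \<phi> \<longrightarrow> (\<Sum>(a, b)\<leftarrow>ps. \<phi> b *\<^sub>C a) \<in> C)" for ps :: "('a \<times> 'b) list"
  proof (induction ps)
    case Nil
    then show ?case by (intro exI[of _ "{0}"]) simp
  next
    case (Cons p ps)
    obtain a b where p: "p = (a, b)" by fastforce
    from Cons obtain C where C: "compact C" "\<And>\<phi>. markov \<phi> \<Longrightarrow> (\<Sum>(a, b)\<leftarrow>ps. \<phi> b *\<^sub>C a) \<in> C" by blast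
    have "bounded_linear (\<lambda>z. z *\<^sub>C a)"
      by (rule bounded_linear_intro[where K = "norm a"])
        (simp_all add: scaleC_add_left scaleR_eq_scaleC scaleC_scaleC norm_scaleC scaleR_conv_of_real)
    then have "continuous_on (cball 0 (norm b)) (\<lambda>z. z *\<^sub>C a)" by (rule linear_continuous_on)
    then have "compact ((\<lambda>z. z *\<^sub>C a) ` cball 0 (norm b))"
      by (rule compact_continuous_image) simp
    then have "compact {x + y |x y. x \<in> (\<lambda>z. z *\<^sub>C a) ` cball 0 (norm b) \<and> y \<in> C}"
      using C(1) by (rule compact_sums)
    moreover have "(\<Sum>(a, b)\<leftarrow>p # ps. \<phi> b *\<^sub>C a) \<in> {x + y |x y. x \<in> (\<lambda>z. z *\<^sub>C a) ` cball 0 (norm b) \<and> y \<in> C}"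
      if "markov \<phi>" for \<phi>
    proof -
      have "\<phi> b *\<^sub>C a \<in> (\<lambda>z. z *\<^sub>C a) ` cball 0 (norm b)"
        using ccontr_norm[OF markov_ccontr[OF that], of b] by (intro imageI) simp
      then show ?thesis using C(2)[OF that] unfolding p by auto
    qed
    ultimately show ?case by blast
  qed
  then obtain C where C: "compact C" "\<And>\<phi>. markov \<phi> \<Longrightarrow> (\<Sum>(a, b)\<leftarrow>ps. \<phi> b *\<^sub>C a) \<in> C" by metis
  obtain k where k: "finite k" "C \<subseteq> (\<Union>x\<in>k. ball x (e / 4))"
    using C(1) e unfolding compact_eq_totally_bounded by (meson divide_pos_pos zero_less_numeral)
  have "closure {rslice t \<phi> u |\<phi>. markov \<phi>} \<subseteq> (\<Union>x\<in>k. ball x e)"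
  proof
    fix w assume "w \<in> closure {rslice t \<phi> u |\<phi>. markov \<phi>}"
    then obtain \<phi> :: "'b \<Rightarrow> complex" where \<phi>: "markov \<phi>" "dist (rslice t \<phi> u) w < e / 4"
    proof -
      have "\<exists>y\<in>{rslice t \<phi> u |\<phi>. markov \<phi>}. dist y w < e / 4"
        using \<open>w \<in> _\<close>[unfolded closure_approachable, rule_format, of "e / 4"] e by simp
      then show ?thesis using that by blast
    qed
    have c: "ccontr (rslice t \<phi>)" by (rule rslice_ccontr[OF markov_ccontr[OF \<phi>(1)]])
    define r where "r = (\<Sum>(a, b)\<leftarrow>ps. \<phi> b *\<^sub>C a)"
    have "r = rslice t \<phi> (\<Sum>(a, b)\<leftarrow>ps. t a b)"
      by (simp add: r_def cblin_list_sum[OF ccontr_cblin[OF c]] rslice_tensor markov_ccontr \<phi>)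
    then have "dist r (rslice t \<phi> u) < e / 4"
      using ccontr_norm[OF c, of "(\<Sum>(a, b)\<leftarrow>ps. t a b) - u"] ps
      by (simp add: dist_norm cblin_diff[OF ccontr_cblin[OF c]])
    moreover obtain x where x: "x \<in> k" "dist x r < e / 4"
      using C(2)[OF \<phi>(1)] k(2) unfolding r_def[symmetric] by auto
    moreover have "dist x w \<le> dist x r + dist r (rslice t \<phi> u) + dist (rslice t \<phi> u) w"
      using dist_triangle[of x w r] dist_triangle[of r w "rslice t \<phi> u"] by linarith
    ultimately have "dist x w < e" using \<phi>(2) e by linarith
    then show "w \<in> (\<Union>x\<in>k. ball x e)" using x(1) by auto
  qed
  then show "\<exists>k. finite k \<and> closure {rslice t \<phi> u |\<phi>. markov \<phi>} \<subseteq> (\<Union>x\<in>k. ball x e)"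
    using k(1) by blast
qed

end

section \<open>Mean ergodic theorem\<close>

text \<open>The weight is written with \<open>card {..n}\<close>, that is \<open>n + 1\<close>, to
  match \<open>markov_average\<close>.\<close>

definition cesaro :: "('a::real_vector \<Rightarrow> 'a) \<Rightarrow> nat \<Rightarrow> 'a \<Rightarrow> 'a" where
  "cesaro L n x = (1 / real (card {..n})) *\<^sub>R (\<Sum>k\<le>n. (L ^^ k) x)"

text \<open>A limit point \<open>y\<close> of the averages is fixed, because averages of
  \<open>L x - x\<close> telescope. For the whole sequence, compare with \<open>cesaro L m x\<close>
  for an \<open>m\<close> at which it is near \<open>y\<close>: its difference from \<open>x\<close>
  averages to 0, being itself a mean of vectors \<open>(L ^^ j) x - x\<close>.\<close>

lemma cesaro_convergent:
  fixes L :: "'a::real_normed_vector \<Rightarrow> 'a"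
  assumes L: "bounded_linear L" and contr: "\<And>x. norm (L x) \<le> norm x"
    and K: "compact K" "\<And>n. cesaro L n x \<in> K"
  shows "\<exists>y. (\<lambda>n. cesaro L n x) \<longlonglongrightarrow> y \<and> L y = y"
proof -
  have pow_lin: "linear (L ^^ k)" for k
    by (induction k) (auto intro!: linearI simp: linear_simps[OF L] linear_add linear_scale)
  have pow_contr: "norm ((L ^^ k) z) \<le> norm z" for k z
    by (induction k) (auto intro: order_trans contr)
  have avg: "(1 / real (card {..m})) *\<^sub>R (\<Sum>j\<le>m. z) = z" for m :: nat and z :: 'a
    unfolding sum_constant_scaleR by simp
  have ces_add: "cesaro L n (z + w) = cesaro L n z + cesaro L n w" for n z w
    by (simp add: cesaro_def linear_add[OF pow_lin] sum.distrib scaleR_add_right)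
  have ces_scale: "cesaro L n (r *\<^sub>R z) = r *\<^sub>R cesaro L n z" for n r z
    by (simp add: cesaro_def linear_scale[OF pow_lin] scaleR_right.sum[symmetric])
  have ces_contr: "norm (cesaro L n z) \<le> norm z" for n z
  proof -
    have "norm (\<Sum>k\<le>n. (L ^^ k) z) \<le> (\<Sum>k\<le>n. norm z)"
      by (intro order_trans[OF norm_sum] sum_mono pow_contr)
    then show ?thesis by (simp add: cesaro_def field_simps)
  qed
  have ces_comm: "L (cesaro L n z) = cesaro L n (L z)" for n z
    by (simp add: cesaro_def linear_simps[OF L] bounded_linear.linear[OF L] linear_sum funpow_swap1)
  have tele: "cesaro L n (L z - z) = (1 / real (Suc n)) *\<^sub>R ((L ^^ Suc n) z - z)" for n z
  proof -
    have "(\<Sum>k\<le>n. (L ^^ k) (L z - z)) = (\<Sum>k\<le>n. (L ^^ Suc k) z - (L ^^ k) z)"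
      by (simp add: linear_diff[OF pow_lin] funpow_swap1)
    also have "\<dots> = (L ^^ Suc n) z - (L ^^ 0) z" by (induction n) simp_all
    finally show ?thesis by (simp add: cesaro_def)
  qed
  have tele0: "(\<lambda>n. cesaro L n (L z - z)) \<longlonglongrightarrow> 0" for z
  proof (rule Lim_null_comparison)
    show "\<forall>\<^sub>F n in sequentially. norm (cesaro L n (L z - z)) \<le> 2 * norm z * (1 / real (Suc n))"
    proof (rule always_eventually, rule allI)
      fix n
      have "norm ((L ^^ Suc n) z - z) \<le> 2 * norm z"
        using norm_triangle_ineq4[of "(L ^^ Suc n) z" z] pow_contr[of "Suc n" z] by linarith
      then show "norm (cesaro L n (L z - z)) \<le> 2 * norm z * (1 / real (Suc n))"
        unfolding tele norm_scaleR by (simp add: divide_right_mono)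
    qed
    show "(\<lambda>n. 2 * norm z * (1 / real (Suc n))) \<longlonglongrightarrow> 0"
      using tendsto_mult[OF tendsto_const[of "2 * norm z"] lim_1_over_n[THEN LIMSEQ_Suc]] by simp
  qed
  have pow0: "(\<lambda>n. cesaro L n ((L ^^ j) z - z)) \<longlonglongrightarrow> 0" for j z
  proof (induction j)
    case 0
    then show ?case using ces_scale[of _ 0 0] by simp
  next
    case (Suc j)
    have "(L ^^ Suc j) z - z = (L ((L ^^ j) z) - (L ^^ j) z) + ((L ^^ j) z - z)" by simp
    then show ?case
      using tendsto_add[OF tele0[of "(L ^^ j) z"] Suc] by (simp only: ces_add add_0)
  qed
  have mean0: "(\<lambda>n. cesaro L n (cesaro L m z - z)) \<longlonglongrightarrow> 0" for m z
  proof -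
    have "cesaro L m z - z = (1 / real (card {..m})) *\<^sub>R (\<Sum>j\<le>m. (L ^^ j) z - z)"
      unfolding sum_subtractf scaleR_diff_right avg by (simp add: cesaro_def)
    moreover have "cesaro L n (\<Sum>j\<in>J. g j) = (\<Sum>j\<in>J. cesaro L n (g j))" for n and J :: "nat set" and g
      by (rule linear_sum[OF linearI]) (simp_all add: ces_add ces_scale)
    moreover have "(\<lambda>n. (1 / real (card {..m})) *\<^sub>R (\<Sum>j\<le>m. cesaro L n ((L ^^ j) z - z)))
        \<longlonglongrightarrow> (1 / real (card {..m})) *\<^sub>R (\<Sum>j\<le>m. 0)"
      by (intro tendsto_intros pow0)
    ultimately show ?thesis by (simp add: ces_scale)
  qed
  obtain y r where r: "strict_mono r" and y: "(\<lambda>i. cesaro L (r i) x) \<longlonglongrightarrow> y"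
    using K(1)[unfolded compact_def] K(2) unfolding comp_def by meson
  have "(\<lambda>i. L (cesaro L (r i) x) - cesaro L (r i) x) \<longlonglongrightarrow> L y - y"
    by (intro tendsto_diff y bounded_linear.tendsto[OF L])
  moreover have "(\<lambda>i. L (cesaro L (r i) x) - cesaro L (r i) x) \<longlonglongrightarrow> 0"
  proof -
    have "L (cesaro L n x) - cesaro L n x = cesaro L n (L x - x)" for n
      using ces_add[of n "L x - x" x] by (simp add: ces_comm algebra_simps)
    then show ?thesis using LIMSEQ_subseq_LIMSEQ[OF tele0[of x] r] by (simp add: comp_def)
  qed
  ultimately have Ly: "L y = y" using LIMSEQ_unique by fastforce
  have cesy: "cesaro L n y = y" for n
  proof -
    have "(L ^^ k) y = y" for k by (induction k) (auto simp: Ly)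
    then show ?thesis unfolding cesaro_def using avg by simp
  qed
  have "(\<lambda>n. cesaro L n x) \<longlonglongrightarrow> y"
  proof (rule LIMSEQ_I)
    fix e :: real assume e: "e > 0"
    obtain i where i: "norm (cesaro L (r i) x - y) < e / 2"
      using LIMSEQ_D[OF y, of "e / 2"] e by auto
    define m where "m = r i"
    obtain N where N: "\<And>n. n \<ge> N \<Longrightarrow> norm (cesaro L n (cesaro L m x - x)) < e / 2"
      using LIMSEQ_D[OF mean0[of m x], of "e / 2"] e by auto
    have "norm (cesaro L n x - y) < e" if "n \<ge> N" for n
    proof -
      have "cesaro L n x = y + cesaro L n (cesaro L m x - y) + (- 1) *\<^sub>R cesaro L n (cesaro L m x - x)"
        using ces_add[of n "y" "(cesaro L m x - y)"] ces_add[of n "x" "(cesaro L m x - x)"]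
        by (simp add: cesy)
      then have "norm (cesaro L n x - y)
          \<le> norm (cesaro L n (cesaro L m x - y)) + norm (cesaro L n (cesaro L m x - x))"
        using norm_triangle_ineq4[of "cesaro L n (cesaro L m x - y)" "cesaro L n (cesaro L m x - x)"] by simp
      then show ?thesis
        using ces_contr[of n "cesaro L m x - y"] i N[OF that] by (simp add: m_def)
    qed
    then show "\<exists>N. \<forall>n\<ge>N. norm (cesaro L n x - y) < e" by blast
  qed
  with Ly show ?thesis by blast
qed

section \<open>Averaging states on a compact quantum group\<close>

lemma markov_limit:
  assumes f: "\<And>n. markov (f n)" and lim: "\<And>x. (\<lambda>n. f n x) \<longlonglongrightarrow> g x"
  shows "markov g"
  unfolding markov_def
proof (intro conjI ccontrI)
  note lin = markov_cblin[OF f]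
  show "g (x + y) = g x + g y" for x y
    using LIMSEQ_unique[OF lim[of "x + y"]] tendsto_add[OF lim[of x] lim[of y]]
    by (simp add: cblin_add[OF lin])
  show "g (c *\<^sub>C x) = c *\<^sub>C g x" for c x
    using LIMSEQ_unique[OF lim[of "c *\<^sub>C x"]] bounded_linear.tendsto[OF bounded_linear_scaleC lim[of x], of c]
    by (simp add: cblin_scaleC[OF lin])
  show "norm (g x) \<le> norm x" for x
    by (rule LIMSEQ_le_const2[OF tendsto_norm[OF lim]])
      (auto intro: ccontr_norm markov_ccontr f)
  show "g 1 = 1"
    using lim[of 1] by (simp add: markov_one[OF f] LIMSEQ_const_iff)
qed

locale cqg = compact_quantum_group t tl tr \<Delta>
  for t :: "'a::cstar_algebra \<Rightarrow> 'a \<Rightarrow> 'aa::cstar_algebra"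
    and tl :: "'aa \<Rightarrow> 'a \<Rightarrow> 'aaa::cstar_algebra"
    and tr :: "'a \<Rightarrow> 'aa \<Rightarrow> 'aaa"
    and \<Delta> :: "'a \<Rightarrow> 'aa"
begin

sublocale T: tensor_product t
  using tensor_AAA by unfold_locales (simp add: triple_tensor_def)

sublocale TL: tensor_product tl
  using tensor_AAA by unfold_locales (simp add: triple_tensor_def)

sublocale TR: tensor_product tr
  using tensor_AAA by unfold_locales (simp add: triple_tensor_def)

lemma markov_\<Delta>: "markov \<Delta>"
  using star_hom_\<Delta> by (rule star_hom_markov)

lemma cblin_\<Delta>: "cblin \<Delta>"
  by (rule markov_cblin[OF markov_\<Delta>])

text \<open>On functionals this is the convolution product: \<open>\<phi> (conv \<omega> a)\<close>
  is \<open>(\<phi> \<otimes> \<omega>) (\<Delta> a)\<close>.\<close>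

definition conv :: "('a \<Rightarrow> complex) \<Rightarrow> 'a \<Rightarrow> 'a" where
  "conv \<omega> a = rslice t \<omega> (\<Delta> a)"

lemma markov_conv: "markov \<omega> \<Longrightarrow> markov (conv \<omega>)"
  unfolding conv_def[abs_def] by (rule markov_compose[OF T.rslice_markov markov_\<Delta>])

text \<open>Here the two bracketings of the triple tensor product of \<open>A\<close> are
  identified.\<close>

lemma slice_tr:
  assumes "markov \<omega>"
  shows "rslice tl \<omega> (tr a v) = t a (rslice t \<omega> v)"
proof (rule T.eq_on_tensors[of "\<lambda>v. rslice tl \<omega> (tr a v)" "\<lambda>v. t a (rslice t \<omega> v)"])
  show "cblin (\<lambda>v. rslice tl \<omega> (tr a v))"
    by (rule cblin_compose[OF markov_cblin[OF TL.rslice_markov[OF assms]] TR.cblin_right])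
  show "cblin (\<lambda>v. t a (rslice t \<omega> v))"
    by (rule cblin_compose[OF T.cblin_right markov_cblin[OF T.rslice_markov[OF assms]]])
  have "tr a (t b c) = tl (t a b) c" for b c
    using tensor_AAA by (simp add: triple_tensor_def)
  then show "rslice tl \<omega> (tr a (t b c)) = t a (rslice t \<omega> (t b c))" for b c
    using assms by (simp add: TL.rslice_tensor T.rslice_tensor markov_ccontr T.scale_right)
qed

text \<open>Coassociativity, sliced by \<omega> in the last leg and by \<phi> in the middle
  one.\<close>

lemma conv_conv:
  assumes \<phi>: "markov \<phi>" and \<omega>: "markov \<omega>"
  shows "conv \<phi> (conv \<omega> a) = conv (\<lambda>b. \<phi> (conv \<omega> b)) a"
proof -
  obtain F G where F: "is_tensor_hom t tr id \<Delta> F" and G: "is_tensor_hom t tl \<Delta> id G"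
    and FG: "F \<circ> \<Delta> = G \<circ> \<Delta>" using coassociative by blast
  have cF: "cblin F" and cG: "cblin G"
    using F G by (auto simp: is_tensor_hom_def markov_cblin star_hom_markov)
  have \<phi>\<omega>: "markov (\<lambda>b. \<phi> (conv \<omega> b))" by (rule markov_compose[OF \<phi> markov_conv[OF \<omega>]])
  have 1: "rslice t \<phi> (rslice tl \<omega> (F u)) = rslice t (\<lambda>b. \<phi> (conv \<omega> b)) u" for u
  proof (rule T.eq_on_tensors[of "\<lambda>u. rslice t \<phi> (rslice tl \<omega> (F u))"])
    show "cblin (\<lambda>u. rslice t \<phi> (rslice tl \<omega> (F u)))"
      by (rule cblin_compose[OF markov_cblin[OF T.rslice_markov[OF \<phi>]]
            cblin_compose[OF markov_cblin[OF TL.rslice_markov[OF \<omega>]] cF]])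
    show "cblin (rslice t (\<lambda>b. \<phi> (conv \<omega> b)))"
      by (rule markov_cblin[OF T.rslice_markov[OF \<phi>\<omega>]])
    show "rslice t \<phi> (rslice tl \<omega> (F (t a b))) = rslice t (\<lambda>b. \<phi> (conv \<omega> b)) (t a b)" for a b
      using F \<phi> \<omega> \<phi>\<omega> by (simp add: is_tensor_hom_def slice_tr T.rslice_tensor markov_ccontr conv_def)
  qed
  have 2: "rslice tl \<omega> (G u) = \<Delta> (rslice t \<omega> u)" for u
  proof (rule T.eq_on_tensors[of "\<lambda>u. rslice tl \<omega> (G u)" "\<lambda>u. \<Delta> (rslice t \<omega> u)"])
    show "cblin (\<lambda>u. rslice tl \<omega> (G u))"
      by (rule cblin_compose[OF markov_cblin[OF TL.rslice_markov[OF \<omega>]] cG])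
    show "cblin (\<lambda>u. \<Delta> (rslice t \<omega> u))"
      by (rule cblin_compose[OF cblin_\<Delta> markov_cblin[OF T.rslice_markov[OF \<omega>]]])
    show "rslice tl \<omega> (G (t a b)) = \<Delta> (rslice t \<omega> (t a b))" for a b
      using G \<omega> by (simp add: is_tensor_hom_def TL.rslice_tensor T.rslice_tensor markov_ccontr
          cblin_scaleC[OF cblin_\<Delta>])
  qed
  have "F (\<Delta> a) = G (\<Delta> a)" using FG by (metis comp_apply)
  then show ?thesis using 1[of "\<Delta> a"] by (simp add: 2 conv_def)
qed

lemma conv_funpow:
  assumes \<phi>: "markov \<phi>" and \<omega>: "markov \<omega>"
  shows "conv \<phi> ((conv \<omega> ^^ k) a) = conv (\<lambda>b. \<phi> ((conv \<omega> ^^ k) b)) a"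
    and "markov (\<lambda>b. \<phi> ((conv \<omega> ^^ k) b))"
proof -
  have "markov (\<lambda>b. \<phi> ((conv \<omega> ^^ k) b)) \<and>
    (\<forall>a. conv \<phi> ((conv \<omega> ^^ k) a) = conv (\<lambda>b. \<phi> ((conv \<omega> ^^ k) b)) a)"
  proof (induction k)
    case 0
    then show ?case by (simp add: \<phi>)
  next
    case (Suc k)
    then show ?case
      using markov_compose[OF _ markov_conv[OF \<omega>], of "\<lambda>b. \<phi> ((conv \<omega> ^^ k) b)"]
      by (simp add: funpow_swap1 conv_conv \<omega>)
  qed
  then show "conv \<phi> ((conv \<omega> ^^ k) a) = conv (\<lambda>b. \<phi> ((conv \<omega> ^^ k) b)) a"
    and "markov (\<lambda>b. \<phi> ((conv \<omega> ^^ k) b))" by auto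
qed

text \<open>Moving the average into the functional keeps everything a slice of the single element
  \<open>\<Delta> a\<close>, where \<open>compact_rslices\<close> applies.\<close>

lemma cesaro_conv:
  assumes \<omega>: "markov \<omega>"
  shows "markov (cesaro (conv \<omega>) n)"
    and "markov \<phi> \<Longrightarrow> conv \<phi> (cesaro (conv \<omega>) n a) = conv (\<lambda>b. \<phi> (cesaro (conv \<omega>) n b)) a"
proof -
  have pow: "markov (conv \<omega> ^^ k)" for k
  proof (induction k)
    case 0
    then show ?case using markov_id by (simp add: id_def)
  next
    case (Suc k)
    then show ?case using markov_compose[OF markov_conv[OF \<omega>] Suc] by (simp add: comp_def)
  qed
  show "markov (cesaro (conv \<omega>) n)"
    unfolding cesaro_def[abs_def] by (rule markov_average) (auto intro: pow)
  assume \<phi>: "markov \<phi>"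
  have "conv \<phi> (cesaro (conv \<omega>) n a) = (1 / real (card {..n})) *\<^sub>R (\<Sum>k\<le>n. conv \<phi> ((conv \<omega> ^^ k) a))"
    using markov_cblin[OF markov_conv[OF \<phi>]] by (simp add: cesaro_def cblin_scaleR cblin_sum)
  also have "\<dots> = (1 / real (card {..n})) *\<^sub>R (\<Sum>k\<le>n. rslice t (\<lambda>b. \<phi> ((conv \<omega> ^^ k) b)) (\<Delta> a))"
    by (simp only: conv_funpow(1)[OF \<phi> \<omega>]) (simp only: conv_def)
  also have "\<dots> = rslice t (\<lambda>b. (1 / real (card {..n})) *\<^sub>R (\<Sum>k\<le>n. \<phi> ((conv \<omega> ^^ k) b))) (\<Delta> a)"
    by (rule T.rslice_average[symmetric]) (auto intro: conv_funpow(2) \<phi> \<omega>)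
  also have "(\<lambda>b. (1 / real (card {..n})) *\<^sub>R (\<Sum>k\<le>n. \<phi> ((conv \<omega> ^^ k) b))) = (\<lambda>b. \<phi> (cesaro (conv \<omega>) n b))"
    using markov_cblin[OF \<phi>] by (simp add: cesaro_def cblin_scaleR cblin_sum)
  finally show "conv \<phi> (cesaro (conv \<omega>) n a) = conv (\<lambda>b. \<phi> (cesaro (conv \<omega>) n b)) a"
    unfolding conv_def[of "\<lambda>b. \<phi> (cesaro (conv \<omega>) n b)"] .
qed

lemma ex_conv_limit:
  assumes \<omega>: "markov \<omega>"
  obtains E where "markov E" "\<And>a. conv \<omega> (E a) = E a" "\<And>a. E (conv \<omega> a) = E a"
    "\<And>\<phi> a. markov \<phi> \<Longrightarrow> conv \<phi> (E a) = conv (\<lambda>b. \<phi> (E b)) a"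
proof -
  define L where "L = conv \<omega>"
  have L: "markov L" unfolding L_def by (rule markov_conv[OF \<omega>])
  have bL: "bounded_linear L" by (rule cblin_bounded_linear[OF markov_cblin[OF L]])
  have comm: "L (cesaro L n a) = cesaro L n (L a)" for n a
    using markov_cblin[OF L] by (simp add: cesaro_def cblin_scaleR cblin_sum funpow_swap1)
  \<comment> \<open>Averages of \<open>L a\<close> rather than of \<open>a\<close>: each is a slice
    of \<open>\<Delta> a\<close>, which is not known for the term \<open>a\<close> itself.\<close>
  have "\<exists>y. (\<lambda>n. cesaro L n (L a)) \<longlonglongrightarrow> y \<and> L y = y" for a
  proof (rule cesaro_convergent[OF bL])
    show "norm (L x) \<le> norm x" for x by (rule ccontr_norm[OF markov_ccontr[OF L]])
    show "compact (closure {rslice t \<phi> (\<Delta> a) |\<phi>. markov \<phi>})" by (rule T.compact_rslices)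
    show "cesaro L n (L a) \<in> closure {rslice t \<phi> (\<Delta> a) |\<phi>. markov \<phi>}" for n
    proof -
      have "cesaro L n (L a) = rslice t (\<lambda>b. \<omega> (cesaro L n b)) (\<Delta> a)"
        using cesaro_conv(2)[OF \<omega> \<omega>, of n a] by (simp add: comm flip: L_def) (simp add: L_def conv_def)
      moreover have "markov (\<lambda>b. \<omega> (cesaro L n b))"
        unfolding L_def by (rule markov_compose[OF \<omega> cesaro_conv(1)[OF \<omega>]])
      ultimately show ?thesis by (intro subsetD[OF closure_subset]) blast
    qed
  qed
  then obtain E where lim: "\<And>a. (\<lambda>n. cesaro L n (L a)) \<longlonglongrightarrow> E a" and LE: "\<And>a. L (E a) = E a" by metis
  have mk: "markov (\<lambda>a. cesaro L n (L a))" for n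
    unfolding L_def by (rule markov_compose[OF cesaro_conv(1)[OF \<omega>] markov_conv[OF \<omega>]])
  have E: "markov E" by (rule markov_limit[OF mk lim])
  have EL: "E (L a) = E a" for a
  proof -
    have "(\<lambda>n. cesaro L n (L (L a))) \<longlonglongrightarrow> L (E a)"
      using bounded_linear.tendsto[OF bL lim[of a]] by (simp add: comm)
    then show ?thesis using LIMSEQ_unique[OF lim[of "L a"]] by (simp add: LE)
  qed
  have "conv \<phi> (E a) = conv (\<lambda>b. \<phi> (E b)) a" if \<phi>: "markov \<phi>" for \<phi> a
  proof -
    have b\<phi>: "bounded_linear \<phi>" by (rule cblin_bounded_linear[OF markov_cblin[OF \<phi>]])
    have eq: "conv \<phi> (cesaro L n (L a)) = conv (\<lambda>b. \<phi> (cesaro L n (L b))) a" for n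
    proof -
      have "conv \<phi> (cesaro L n (L a)) = conv (\<lambda>b. \<phi> (cesaro L n b)) (conv \<omega> a)"
        unfolding L_def by (rule cesaro_conv(2)[OF \<omega> \<phi>])
      also have "\<dots> = conv (\<lambda>b. \<phi> (cesaro L n (L b))) a"
        unfolding L_def by (rule conv_conv[OF markov_compose[OF \<phi> cesaro_conv(1)[OF \<omega>]] \<omega>])
      finally show ?thesis .
    qed
    have "(\<lambda>n. conv \<phi> (cesaro L n (L a))) \<longlonglongrightarrow> conv \<phi> (E a)"
      by (rule bounded_linear.tendsto[OF cblin_bounded_linear[OF markov_cblin[OF markov_conv[OF \<phi>]]] lim])
    moreover have "(\<lambda>n. conv (\<lambda>b. \<phi> (cesaro L n (L b))) a) \<longlonglongrightarrow> conv (\<lambda>b. \<phi> (E b)) a"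
      unfolding conv_def
      by (rule T.rslice_tendsto) (auto intro: markov_compose[OF \<phi> mk] markov_compose[OF \<phi> E]
          bounded_linear.tendsto[OF b\<phi> lim])
    ultimately show ?thesis unfolding eq by (rule LIMSEQ_unique)
  qed
  with E LE EL show ?thesis unfolding L_def by (rule that)
qed

text \<open>With \<open>b = E a\<close> the variance \<open>(h \<otimes> \<omega>) |\<Delta> b - b \<otimes> 1|\<^sup>2\<close> vanishes, hence so does
  \<open>(h \<otimes> \<phi>) |\<Delta> b - b \<otimes> 1|\<^sup>2\<close> for every member \<open>\<phi>\<close> of the average \<open>\<omega>\<close>. By density of the span
  of \<open>(c \<otimes> 1) \<Delta> a\<close> this forces \<open>\<phi> (E a) = \<omega> (E a)\<close>.\<close>

lemma ex_averaging_state: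
  assumes fin: "finite \<Phi>" and ne: "\<Phi> \<noteq> {}" and mk: "\<And>\<phi>. \<phi> \<in> \<Phi> \<Longrightarrow> markov \<phi>"
  obtains h where "markov h" "\<And>\<phi> a. \<phi> \<in> \<Phi> \<Longrightarrow> \<phi> (conv h a) = h a"
proof -
  define \<omega> where "\<omega> = (\<lambda>a. (1 / real (card \<Phi>)) *\<^sub>R (\<Sum>\<phi>\<in>\<Phi>. \<phi> a))"
  have \<omega>: "markov \<omega>" unfolding \<omega>_def by (rule markov_average[OF fin ne mk])
  obtain E where E: "markov E" and LE: "\<And>a. conv \<omega> (E a) = E a" and EL: "\<And>a. E (conv \<omega> a) = E a"
    and conv_E: "\<And>\<phi> a. markov \<phi> \<Longrightarrow> conv \<phi> (E a) = conv (\<lambda>b. \<phi> (E b)) a"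
    using ex_conv_limit[OF \<omega>] by blast
  define h where "h = (\<lambda>a. \<omega> (E a))"
  have h: "markov h" unfolding h_def by (rule markov_compose[OF \<omega> E])
  have h_conv: "h (conv \<omega> a) = h a" for a by (simp add: h_def EL)
  have conv_h: "conv h a = E a" for a using conv_E[OF \<omega>, of a] by (simp add: h_def LE)
  have slice_mk: "markov (\<lambda>u. h (rslice t \<phi> u))" if "markov \<phi>" for \<phi>
    by (rule markov_compose[OF h T.rslice_markov[OF that]])
  have card: "card \<Phi> > 0" using fin ne by (simp add: card_gt_0_iff)
  have key: "h (c * conv \<phi> (E a)) = h (c * E a)" if \<phi>: "\<phi> \<in> \<Phi>" for \<phi> c a
  proof -
    define b where "b = E a"
    define v where "v = \<Delta> b - t b 1"
    define \<Psi> where "\<Psi> \<phi> u = h (rslice t \<phi> u)" for \<phi> u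
    have \<Psi>: "markov (\<Psi> \<phi>)" if "markov \<phi>" for \<phi>
      unfolding \<Psi>_def[abs_def] by (rule slice_mk[OF that])
    have \<Delta>mult: "\<Delta> (x * y) = \<Delta> x * \<Delta> y" and \<Delta>star: "\<Delta> (star x) = star (\<Delta> x)" for x y
      using star_hom_\<Delta> by (simp_all add: star_hom_def)
    \<comment> \<open>\<open>\<Psi> \<omega>\<close> takes the value \<open>h (star b * b)\<close>
      on all four terms, by \<open>h_conv\<close> for the first and by
      \<open>conv \<omega> b = b\<close> for the mixed ones, so the signs cancel.\<close>
    have "star v * v = \<Delta> (star b * b) - star (t (star b) 1 * \<Delta> b) - t (star b) 1 * \<Delta> b + t (star b * b) 1"
      by (simp add: v_def star_diff T.star star_mult star_star star_one \<Delta>mult \<Delta>star algebra_simps T.mult)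
    moreover have "\<Psi> \<omega> (\<Delta> (star b * b)) = h (star b * b)"
      using h_conv[of "star b * b"] by (simp add: \<Psi>_def conv_def)
    moreover have third: "\<Psi> \<omega> (t (star b) 1 * \<Delta> b) = h (star b * b)"
      using LE[of a] by (simp add: \<Psi>_def T.rslice_mult_left markov_ccontr[OF \<omega>] b_def conv_def)
    moreover have "\<Psi> \<omega> (star (t (star b) 1 * \<Delta> b)) = h (star b * b)"
      using markov_functional_star[OF h, of "star b * b"]
      unfolding markov_functional_star[OF \<Psi>[OF \<omega>]] third by (simp add: star_mult star_star)
    moreover have "\<Psi> \<omega> (t (star b * b) 1) = h (star b * b)"
      by (simp add: \<Psi>_def T.rslice_tensor markov_ccontr[OF \<omega>] markov_one[OF \<omega>])
    ultimately have "\<Psi> \<omega> (star v * v) = 0"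
      using markov_cblin[OF \<Psi>[OF \<omega>]] by (simp add: cblin_diff cblin_add)
    moreover have "\<Psi> \<omega> u = (1 / real (card \<Phi>)) *\<^sub>R (\<Sum>\<phi>\<in>\<Phi>. \<Psi> \<phi> u)" for u
      unfolding \<Psi>_def \<omega>_def using markov_cblin[OF h]
      by (subst T.rslice_average[OF fin ne mk]) (simp_all add: cblin_scaleR cblin_sum)
    ultimately have "(\<Sum>\<phi>\<in>\<Phi>. \<Psi> \<phi> (star v * v)) = 0" using card by simp
    then have "(\<Sum>\<phi>\<in>\<Phi>. Re (\<Psi> \<phi> (star v * v))) = 0" by (metis Re_sum zero_complex.sel(1))
    moreover have "Re (\<Psi> \<phi> (star v * v)) \<ge> 0" if "\<phi> \<in> \<Phi>" for \<phi>
      by (rule T.positive[OF \<Psi>[OF mk[OF that]]])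
    ultimately have "Re (\<Psi> \<phi> (star v * v)) = 0"
      using fin \<phi> by (simp add: sum_nonneg_eq_0_iff)
    moreover have "Im (\<Psi> \<phi> (star v * v)) = 0"
      by (rule markov_functional_selfadj_real[OF \<Psi>[OF mk[OF \<phi>]]]) (simp add: star_mult star_star)
    ultimately have "\<Psi> \<phi> (star v * v) = 0" by (simp add: complex_eq_iff)
    then have "\<Psi> \<phi> (t c 1 * v) = 0"
      by (rule markov_functional_null[OF T.positive[OF \<Psi>[OF mk[OF \<phi>]]] \<Psi>[OF mk[OF \<phi>]]])
    moreover have "t c 1 * v = t c 1 * \<Delta> b - t (c * b) 1"
      by (simp add: v_def right_diff_distrib T.mult)
    moreover have "\<Psi> \<phi> (t c 1 * \<Delta> b) = h (c * conv \<phi> b)"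
      by (simp add: \<Psi>_def T.rslice_mult_left markov_ccontr[OF mk[OF \<phi>]] conv_def)
    moreover have "\<Psi> \<phi> (t (c * b) 1) = h (c * b)"
      by (simp add: \<Psi>_def T.rslice_tensor markov_ccontr[OF mk[OF \<phi>]] markov_one[OF mk[OF \<phi>]])
    ultimately show ?thesis
      using markov_cblin[OF \<Psi>[OF mk[OF \<phi>]]] by (simp add: cblin_diff b_def)
  qed
  have "\<phi> (E a) = h a" if \<phi>: "\<phi> \<in> \<Phi>" for \<phi> a
  proof -
    define \<phi>E where "\<phi>E = (\<lambda>b. \<phi> (E b))"
    have \<phi>E: "markov \<phi>E" unfolding \<phi>E_def by (rule markov_compose[OF mk[OF \<phi>] E])
    \<comment> \<open>The difference of \<open>h \<otimes> \<phi>E\<close> and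
      \<open>h \<otimes> h\<close>. It vanishes on \<open>t c 1 * \<Delta> a\<close> by
      \<open>key\<close>, and its value at \<open>t 1 a\<close> is
      \<open>\<phi> (E a) - h a\<close>.\<close>
    define D where "D u = h (rslice t \<phi>E u) - h (rslice t h u)" for u
    have D: "cblin D"
      unfolding D_def[abs_def] by (intro cblin_minus markov_cblin slice_mk \<phi>E h)
    have D0: "D (t c 1 * \<Delta> a) = 0" for c a
    proof -
      have "rslice t \<phi>E (\<Delta> a) = conv \<phi> (E a)" using conv_E[OF mk[OF \<phi>]] by (simp add: \<phi>E_def conv_def)
      moreover have "rslice t h (\<Delta> a) = E a" using conv_h[of a] by (simp add: conv_def)
      ultimately show ?thesis
        by (simp add: D_def T.rslice_mult_left markov_ccontr \<phi>E h key[OF \<phi>])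
    qed
    \<comment> \<open>\<open>dense_left\<close> has the factor from \<open>A\<close> on the right of
      \<open>\<Delta> a\<close>. Taking stars moves it to the left, and the outer conjugation makes
      the functional linear again.\<close>
    have "cnj (D (star u)) = 0" for u
    proof (rule cblin_eq_on_dense[OF dense_left, of "\<lambda>u. cnj (D (star u))" "\<lambda>u. 0"])
      obtain K where K: "\<And>x. norm (D x) \<le> norm x * K"
        using bounded_linear.bounded[OF cblin_bounded_linear[OF D]] by blast
      show "cblin (\<lambda>u. cnj (D (star u)))"
        by (rule cblinI[where K = K])
          (use K[of "star _"] in \<open>simp_all add: star_add star_scaleC cblin_add[OF D] cblin_scaleC[OF D] norm_star mult.commute\<close>)
      show "cblin (\<lambda>u. 0 :: complex)" by (rule cblinI[where K = 0]) simp_all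
      show "cnj (D (star x)) = 0" if x: "x \<in> {\<Delta> a * t b 1 |a b. True}" for x
      proof -
        obtain a b where "x = \<Delta> a * t b 1" using x by blast
        moreover have "star (\<Delta> a) = \<Delta> (star a)" using star_hom_\<Delta> by (simp add: star_hom_def)
        ultimately show ?thesis by (simp add: star_mult T.star star_one D0)
      qed
    qed
    then have "D (t 1 a) = 0" by (metis complex_cnj_zero_iff star_star)
    then show ?thesis
      by (simp add: D_def T.rslice_tensor markov_ccontr \<phi>E h cblin_scaleC[OF markov_cblin[OF h]] markov_one[OF h])
        (simp add: \<phi>E_def)
  qed
  then show ?thesis using that[OF h] by (simp add: conv_h)
qed

end

section \<open>Ergodic actions on compact spaces\<close>

definition ev :: "'x::topological_space \<Rightarrow> 'x cfun \<Rightarrow> complex" where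
  "ev x f = apply_cfun f x"

lemma markov_ev: "markov (ev x)"
  unfolding markov_def
  by (auto intro!: ccontrI simp: ev_def plus_cfun.rep_eq scaleC_cfun.rep_eq one_cfun.rep_eq cmod_apply_cfun_le)

lemma ev_mult: "ev x (f * g) = ev x f * ev x g"
  by (simp add: ev_def times_cfun.rep_eq)

lemma ev_eqI: "(\<And>x. ev x f = ev x g) \<Longrightarrow> f = g"
  by (rule cfun_eqI) (simp add: ev_def)

locale action = quantum_action t tl tr \<Delta> s sl sr \<alpha>
  for t :: "'a::cstar_algebra \<Rightarrow> 'a \<Rightarrow> 'aa::cstar_algebra"
    and tl :: "'aa \<Rightarrow> 'a \<Rightarrow> 'aaa::cstar_algebra"
    and tr :: "'a \<Rightarrow> 'aa \<Rightarrow> 'aaa"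
    and \<Delta> :: "'a \<Rightarrow> 'aa"
    and s :: "'x::t2_space cfun \<Rightarrow> 'a \<Rightarrow> 'ba::cstar_algebra"
    and sl :: "'ba \<Rightarrow> 'a \<Rightarrow> 'baa::cstar_algebra"
    and sr :: "'x cfun \<Rightarrow> 'aa \<Rightarrow> 'baa"
    and \<alpha> :: "'x cfun \<Rightarrow> 'ba"
begin

sublocale cqg t tl tr \<Delta> by unfold_locales

sublocale S: tensor_product s
  using tensor_BAA by unfold_locales (simp add: triple_tensor_def)

sublocale SL: tensor_product sl
  using tensor_BAA by unfold_locales (simp add: triple_tensor_def)

sublocale SR: tensor_product sr
  using tensor_BAA by unfold_locales (simp add: triple_tensor_def)

text \<open>Evaluation at \<open>x\<close> in \<open>C(X, A)\<close>, so that
  \<open>at_point x (\<alpha> f)\<close> is \<open>\<alpha>\<^sub>x f\<close>.\<close>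

definition at_point :: "'x \<Rightarrow> 'ba \<Rightarrow> 'a" where
  "at_point x = lslice s (ev x)"

lemma markov_at_point: "markov (at_point x)"
  unfolding at_point_def by (rule S.lslice_markov[OF markov_ev])

lemma at_point_tensor: "at_point x (s f a) = ev x f *\<^sub>C a"
  unfolding at_point_def by (rule S.lslice_tensor[OF markov_ccontr[OF markov_ev]])

lemma markov_\<alpha>: "markov \<alpha>"
  using star_hom_\<alpha> by (rule star_hom_markov)

lemma \<alpha>_mult: "\<alpha> (f * g) = \<alpha> f * \<alpha> g"
  using star_hom_\<alpha> by (simp add: star_hom_def)

lemma ev_rslice:
  assumes \<phi>: "ccontr \<phi>"
  shows "ev x (rslice s \<phi> u) = \<phi> (at_point x u)"
proof (rule S.eq_on_tensors[of "\<lambda>u. ev x (rslice s \<phi> u)" "\<lambda>u. \<phi> (at_point x u)"])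
  show "cblin (\<lambda>u. ev x (rslice s \<phi> u))"
    by (rule cblin_compose[OF markov_cblin[OF markov_ev] ccontr_cblin[OF S.rslice_ccontr[OF \<phi>]]])
  show "cblin (\<lambda>u. \<phi> (at_point x u))"
    by (rule cblin_compose[OF ccontr_cblin[OF \<phi>] markov_cblin[OF markov_at_point]])
  show "ev x (rslice s \<phi> (s f a)) = \<phi> (at_point x (s f a))" for f a
    by (simp add: S.rslice_tensor \<phi> at_point_tensor cblin_scaleC[OF ccontr_cblin[OF \<phi>]]
        cblin_scaleC[OF markov_cblin[OF markov_ev]])
qed

lemma at_point_slice_sr:
  assumes \<phi>: "markov \<phi>"
  shows "at_point x (rslice sl \<phi> (sr f v)) = ev x f *\<^sub>C rslice t \<phi> v"
proof (rule T.eq_on_tensors[of "\<lambda>v. at_point x (rslice sl \<phi> (sr f v))" "\<lambda>v. ev x f *\<^sub>C rslice t \<phi> v"])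
  show "cblin (\<lambda>v. at_point x (rslice sl \<phi> (sr f v)))"
    by (rule cblin_compose[OF markov_cblin[OF markov_at_point]
          cblin_compose[OF markov_cblin[OF SL.rslice_markov[OF \<phi>]] SR.cblin_right]])
  show "cblin (\<lambda>v. ev x f *\<^sub>C rslice t \<phi> v)"
    by (rule cblin_scale[OF markov_cblin[OF T.rslice_markov[OF \<phi>]]])
  have "sr f (t b c) = sl (s f b) c" for b c
    using tensor_BAA by (simp add: triple_tensor_def)
  then show "at_point x (rslice sl \<phi> (sr f (t b c))) = ev x f *\<^sub>C rslice t \<phi> (t b c)" for b c
    by (simp add: SL.rslice_tensor T.rslice_tensor markov_ccontr \<phi> at_point_tensor
        cblin_scaleC[OF markov_cblin[OF markov_at_point]] scaleC_scaleC mult.commute)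
qed

text \<open>The coaction identity, sliced by \<phi> in the last leg and evaluated at
  \<open>x\<close>. It turns averaging of functions on \<open>X\<close> into convolution on
  \<open>A\<close>, where \<open>ex_averaging_state\<close> applies.\<close>

lemma at_point_rslice:
  assumes \<phi>: "markov \<phi>"
  shows "at_point x (\<alpha> (rslice s \<phi> (\<alpha> f))) = conv \<phi> (at_point x (\<alpha> f))"
proof -
  obtain F G where F: "is_tensor_hom s sl \<alpha> id F" and G: "is_tensor_hom s sr id \<Delta> G"
    and FG: "F \<circ> \<alpha> = G \<circ> \<alpha>" using coaction by blast
  have cF: "cblin F" and cG: "cblin G"
    using F G by (auto simp: is_tensor_hom_def markov_cblin star_hom_markov)
  have 1: "rslice sl \<phi> (F u) = \<alpha> (rslice s \<phi> u)" for u
  proof (rule S.eq_on_tensors[of "\<lambda>u. rslice sl \<phi> (F u)" "\<lambda>u. \<alpha> (rslice s \<phi> u)"])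
    show "cblin (\<lambda>u. rslice sl \<phi> (F u))"
      by (rule cblin_compose[OF markov_cblin[OF SL.rslice_markov[OF \<phi>]] cF])
    show "cblin (\<lambda>u. \<alpha> (rslice s \<phi> u))"
      by (rule cblin_compose[OF markov_cblin[OF markov_\<alpha>] markov_cblin[OF S.rslice_markov[OF \<phi>]]])
    show "rslice sl \<phi> (F (s f a)) = \<alpha> (rslice s \<phi> (s f a))" for f a
      using F by (simp add: is_tensor_hom_def SL.rslice_tensor S.rslice_tensor markov_ccontr \<phi>
          cblin_scaleC[OF markov_cblin[OF markov_\<alpha>]])
  qed
  have 2: "at_point x (rslice sl \<phi> (G u)) = conv \<phi> (at_point x u)" for u
  proof (rule S.eq_on_tensors[of "\<lambda>u. at_point x (rslice sl \<phi> (G u))" "\<lambda>u. conv \<phi> (at_point x u)"])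
    show "cblin (\<lambda>u. at_point x (rslice sl \<phi> (G u)))"
      by (rule cblin_compose[OF markov_cblin[OF markov_at_point]
            cblin_compose[OF markov_cblin[OF SL.rslice_markov[OF \<phi>]] cG]])
    show "cblin (\<lambda>u. conv \<phi> (at_point x u))"
      by (rule cblin_compose[OF markov_cblin[OF markov_conv[OF \<phi>]] markov_cblin[OF markov_at_point]])
    show "at_point x (rslice sl \<phi> (G (s f a))) = conv \<phi> (at_point x (s f a))" for f a
      using G by (simp add: is_tensor_hom_def at_point_slice_sr \<phi> at_point_tensor
          cblin_scaleC[OF markov_cblin[OF markov_conv[OF \<phi>]]]) (simp add: conv_def)
  qed
  have "F (\<alpha> f) = G (\<alpha> f)" using FG by (metis comp_apply)
  then show ?thesis using 2[of "\<alpha> f"] by (simp flip: 1)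
qed

text \<open>With no state at all, separation would hold vacuously and give
  \<open>1 = 0\<close>.\<close>

lemma ex_state: "\<exists>\<phi> :: 'a \<Rightarrow> complex. markov \<phi>"
  using T.states_separate_right[of 1] by auto

text \<open>For finitely many states take \<open>h\<close> from \<open>ex_averaging_state\<close>
  and \<open>g = rslice s h (\<alpha> f)\<close>: then
  \<open>\<phi> (at_point x (\<alpha> g))\<close> equals \<open>h (at_point x (\<alpha> f))\<close>,
  which is \<open>ev x g\<close>. These conditions are closed in \<open>g\<close>, so compactness
  yields one \<open>g\<close> for all states, and states separate the points of
  \<open>A\<close>.\<close>

lemma fixed_function:
  "\<exists>g \<in> closure {rslice s \<phi> (\<alpha> f) |\<phi>. markov \<phi>}. \<alpha> g = s g 1"
proof -
  define K where "K = closure {rslice s \<phi> (\<alpha> f) |\<phi>. markov \<phi>}"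
  define C where "C \<phi> = {g. \<forall>x. \<phi> (at_point x (\<alpha> g)) = ev x g}" for \<phi> :: "'a \<Rightarrow> complex"
  have "K \<inter> (\<Inter>\<phi>\<in>{\<phi>. markov \<phi>}. C \<phi>) \<noteq> {}"
  proof (rule compact_imp_fip_image)
    show "compact K" unfolding K_def by (rule S.compact_rslices)
    show "closed (C \<phi>)" if "\<phi> \<in> {\<phi>. markov \<phi>}" for \<phi>
    proof -
      have \<phi>: "markov \<phi>" using that by simp
      have "closed {g. \<phi> (at_point x (\<alpha> g)) = ev x g}" for x
      proof (rule closed_Collect_eq)
        have "markov (\<lambda>g. \<phi> (at_point x (\<alpha> g)))"
          by (rule markov_compose[OF \<phi> markov_compose[OF markov_at_point markov_\<alpha>]])
        then show "continuous_on UNIV (\<lambda>g. \<phi> (at_point x (\<alpha> g)))"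
          by (intro linear_continuous_on cblin_bounded_linear markov_cblin)
        show "continuous_on UNIV (ev x)"
          by (intro linear_continuous_on cblin_bounded_linear markov_cblin markov_ev)
      qed
      moreover have "C \<phi> = (\<Inter>x. {g. \<phi> (at_point x (\<alpha> g)) = ev x g})" by (auto simp: C_def)
      ultimately show ?thesis by auto
    qed
    fix I :: "('a \<Rightarrow> complex) set" assume I: "finite I" "I \<subseteq> {\<phi>. markov \<phi>}"
    \<comment> \<open>\<open>ex_averaging_state\<close> requires a nonempty set, and
      \<open>I\<close> may be empty.\<close>
    obtain \<phi>0 :: "'a \<Rightarrow> complex" where "markov \<phi>0" using ex_state by blast
    then obtain h where h: "markov h" "\<And>\<phi> a. \<phi> \<in> insert \<phi>0 I \<Longrightarrow> \<phi> (conv h a) = h a"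
      using I by (rule_tac ex_averaging_state[of "insert \<phi>0 I"]) auto
    define g where "g = rslice s h (\<alpha> f)"
    have "g \<in> {rslice s \<phi> (\<alpha> f) |\<phi>. markov \<phi>}" using h(1) by (auto simp: g_def)
    then have "g \<in> K" unfolding K_def by (rule subsetD[OF closure_subset])
    moreover have "g \<in> C \<phi>" if "\<phi> \<in> I" for \<phi>
      using that by (simp add: C_def g_def at_point_rslice h ev_rslice markov_ccontr)
    ultimately show "K \<inter> (\<Inter>\<phi>\<in>I. C \<phi>) \<noteq> {}" by blast
  qed
  then obtain g where g: "g \<in> K" "\<And>\<phi> x. markov \<phi> \<Longrightarrow> \<phi> (at_point x (\<alpha> g)) = ev x g"
    by (auto simp: C_def)
  have pt: "at_point x (\<alpha> g) = ev x g *\<^sub>C 1" for x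
  proof -
    have "at_point x (\<alpha> g) - ev x g *\<^sub>C 1 = 0"
      by (rule T.states_separate_right)
        (simp add: cblin_diff[OF markov_cblin] cblin_scaleC[OF markov_cblin] g(2) markov_one)
    then show ?thesis by simp
  qed
  have "\<alpha> g - s g 1 = 0"
  proof (rule S.rslices_separate)
    fix \<phi> :: "'a \<Rightarrow> complex" assume \<phi>: "ccontr \<phi>"
    show "rslice s \<phi> (\<alpha> g - s g 1) = 0"
    proof (rule ev_eqI)
      show "ev x (rslice s \<phi> (\<alpha> g - s g 1)) = ev x 0" for x
        by (simp add: ev_rslice \<phi> cblin_diff[OF markov_cblin[OF markov_at_point]] at_point_tensor pt
            cblin_zero[OF ccontr_cblin[OF \<phi>]] cblin_zero[OF markov_cblin[OF markov_ev]])
    qed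
  qed
  with g(1) show ?thesis by (auto simp: K_def)
qed

text \<open>Ergodicity turns the fixed function into a constant \<open>c\<close>. A slice near
  \<open>c\<close> has the value \<open>m f\<close> under \<open>m\<close>, by invariance, and
  \<open>\<phi> (at_point x (\<alpha> f))\<close> at \<open>x\<close>; both lie within
  \<open>e / 2\<close> of \<open>c\<close>.\<close>

lemma invariant_state_le_norm:
  assumes erg: "ergodic s \<alpha>" and m: "markov m" and inv: "\<And>f. lslice s m (\<alpha> f) = m f *\<^sub>C 1"
  shows "cmod (m f) \<le> norm (at_point x (\<alpha> f))"
proof (rule field_le_epsilon)
  fix e :: real assume e: "e > 0"
  obtain g where g: "g \<in> closure {rslice s \<phi> (\<alpha> f) |\<phi>. markov \<phi>}" "\<alpha> g = s g 1"
    using fixed_function by blast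
  from g(2) have "g \<in> range (\<lambda>c. c *\<^sub>C 1)" using erg unfolding ergodic_def by blast
  then obtain c where c: "g = c *\<^sub>C 1" by blast
  obtain y where "y \<in> {rslice s \<phi> (\<alpha> f) |\<phi>. markov \<phi>}" "dist y g < e / 2"
    using g(1)[unfolded closure_approachable, rule_format, of "e / 2"] e by auto
  then obtain \<phi> where \<phi>: "markov \<phi>" "norm (rslice s \<phi> (\<alpha> f) - c *\<^sub>C 1) < e / 2"
    by (auto simp: dist_norm c)
  have near: "cmod (p (rslice s \<phi> (\<alpha> f)) - c) < e / 2" if "markov p" for p :: "'x cfun \<Rightarrow> complex"
    using ccontr_norm[OF markov_ccontr[OF that], of "rslice s \<phi> (\<alpha> f) - c *\<^sub>C 1"] \<phi>(2)
    by (simp add: cblin_diff[OF markov_cblin[OF that]] cblin_scaleC[OF markov_cblin[OF that]] markov_one[OF that])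
  have "m (rslice s \<phi> u) = \<phi> (lslice s m u)" for u
  proof (rule S.eq_on_tensors[of "\<lambda>u. m (rslice s \<phi> u)" "\<lambda>u. \<phi> (lslice s m u)"])
    show "cblin (\<lambda>u. m (rslice s \<phi> u))"
      by (rule cblin_compose[OF markov_cblin[OF m] markov_cblin[OF S.rslice_markov[OF \<phi>(1)]]])
    show "cblin (\<lambda>u. \<phi> (lslice s m u))"
      by (rule cblin_compose[OF markov_cblin[OF \<phi>(1)] markov_cblin[OF S.lslice_markov[OF m]]])
    show "m (rslice s \<phi> (s f a)) = \<phi> (lslice s m (s f a))" for f a
      by (simp add: S.rslice_tensor S.lslice_tensor markov_ccontr m \<phi>(1)
          cblin_scaleC[OF markov_cblin[OF m]] cblin_scaleC[OF markov_cblin[OF \<phi>(1)]])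
  qed
  then have "m (rslice s \<phi> (\<alpha> f)) = m f"
    by (simp add: inv cblin_scaleC[OF markov_cblin[OF \<phi>(1)]] markov_one[OF \<phi>(1)])
  then have "cmod (m f - c) < e / 2" using near[OF m] by simp
  moreover have "cmod (\<phi> (at_point x (\<alpha> f)) - c) < e / 2"
    using near[OF markov_ev, of x] by (simp add: ev_rslice markov_ccontr \<phi>(1))
  moreover have "cmod (\<phi> (at_point x (\<alpha> f))) \<le> norm (at_point x (\<alpha> f))"
    by (rule ccontr_norm[OF markov_ccontr[OF \<phi>(1)]])
  moreover have "cmod (m f) \<le> cmod (m f - c) + cmod (\<phi> (at_point x (\<alpha> f)) - c) + cmod (\<phi> (at_point x (\<alpha> f)))"
    using norm_triangle_ineq[of "m f - c" "c"] norm_triangle_ineq2[of c "\<phi> (at_point x (\<alpha> f))"]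
      norm_minus_commute[of c "\<phi> (at_point x (\<alpha> f))"] by simp
  ultimately show "cmod (m f) \<le> norm (at_point x (\<alpha> f)) + e" by linarith
qed

text \<open>In the limit \<open>f \<rightarrow> 1\<^bsub>{x\<^sub>0}\<^esub>\<close> the element \<open>p = \<alpha>\<^sub>x\<^sub>1 f\<close> satisfies \<open>p = p a / M\<close> with
  \<open>a = (m \<otimes> id) (\<alpha> f (g \<otimes> 1))\<close> of norm at most \<open>r < M\<close>, which forces \<open>p = 0\<close>.\<close>

lemma no_localized_functions:
  assumes erg: "ergodic s \<alpha>" and m: "markov m" and inv: "\<And>f. lslice s m (\<alpha> f) = m f *\<^sub>C 1"
    and r: "0 < r" "r < M" and g1: "ev x1 g = 1" and g: "\<And>k. cmod (m (k * g)) \<le> r * norm k"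
  shows "\<exists>ks \<delta>. \<delta> > 0 \<and> (\<forall>f. norm f \<le> 1 \<longrightarrow> M \<le> cmod (m f) \<longrightarrow>
    \<not> (\<forall>k\<in>set ks. norm (f * k - (m (f * k) / of_real M) *\<^sub>C f) \<le> \<delta>))"
proof -
  \<comment> \<open>The estimates end in \<open>M - r \<le> 3 * e\<close>, which a quarter of
    \<open>M - r\<close> contradicts.\<close>
  define e where "e = (M - r) / 4"
  have e: "e > 0" using r by (simp add: e_def)
  have "\<exists>ps. norm ((\<Sum>(f, a)\<leftarrow>ps. \<alpha> f * s 1 a) - s g 1) < e"
    by (rule dense_span_list[OF _ dense_\<alpha> e])
      (simp add: cblin_scaleC[OF markov_cblin[OF markov_\<alpha>]] mult_scaleC_left)
  then obtain ps where ps: "norm ((\<Sum>(f, a)\<leftarrow>ps. \<alpha> f * s 1 a) - s g 1) < e" by blast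
  define v where "v = (\<Sum>(f, a)\<leftarrow>ps. \<alpha> f * s 1 a)"
  define A where "A = (\<Sum>(f, a)\<leftarrow>ps. norm a)"
  have A: "A \<ge> 0" unfolding A_def by (intro sum_list_nonneg) auto
  \<comment> \<open>Adding 1 guards against \<open>A = 0\<close>; the errors \<delta>, weighted by
    the norms of the coefficients, then sum to at most \<open>e\<close>.\<close>
  define \<delta> where "\<delta> = e / (A + 1)"
  have \<delta>: "\<delta> > 0" "\<delta> * A \<le> e" using e A by (simp_all add: \<delta>_def field_simps)
  define S where "S = lslice s m"
  define R where "R = at_point x1"
  have S: "ccontr S" unfolding S_def by (rule S.lslice_ccontr[OF markov_ccontr[OF m]])
  have R: "ccontr R" unfolding R_def by (rule markov_ccontr[OF markov_at_point])
  have S_mult: "S (u * s 1 c) = S u * c" for u c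
    unfolding S_def by (rule S.lslice_mult_right[OF markov_ccontr[OF m]])
  have R_mult: "R (u * s 1 c) = R u * c" for u c
    unfolding R_def at_point_def by (rule S.lslice_mult_right[OF markov_ccontr[OF markov_ev]])
  have R_g: "R (u * s g 1) = R u" for u
  proof (rule S.eq_on_tensors[of "\<lambda>u. R (u * s g 1)" R])
    show "cblin (\<lambda>u. R (u * s g 1))"
      by (rule cblin_compose[OF ccontr_cblin[OF R] cblin_mult_right[OF cblin_id]])
    show "cblin R" by (rule ccontr_cblin[OF R])
    show "R (s f a * s g 1) = R (s f a)" for f a
      by (simp add: R_def S.mult at_point_tensor ev_mult g1)
  qed
  have S_g: "norm (S (u * s g 1)) \<le> r * norm u" for u
  proof -
    \<comment> \<open>Dividing by \<open>r\<close> makes \<open>m (k * g)\<close> a contraction in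
      \<open>k\<close>; its slice map is then contractive, and the factor \<open>r\<close> comes
      back outside.\<close>
    define \<psi> where "\<psi> k = of_real (1 / r) *\<^sub>C m (k * g)" for k
    have "cblin \<psi>"
      unfolding \<psi>_def[abs_def]
      by (rule cblin_scale[OF cblin_compose[OF markov_cblin[OF m] cblin_mult_right[OF cblin_id]]])
    moreover have "cmod (\<psi> k) \<le> norm k" for k
      using g[of k] r by (simp add: \<psi>_def norm_mult norm_divide field_simps)
    ultimately have \<psi>: "ccontr \<psi>" by (simp add: ccontr_def)
    have "S (u * s g 1) = of_real r *\<^sub>C lslice s \<psi> u"
    proof (rule S.eq_on_tensors[of "\<lambda>u. S (u * s g 1)" "\<lambda>u. of_real r *\<^sub>C lslice s \<psi> u"])
      show "cblin (\<lambda>u. S (u * s g 1))"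
        by (rule cblin_compose[OF ccontr_cblin[OF S] cblin_mult_right[OF cblin_id]])
      show "cblin (\<lambda>u. of_real r *\<^sub>C lslice s \<psi> u)"
        by (rule cblin_scale[OF ccontr_cblin[OF S.lslice_ccontr[OF \<psi>]]])
      show "S (s f a * s g 1) = of_real r *\<^sub>C lslice s \<psi> (s f a)" for f a
        using r by (simp add: S_def S.mult S.lslice_tensor \<psi> markov_ccontr m scaleC_scaleC \<psi>_def)
    qed
    then show ?thesis
      using r ccontr_norm[OF S.lslice_ccontr[OF \<psi>], of u] by (simp add: norm_scaleC)
  qed
  have "False"
    if f: "norm f \<le> 1" "M \<le> cmod (m f)"
      and loc: "\<forall>k\<in>set (map fst ps). norm (f * k - (m (f * k) / of_real M) *\<^sub>C f) \<le> \<delta>" for f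
  proof -
    define p where "p = R (\<alpha> f)"
    have p: "M \<le> norm p" "norm p \<le> 1"
    proof -
      show "M \<le> norm p"
        using f(2) invariant_state_le_norm[OF erg m inv, of f x1] by (simp add: p_def R_def)
      have "norm p \<le> norm (\<alpha> f)" unfolding p_def by (rule ccontr_norm[OF R])
      also have "\<dots> \<le> norm f" by (rule ccontr_norm[OF markov_ccontr[OF markov_\<alpha>]])
      finally show "norm p \<le> 1" using f(1) by simp
    qed
    have nf: "norm (\<alpha> f) \<le> 1"
      using ccontr_norm[OF markov_ccontr[OF markov_\<alpha>], of f] f(1) by simp
    have small: "norm (\<alpha> f * (v - s g 1)) \<le> e"
    proof -
      have "norm (\<alpha> f * (v - s g 1)) \<le> norm (\<alpha> f) * norm (v - s g 1)" by (rule norm_mult_ineq)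
      also have "\<dots> \<le> 1 * e" using nf ps by (intro mult_mono) (auto simp: v_def)
      finally show ?thesis by simp
    qed
    \<comment> \<open>On one summand the deviation is exactly \<open>R (\<alpha> k') * a\<close>,
      where \<open>k'\<close> measures how far multiplying \<open>f\<close> by \<open>k\<close> is
      from scaling it; \<open>loc\<close> bounds its norm by \<delta>.\<close>
    have main: "norm (R (\<alpha> f * (\<Sum>(k, a)\<leftarrow>qs. \<alpha> k * s 1 a))
        - (1 / M) *\<^sub>R (p * S (\<alpha> f * (\<Sum>(k, a)\<leftarrow>qs. \<alpha> k * s 1 a)))) \<le> \<delta> * (\<Sum>(k, a)\<leftarrow>qs. norm a)"
      if "set qs \<subseteq> set ps" for qs
      using that
    proof (induction qs)
      case Nil
      then show ?case by (simp add: cblin_zero ccontr_cblin R S)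
    next
      case (Cons q qs)
      obtain k a where q: "q = (k, a)" by fastforce
      define w where "w = (\<Sum>(k, a)\<leftarrow>qs. \<alpha> k * s 1 a)"
      define k' where "k' = f * k - (m (f * k) / of_real M) *\<^sub>C f"
      have "k \<in> set (map fst ps)" using Cons(2) by (force simp: q)
      then have nk': "norm k' \<le> \<delta>" using loc unfolding k'_def by blast
      have Rk: "R (\<alpha> f * (\<alpha> k * s 1 a)) = R (\<alpha> (f * k)) * a"
        by (simp add: \<alpha>_mult R_mult flip: mult.assoc)
      have Sk: "S (\<alpha> f * (\<alpha> k * s 1 a)) = m (f * k) *\<^sub>C a"
        using S_mult[of "\<alpha> (f * k)" a] inv[of "f * k"]
        by (simp add: \<alpha>_mult mult.assoc mult_scaleC_left flip: S_def)
      have Rf: "R (\<alpha> k') = R (\<alpha> (f * k)) - (m (f * k) / of_real M) *\<^sub>C p"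
        by (simp add: k'_def p_def cblin_diff cblin_scaleC markov_cblin[OF markov_\<alpha>] ccontr_cblin[OF R])
      have eq: "R (\<alpha> f * (\<alpha> k * s 1 a)) - (1 / M) *\<^sub>R (p * S (\<alpha> f * (\<alpha> k * s 1 a))) = R (\<alpha> k') * a"
        unfolding Rk Sk Rf
        by (simp add: left_diff_distrib mult_scaleC_left mult_scaleC_right scaleR_eq_scaleC scaleC_scaleC)
      have "R (\<alpha> f * (\<Sum>(k, a)\<leftarrow>q # qs. \<alpha> k * s 1 a))
          - (1 / M) *\<^sub>R (p * S (\<alpha> f * (\<Sum>(k, a)\<leftarrow>q # qs. \<alpha> k * s 1 a)))
        = (R (\<alpha> f * (\<alpha> k * s 1 a)) - (1 / M) *\<^sub>R (p * S (\<alpha> f * (\<alpha> k * s 1 a))))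
          + (R (\<alpha> f * w) - (1 / M) *\<^sub>R (p * S (\<alpha> f * w)))"
        by (simp add: q distrib_left cblin_add[OF ccontr_cblin[OF R]] cblin_add[OF ccontr_cblin[OF S]]
            scaleR_add_right flip: w_def)
      also have "norm \<dots> \<le> norm (R (\<alpha> k') * a) + norm (R (\<alpha> f * w) - (1 / M) *\<^sub>R (p * S (\<alpha> f * w)))"
        unfolding eq by (rule norm_triangle_ineq)
      also have "norm (R (\<alpha> k') * a) \<le> norm (R (\<alpha> k')) * norm a" by (rule norm_mult_ineq)
      also have "\<dots> \<le> \<delta> * norm a"
        using ccontr_norm[OF ccontr_compose[OF R markov_ccontr[OF markov_\<alpha>]], of k'] nk'
        by (intro mult_right_mono) auto
      also have "norm (R (\<alpha> f * w) - (1 / M) *\<^sub>R (p * S (\<alpha> f * w))) \<le> \<delta> * (\<Sum>(k, a)\<leftarrow>qs. norm a)"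
        using Cons by (simp add: w_def)
      finally show ?case by (simp add: q distrib_left)
    qed
    have "norm (R (\<alpha> f * v) - (1 / M) *\<^sub>R (p * S (\<alpha> f * v))) \<le> e"
      using main[of ps] \<delta> by (simp add: v_def A_def)
    moreover have "norm (R (\<alpha> f * v) - p) \<le> e"
    proof -
      have "R (\<alpha> f * v) - p = R (\<alpha> f * (v - s g 1))"
        by (simp add: right_diff_distrib cblin_diff[OF ccontr_cblin[OF R]] R_g p_def)
      then show ?thesis using ccontr_norm[OF R, of "\<alpha> f * (v - s g 1)"] small by simp
    qed
    moreover have "norm (S (\<alpha> f * v)) \<le> r + e"
    proof -
      have "S (\<alpha> f * v) = S (\<alpha> f * s g 1) + S (\<alpha> f * (v - s g 1))"
        by (simp add: right_diff_distrib cblin_diff[OF ccontr_cblin[OF S]])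
      moreover have "norm (S (\<alpha> f * s g 1)) \<le> r"
        using order_trans[OF S_g[of "\<alpha> f"] mult_left_mono[OF nf, of r]] r by simp
      moreover have "norm (S (\<alpha> f * (v - s g 1))) \<le> e"
        using ccontr_norm[OF S, of "\<alpha> f * (v - s g 1)"] small by simp
      ultimately show ?thesis using norm_triangle_ineq[of "S (\<alpha> f * s g 1)" "S (\<alpha> f * (v - s g 1))"] by simp
    qed
    then have "norm (p * S (\<alpha> f * v)) \<le> norm p * (r + e)"
      using norm_mult_ineq[of p "S (\<alpha> f * v)"] mult_left_mono[of "norm (S (\<alpha> f * v))" "r + e" "norm p"] by simp
    then have "norm ((1 / M) *\<^sub>R (p * S (\<alpha> f * v))) \<le> norm p * ((r + e) / M)"
      using r by (simp add: field_simps)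
    \<comment> \<open>\<open>p\<close> is close to \<open>R (\<alpha> f * v)\<close> because
      \<open>v\<close> is close to \<open>s g 1\<close> and \<open>g\<close> is 1 at
      \<open>x1\<close>; that in turn is close to \<open>p * S (\<alpha> f * v)\<close> divided by
      \<open>M\<close>.\<close>
    moreover have "norm p \<le> norm (R (\<alpha> f * v) - p) + norm (R (\<alpha> f * v) - (1 / M) *\<^sub>R (p * S (\<alpha> f * v)))
        + norm ((1 / M) *\<^sub>R (p * S (\<alpha> f * v)))"
      using norm_triangle_sub[of p "R (\<alpha> f * v)"] norm_minus_commute[of p "R (\<alpha> f * v)"]
        norm_triangle_sub[of "R (\<alpha> f * v)" "(1 / M) *\<^sub>R (p * S (\<alpha> f * v))"] by linarith
    ultimately have "norm p \<le> 2 * e + norm p * ((r + e) / M)" by linarith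
    then have "norm p * (1 - (r + e) / M) \<le> 2 * e" by (simp add: right_diff_distrib)
    moreover have "0 \<le> 1 - (r + e) / M" using r by (simp add: e_def field_simps)
    then have "M * (1 - (r + e) / M) \<le> norm p * (1 - (r + e) / M)"
      using p(1) by (rule mult_right_mono[rotated])
    moreover have "M * (1 - (r + e) / M) = M - r - e" using r by (simp add: field_simps)
    ultimately have "M - r \<le> 3 * e" by linarith
    then show False using r by (simp add: e_def)
  qed
  then show ?thesis using \<delta>(1) by (intro exI[of _ "map fst ps"] exI[of _ \<delta>]) blast
qed

end

section \<open>Atoms of an invariant measure\<close>

text \<open>Urysohn's lemma, a compact Hausdorff space being normal. The real function is kept
  beside \<open>f\<close> for the integral estimates.\<close>

lemma ex_bump:
  fixes x :: "'x::t2_space"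
  assumes cpt: "compact (UNIV :: 'x set)" and U: "open U" "x \<in> U"
  obtains k :: "'x \<Rightarrow> real" and f :: "'x cfun"
  where "continuous_on UNIV k" "\<And>y. 0 \<le> k y" "\<And>y. k y \<le> 1" "k x = 1" "\<And>y. y \<notin> U \<Longrightarrow> k y = 0"
    "apply_cfun f = (\<lambda>y. of_real (k y))"
proof -
  let ?X = "euclidean :: 'x topology"
  have "Hausdorff_space ?X"
    unfolding Hausdorff_space_def disjnt_def using hausdorff by (metis open_openin)
  moreover have "compact_space ?X" using cpt by (simp add: compact_space_def)
  ultimately have "normal_space ?X" using compact_Hausdorff_or_regular_imp_normal_space by blast
  moreover have "closedin ?X (- U)" "closedin ?X {x}" using U(1) by (auto simp: closed_Compl)
  moreover have "disjnt (- U) {x}" using U(2) by (simp add: disjnt_def)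
  ultimately obtain k where k: "continuous_map ?X (top_of_set {0..1::real}) k" "k ` (- U) \<subseteq> {0}" "k ` {x} \<subseteq> {1}"
    using Urysohn_lemma[of ?X "- U" "{x}" 0 1] by (metis zero_le_one)
  have c: "continuous_on UNIV k" using k(1) by (simp add: continuous_map_in_subtopology)
  have k01: "k y \<in> {0..1}" for y using k(1) by (auto simp: continuous_map_in_subtopology)
  have "continuous_on UNIV (\<lambda>y. complex_of_real (k y))" by (intro continuous_intros c)
  moreover have "bounded (range (\<lambda>y. complex_of_real (k y)))"
    unfolding bounded_iff using k01 by (intro exI[of _ 1]) auto
  ultimately have "apply_cfun (Abs_cfun (\<lambda>y. of_real (k y))) = (\<lambda>y. complex_of_real (k y))"
    by (intro Abs_cfun_inverse) simp
  with c k01 k(2,3) show ?thesis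
    by (intro that[of k "Abs_cfun (\<lambda>y. of_real (k y))"]) auto
qed

section \<open>Regular probability measures on a compact space\<close>

locale regular_prob = prob_space \<mu> for \<mu> :: "'x::t2_space measure" +
  assumes regular: "regular_borel_probability \<mu>" and compact_UNIV: "compact (UNIV :: 'x set)"
begin

lemma sets_\<mu> [simp, measurable_cong]: "sets \<mu> = sets borel"
  using regular by (simp add: regular_borel_probability_def)

lemma space_\<mu> [simp]: "space \<mu> = UNIV"
  using sets_eq_imp_space_eq[OF sets_\<mu>] by simp

lemma continuous_measurable:
  "continuous_on UNIV (f :: 'x \<Rightarrow> 'b::topological_space) \<Longrightarrow> f \<in> borel_measurable \<mu>"
  using borel_measurable_continuous_onI by (simp add: measurable_cong_sets[OF sets_\<mu> refl])

lemma integrable_apply_cfun: "integrable \<mu> (apply_cfun f)"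
  by (rule integrable_const_bound[where B = "norm f"])
    (auto intro: continuous_measurable continuous_on_apply_cfun cmod_apply_cfun_le)

definition mean :: "'x cfun \<Rightarrow> complex" where
  "mean f = integral\<^sup>L \<mu> (apply_cfun f)"

lemma cmod_mean_le:
  assumes "integrable \<mu> h" "\<And>y. cmod (apply_cfun f y) \<le> h y"
  shows "cmod (mean f) \<le> integral\<^sup>L \<mu> h"
  unfolding mean_def
  by (rule order_trans[OF integral_norm_bound])
    (use assms in \<open>auto intro!: integral_mono integrable_norm integrable_apply_cfun\<close>)

lemma markov_mean: "markov mean"
  unfolding markov_def
proof (intro conjI ccontrI)
  show "cmod (mean f) \<le> norm f" for f
    using cmod_mean_le[of "\<lambda>_. norm f" f] prob_space by (simp add: cmod_apply_cfun_le)
qed (simp_all add: mean_def plus_cfun.rep_eq scaleC_cfun.rep_eq one_cfun.rep_eq integrable_apply_cfun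
    prob_space[unfolded space_\<mu>])

text \<open>Outer regularity, applied to the singleton.\<close>

lemma ex_open_measure_less:
  assumes "measure \<mu> {x} < r"
  obtains U where "open U" "x \<in> U" "measure \<mu> U < r"
proof -
  have r: "r > 0" using assms measure_nonneg[of \<mu> "{x}"] by linarith
  have "\<forall>E\<in>sets borel. emeasure \<mu> E = (INF U\<in>{U. open U \<and> E \<subseteq> U}. emeasure \<mu> U)"
    using regular unfolding regular_borel_probability_def by blast
  then have "emeasure \<mu> {x} = (INF U\<in>{U. open U \<and> {x} \<subseteq> U}. emeasure \<mu> U)"
    by (rule bspec) simp
  moreover have "emeasure \<mu> {x} < ennreal r"
    using assms r by (simp add: emeasure_eq_measure ennreal_lessI)
  ultimately obtain U where "open U" "x \<in> U" "emeasure \<mu> U < ennreal r"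
    by (auto simp: INF_less_iff)
  then show ?thesis using that[of U] r by (simp add: emeasure_eq_measure ennreal_less_iff)
qed

text \<open>If all points had mass at least \<open>M\<close>, any \<open>n > 1 / M\<close> of them
  would together weigh more than 1.\<close>

lemma ex_small_atom:
  assumes inf: "infinite (UNIV :: 'x set)" and M: "M > 0"
  shows "\<exists>x. measure \<mu> {x} < M"
proof (rule ccontr)
  assume "\<nexists>x. measure \<mu> {x} < M"
  then have ge: "M \<le> measure \<mu> {x}" for x by (meson not_le)
  obtain n :: nat where n: "1 / M < n" using reals_Archimedean2 by blast
  obtain F :: "'x set" where F: "finite F" "card F = n"
    using infinite_arbitrarily_large[OF inf] by blast
  have "1 < real n * M" using n M by (simp add: field_simps)
  also have "\<dots> = (\<Sum>x\<in>F. M)" using F by simp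
  also have "\<dots> \<le> (\<Sum>x\<in>F. measure \<mu> {x})" by (intro sum_mono ge)
  also have "\<dots> = measure \<mu> F" by (rule finite_measure_eq_sum_singleton[symmetric]) (use F in auto)
  also have "\<dots> \<le> 1" by (rule prob_le_1)
  finally show False by simp
qed

lemma integrable_bounded_continuous:
  assumes "continuous_on UNIV k" "\<And>y. 0 \<le> k y" "\<And>y. k y \<le> (1::real)"
  shows "integrable \<mu> k"
  by (rule integrable_const_bound[where B = 1]) (use assms in \<open>auto intro: continuous_measurable\<close>)

lemma integral_le_measure:
  assumes "continuous_on UNIV k" "\<And>y. 0 \<le> k y" "\<And>y. k y \<le> (1::real)" "open U" "\<And>y. y \<notin> U \<Longrightarrow> k y = 0"
  shows "integral\<^sup>L \<mu> k \<le> measure \<mu> U"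
proof -
  have "integral\<^sup>L \<mu> k \<le> integral\<^sup>L \<mu> (indicator U)"
  proof (rule integral_mono)
    show "integrable \<mu> k" using assms(1-3) by (rule integrable_bounded_continuous)
    show "integrable \<mu> (indicator U :: 'x \<Rightarrow> real)"
      using assms(4) by (simp add: emeasure_eq_measure)
  qed (use assms(3,5) in \<open>auto simp: indicator_def\<close>)
  then show ?thesis using assms(4) by simp
qed

lemma ex_small_bump:
  assumes "measure \<mu> {x} < M"
  obtains g r where "0 < r" "r < M" "apply_cfun g x = 1" "\<And>f. cmod (mean (f * g)) \<le> r * norm f"
proof -
  obtain U where U: "open U" "x \<in> U" "measure \<mu> U < M" using ex_open_measure_less[OF assms] .
  \<comment> \<open>The midpoint stays positive even when \<open>U\<close> is a null set.\<close>
  define r where "r = (measure \<mu> U + M) / 2"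
  have r: "measure \<mu> U < r" "r < M" using U(3) by (simp_all add: r_def)
  then have "0 < r" using measure_nonneg[of \<mu> U] by linarith
  obtain k g where k: "continuous_on UNIV k" "\<And>y. 0 \<le> k y" "\<And>y. k y \<le> 1" "k x = 1"
    "\<And>y. y \<notin> U \<Longrightarrow> k y = 0" and g: "apply_cfun g = (\<lambda>y. of_real (k y))"
    using ex_bump[OF compact_UNIV U(1,2)] by metis
  have "cmod (mean (f * g)) \<le> r * norm f" for f
  proof -
    have "cmod (mean (f * g)) \<le> integral\<^sup>L \<mu> (\<lambda>y. norm f * k y)"
      by (rule cmod_mean_le)
        (use k in \<open>auto simp: times_cfun.rep_eq g norm_mult intro!: mult_right_mono cmod_apply_cfun_le
          integrable_bounded_continuous integrable_mult_right\<close>)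
    also have "\<dots> = norm f * integral\<^sup>L \<mu> k" by simp
    also have "\<dots> \<le> norm f * r"
      using integral_le_measure[OF k(1-3) U(1) k(5)] r(1) by (intro mult_left_mono) auto
    finally show ?thesis by (simp add: mult.commute)
  qed
  then show ?thesis using \<open>0 < r\<close> r(2) k(4) by (intro that[of r g]) (auto simp: g)
qed

text \<open>A bump at \<open>x\<close>, supported where every \<open>k\<close> is almost
  \<open>k(x)\<close> and where the mass exceeds the atom by little: then \<open>f * k\<close> is
  close to \<open>k(x) f\<close> and \<open>mean f\<close> to \<open>M\<close>, so
  \<open>mean (f * k) / M\<close> is close to \<open>k(x)\<close>.\<close>

lemma ex_localized_function:
  assumes M: "M = measure \<mu> {x}" "M > 0" and \<delta>: "\<delta> > 0"
  obtains f where "norm f \<le> 1" "M \<le> cmod (mean f)"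
    "\<And>k. k \<in> set ks \<Longrightarrow> norm (f * k - (mean (f * k) / of_real M) *\<^sub>C f) \<le> \<delta>"
proof -
  define C where "C = (\<Sum>k\<leftarrow>ks. norm k)"
  have C: "C \<ge> 0" unfolding C_def by (intro sum_list_nonneg) auto
  \<comment> \<open>Splits \<delta>: \<eta> for replacing \<open>k\<close> by its value at
    \<open>x\<close>, and \<open>(1 + C) * \<eta> / M\<close> for replacing
    \<open>mean (f * k) / M\<close> by that value; \<open>C\<close> bounds all these values.\<close>
  define \<eta> where "\<eta> = \<delta> / (1 + (1 + C) / M)"
  have "1 + (1 + C) / M > 0" using C M by (simp add: add_pos_nonneg)
  then have \<eta>: "\<eta> > 0" "\<eta> * (1 + (1 + C) / M) = \<delta>" using \<delta> by (simp_all add: \<eta>_def)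
  obtain V where V: "open V" "x \<in> V" "measure \<mu> V < M + \<eta>"
  proof -
    have "measure \<mu> {x} < M + \<eta>" using M(1) \<eta>(1) by simp
    then show ?thesis using ex_open_measure_less that by blast
  qed
  define W where "W = V \<inter> (\<Inter>k\<in>set ks. {y. cmod (apply_cfun k y - apply_cfun k x) < \<eta>})"
  have "open {y. cmod (apply_cfun k y - apply_cfun k x) < \<eta>}" for k
    by (intro open_Collect_less continuous_intros continuous_on_apply_cfun)
  then have W: "open W" "x \<in> W" using V \<eta>(1) by (auto simp: W_def intro!: open_Int open_INT)
  obtain u f where u: "continuous_on UNIV u" "\<And>y. 0 \<le> u y" "\<And>y. u y \<le> 1" "u x = 1"
    "\<And>y. y \<notin> W \<Longrightarrow> u y = 0" and f: "apply_cfun f = (\<lambda>y. of_real (u y))"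
    using ex_bump[OF compact_UNIV W] by metis
  have int_u: "integrable \<mu> u" by (rule integrable_bounded_continuous[OF u(1-3)])
  have mean_f: "mean f = of_real (integral\<^sup>L \<mu> u)" by (simp add: mean_def f)
  have "integral\<^sup>L \<mu> (indicator {x}) \<le> integral\<^sup>L \<mu> u"
  proof (rule integral_mono)
    show "integrable \<mu> (indicator {x} :: 'x \<Rightarrow> real)" by (simp add: emeasure_eq_measure)
  qed (use u(2,4) int_u in \<open>auto simp: indicator_def\<close>)
  then have lower: "M \<le> integral\<^sup>L \<mu> u" by (simp add: M(1))
  have "integral\<^sup>L \<mu> u \<le> measure \<mu> V"
    by (rule integral_le_measure[OF u(1-3) V(1)]) (use u(5) in \<open>auto simp: W_def\<close>)
  then have upper: "integral\<^sup>L \<mu> u - M \<le> \<eta>" using V(3) by simp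
  have nf: "norm f \<le> 1" using u by (intro norm_cfun_leI) (simp add: f)
  note lin = cblin_diff[OF markov_cblin[OF markov_mean]] cblin_scaleC[OF markov_cblin[OF markov_mean]]
  have loc: "norm (f * k - (mean (f * k) / of_real M) *\<^sub>C f) \<le> \<delta>" if k: "k \<in> set ks" for k
  proof -
    define c where "c = apply_cfun k x"
    define d where "d = mean (f * k) / of_real M"
    have "cmod c \<le> norm k" by (simp add: c_def cmod_apply_cfun_le)
    also have "norm k \<le> C" unfolding C_def by (rule member_le_sum_list) (use k in auto)
    finally have cC: "cmod c \<le> C" .
    have near: "u y * cmod (apply_cfun k y - c) \<le> \<eta>" for y
    proof (cases "y \<in> W")
      case True
      then have "cmod (apply_cfun k y - c) \<le> \<eta>" using k by (auto simp: W_def c_def)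
      then show ?thesis using mult_mono[of "u y" 1 "cmod (apply_cfun k y - c)" \<eta>] u \<eta>(1) by simp
    next
      case False
      then show ?thesis using u(5) \<eta>(1) by simp
    qed
    have "norm (f * k - c *\<^sub>C f) \<le> \<eta>"
    proof (rule norm_cfun_leI)
      fix y
      have "apply_cfun (f * k - c *\<^sub>C f) y = of_real (u y) * (apply_cfun k y - c)"
        by (simp add: minus_cfun.rep_eq times_cfun.rep_eq scaleC_cfun.rep_eq f algebra_simps)
      then show "cmod (apply_cfun (f * k - c *\<^sub>C f) y) \<le> \<eta>"
        using near[of y] u(2)[of y] by (simp add: norm_mult)
    qed
    then have 1: "cmod (mean (f * k) - c * mean f) \<le> \<eta>"
      using ccontr_norm[OF markov_ccontr[OF markov_mean], of "f * k - c *\<^sub>C f"] by (simp add: lin)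
    have "cmod (mean f - of_real M) \<le> \<eta>"
      using lower upper unfolding mean_f by (simp flip: of_real_diff)
    then have 2: "cmod (c * mean f - c * of_real M) \<le> C * \<eta>"
      using mult_mono[OF cC, of "cmod (mean f - of_real M)" \<eta>] C
      by (simp flip: right_diff_distrib add: norm_mult)
    have "cmod (mean (f * k) - c * of_real M) \<le> (1 + C) * \<eta>"
      using norm_triangle_ineq[of "mean (f * k) - c * mean f" "c * mean f - c * of_real M"] 1 2
      by (simp add: algebra_simps)
    moreover have "d - c = (mean (f * k) - c * of_real M) / of_real M"
      using M by (simp add: d_def field_simps)
    ultimately have dc: "cmod (d - c) \<le> (1 + C) * \<eta> / M"
      using M by (simp add: norm_divide divide_right_mono)
    have "norm (f * k - d *\<^sub>C f) \<le> \<eta> + (1 + C) * \<eta> / M"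
    proof -
      have "f * k - d *\<^sub>C f = (f * k - c *\<^sub>C f) - (d - c) *\<^sub>C f"
        by (simp add: complex_vector.scale_left_diff_distrib)
      then have "norm (f * k - d *\<^sub>C f) \<le> norm (f * k - c *\<^sub>C f) + cmod (d - c) * norm f"
        using norm_triangle_ineq4 norm_scaleC by metis
      also have "\<dots> \<le> \<eta> + (1 + C) * \<eta> / M * 1"
        using \<open>norm (f * k - c *\<^sub>C f) \<le> \<eta>\<close> dc nf order_trans[OF norm_ge_zero dc]
        by (intro add_mono mult_mono) auto
      finally show ?thesis by simp
    qed
    also have "\<dots> = \<delta>" using \<eta>(2) by (simp add: algebra_simps add_divide_distrib)
    finally show ?thesis by (simp add: d_def)
  qed
  have "M \<le> cmod (mean f)" using lower M by (simp add: mean_f)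
  with nf loc show ?thesis using that by blast
qed

end

theorem theorem4p25:
  fixes t :: "'a::cstar_algebra \<Rightarrow> 'a \<Rightarrow> 'aa::cstar_algebra"
    and tl :: "'aa \<Rightarrow> 'a \<Rightarrow> 'aaa::cstar_algebra"
    and tr :: "'a \<Rightarrow> 'aa \<Rightarrow> 'aaa"
    and \<Delta> :: "'a \<Rightarrow> 'aa"
    and s :: "'x::t2_space cfun \<Rightarrow> 'a \<Rightarrow> 'ba::cstar_algebra"
    and sl :: "'ba \<Rightarrow> 'a \<Rightarrow> 'baa::cstar_algebra"
    and sr :: "'x cfun \<Rightarrow> 'aa \<Rightarrow> 'baa"
    and \<alpha> :: "'x cfun \<Rightarrow> 'ba"
    and \<mu> :: "'x measure"
  assumes "quantum_action t tl tr \<Delta> s sl sr \<alpha>"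
    and "ergodic s \<alpha>"
    and "infinite (UNIV :: 'x set)"
    and "invariant_measure s \<alpha> \<mu>"
  shows "\<forall>x. emeasure \<mu> {x} = 0"
proof (rule ccontr)
  interpret quantum_action t tl tr \<Delta> s sl sr \<alpha> by fact
  interpret action t tl tr \<Delta> s sl sr \<alpha> by unfold_locales
  have reg: "regular_borel_probability \<mu>"
    using assms(4) unfolding invariant_measure_def by blast
  then have "prob_space \<mu>" unfolding regular_borel_probability_def by blast
  then interpret regular_prob \<mu>
    using reg compact_X by (intro regular_prob.intro regular_prob_axioms.intro)
  obtain S0 where S0: "is_slice_map s mean S0" "\<And>f. S0 (\<alpha> f) = mean f *\<^sub>C 1"
    using assms(4) unfolding invariant_measure_def invariant_state_def mean_def[abs_def] by blast
  \<comment> \<open>Invariance is given for some slice map; density of the elementary tensors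
    identifies it with \<open>lslice\<close>.\<close>
  have "lslice s mean u = S0 u" for u
  proof (rule S.eq_on_tensors[of "lslice s mean" S0])
    show "cblin (lslice s mean)" by (rule markov_cblin[OF S.lslice_markov[OF markov_mean]])
    show "cblin S0" using S0(1) by (simp add: is_slice_map_def cblin_def)
    show "lslice s mean (s f a) = S0 (s f a)" for f a
      using S0(1) by (simp add: is_slice_map_def S.lslice_tensor markov_ccontr markov_mean)
  qed
  then have inv: "lslice s mean (\<alpha> f) = mean f *\<^sub>C 1" for f by (simp add: S0(2))
  assume "\<not> (\<forall>x. emeasure \<mu> {x} = 0)"
  then obtain x0 where "measure \<mu> {x0} \<noteq> 0" by (auto simp: emeasure_eq_measure)
  then have M: "measure \<mu> {x0} > 0" using measure_nonneg[of \<mu> "{x0}"] by linarith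
  obtain x1 where "measure \<mu> {x1} < measure \<mu> {x0}" using ex_small_atom[OF assms(3) M] by blast
  then obtain g r where g: "0 < r" "r < measure \<mu> {x0}" "apply_cfun g x1 = 1"
    "\<And>f. cmod (mean (f * g)) \<le> r * norm f"
    by (rule ex_small_bump) blast
  obtain ks \<delta> where "\<delta> > 0" and no: "\<And>f. norm f \<le> 1 \<Longrightarrow> measure \<mu> {x0} \<le> cmod (mean f) \<Longrightarrow>
      \<not> (\<forall>k\<in>set ks. norm (f * k - (mean (f * k) / of_real (measure \<mu> {x0})) *\<^sub>C f) \<le> \<delta>)"
    using no_localized_functions[OF assms(2) markov_mean inv g(1,2) _ g(4), of x1] g(3)
    unfolding ev_def by blast
  obtain f where "norm f \<le> 1" "measure \<mu> {x0} \<le> cmod (mean f)"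
    "\<And>k. k \<in> set ks \<Longrightarrow> norm (f * k - (mean (f * k) / of_real (measure \<mu> {x0})) *\<^sub>C f) \<le> \<delta>"
    by (rule ex_localized_function[OF refl M \<open>\<delta> > 0\<close>, of ks]) blast
  with no show False by blast
qed

end
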